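(* Let $m>n\ge1$, $1\le k\le m$ and $(F,D)\in\Lambda_{k,n}$. The standard monomials $\Delta_{\mathsf t}$ with $\mathsf t\in\mathcal{T}_m^n(F,D)$, as $\mathbb{C}$-basis elements of $\mathcal{B}_{m,k}^n(F,D)$, are the highest weight vectors of the copies of $\rho_n^D$ in $\rho_m^F$ (each $\Delta_{\mathsf t}$ is a $GL_n$-highest weight vector of weight $D$ in $\rho_m^F$). Therefore $$\mathcal{B}_{m,k}^n(F,D)\cong\mathrm{Hom}_{GL_n}(\rho_n^D,\rho_m^F).$$
   Context: Young diagrams are identified with weakly decreasing sequences $F=(f_1,f_2,\dots)$ of non-negative integers with finitely many nonzero terms; $\ell(F)$ is the number of nonzero terms, $F^t$ is the conjugate diagram, $F\supseteq D$ means $f_r\ge d_r$ for all $r$. $\Lambda_{a,b}=\{(F,D):\ell(F)\le a,\ \ell(D)\le b,\ F\supseteq D\}$. The group $GL_m\times GL_k$ acts on the space $\mathsf{M}_{m,k}$ of complex $m\times k$ matrices by $(g_1,g_2)\cdot Q=(g_1^t)^{-1}Qg_2^{-1}$, hence on $\mathbb{C}[\mathsf{M}_{m,k}]$ by $(g\cdot f)(Q)=f(g^{-1}\cdot Q)$. $U_r\subset GL_r$ is the group of upper triangular matrices with $1$'s on the diagonal and $A_r\subset GL_r$ the diagonal subgroup. $GL_n$ is embedded in $GL_m$ by $X\mapsto\begin{bmatrix}X&0\\0&I\end{bmatrix}$. By $GL_m$-$GL_k$ duality, $\mathbb{C}[\mathsf{M}_{m,k}]^{U_k}=\bigoplus_{\ell(F)\le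 k}\rho_m^F$, where the $F$-summand is the space of $A_k$-eigenvectors of weight $\mathrm{diag}(a_1,\dots,a_k)\mapsto a_1^{f_1}\cdots a_k^{f_k}$ and is isomorphic to the irreducible polynomial representation $\rho_m^F$ of $GL_m$ with highest weight $F$. Put $\mathcal{B}_{m,k}^n=\mathbb{C}[\mathsf{M}_{m,k}]^{U_n\times U_k}$; its component $\mathcal{B}_{m,k}^n(F,D)$ is the subspace of $(\rho_m^F)^{U_n}$ on which $\mathrm{diag}(a_1,\dots,a_n)\in A_n\subset GL_n$ acts by $a_1^{d_1}\cdots a_n^{d_n}$. $\mathcal{L}_m$ is the set of nonempty subsets $I=[i_1,\dots,i_a]$, $i_1<\cdots<i_a$, of $\{1,\dots,m\}$, with $|I|=a$, ordered by: $I\preceq J$ iff $|I|\ge|J|$ and the $c$-th smallest element of $I$ is $\le$ the $c$-th smallest element of $J$ for $1\le c\le|J|$. $\mathcal{L}_m^n\subset\mathcal{L}_m$ consists of the sets $[1,2,\dots,r,a_1,\dots,a_s]$, $[1,2,\dots,r]$, $[a_1,\dots,a_s]$ with $r\le n$ and $n+1\le a_1<\cdots<a_s\le m$. A standard tableau for $(GL_m,GL_n)$ is a multiple chain (repetitions allowed) $\mathsf t=(I_1\preceq\cdots\preceq I_s)$ in $\mathcal{L}_m^n$; its shape is $F/D$ where $F=(|I_1|,\dots,|I_s|)^t$ and $D=(d_1,\dots,d_n)$ with $d_r$ the number of $c$ with $r\in I_c$. $\mathcal{T}_m^n(F,D)$ is the set of all such tableaux of shape $F/D$. For $I=[i_1,\dots,i_r]$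 with $r\le k$, $\delta_I(Q)$ is the determinant of the submatrix of $Q$ with rows $i_1,\dots,i_r$ and columns $1,\dots,r$, and $\Delta_{\mathsf t}=\delta_{I_1}\cdots\delta_{I_s}$ for $\mathsf t=(I_1\preceq\cdots\preceq I_s)$. *)

theory Defs
  imports
    "Jordan_Normal_Form.Gauss_Jordan_Elimination"
    "Jordan_Normal_Form.Determinant"
    "Jordan_Normal_Form.DL_Submatrix"
    "HOL-Library.Function_Algebras"
begin

text \<open>All indices are shifted to start at \<open>0\<close>, as for the matrices of the library: the rows of an
  \<open>m \<times> k\<close> matrix are \<open>0, \<dots>, m - 1\<close>, the set \<open>{1, \<dots>, m}\<close> becomes \<open>{..<m}\<close>, and the part
  \<open>f\<^sub>r\<close> of a diagram is \<open>F (r - 1)\<close>.\<close>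

subsection \<open>Young diagrams\<close>

definition young :: "(nat \<Rightarrow> nat) \<Rightarrow> bool" where
  "young F \<longleftrightarrow> antimono F \<and> finite {r. F r \<noteq> 0}"

definition ylen :: "(nat \<Rightarrow> nat) \<Rightarrow> nat" where
  "ylen F = card {r. F r \<noteq> 0}"

definition conjugate_diagram :: "(nat \<Rightarrow> nat) \<Rightarrow> nat \<Rightarrow> nat" where
  "conjugate_diagram F r = card {s. r < F s}"

definition Lambda :: "nat \<Rightarrow> nat \<Rightarrow> ((nat \<Rightarrow> nat) \<times> (nat \<Rightarrow> nat)) set" where
  "Lambda a b = {(F, D). young F \<and> young D \<and> ylen F \<le> a \<and> ylen D \<le> b \<and> (\<forall>r. D r \<le> F r)}"

subsection \<open>Standard tableaux\<close>

definition LL :: "nat \<Rightarrow> nat set set" where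
  "LL m = {I. I \<noteq> {} \<and> I \<subseteq> {..<m}}"

definition preceq :: "nat set \<Rightarrow> nat set \<Rightarrow> bool"  (infix "\<preceq>" 50) where
  "I \<preceq> J \<longleftrightarrow> card J \<le> card I \<and>
     (\<forall>c < card J. sorted_list_of_set I ! c \<le> sorted_list_of_set J ! c)"

text \<open>Either part of \<open>I = {..<r} \<union> S\<close> may be empty, but not both.\<close>

definition LLn :: "nat \<Rightarrow> nat \<Rightarrow> nat set set" where
  "LLn m n = {I \<in> LL m. \<exists>r S. r \<le> n \<and> S \<subseteq> {n..<m} \<and> I = {..<r} \<union> S}"

text \<open>A multiple chain is listed in increasing order; as \<open>\<preceq>\<close> is antisymmetric on finite sets,
  the list is determined by the multiset of its members.\<close>

definition standard_tableau :: "nat \<Rightarrow> nat \<Rightarrow> nat set list \<Rightarrow> bool" where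
  "standard_tableau m n t \<longleftrightarrow> set t \<subseteq> LLn m n \<and> sorted_wrt (\<preceq>) t"

definition outer_shape :: "nat set list \<Rightarrow> nat \<Rightarrow> nat" where
  "outer_shape t = conjugate_diagram (\<lambda>c. if c < length t then card (t ! c) else 0)"

definition inner_shape :: "nat \<Rightarrow> nat set list \<Rightarrow> nat \<Rightarrow> nat" where
  "inner_shape n t r = (if r < n then card {c. c < length t \<and> r \<in> t ! c} else 0)"

definition tableaux :: "nat \<Rightarrow> nat \<Rightarrow> (nat \<Rightarrow> nat) \<Rightarrow> (nat \<Rightarrow> nat) \<Rightarrow> nat set list set" where
  "tableaux m n F D = {t. standard_tableau m n t \<and> outer_shape t = F \<and> inner_shape n t = D}"

subsection \<open>Matrix groups\<close>

definition GL :: "nat \<Rightarrow> complex mat set" where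
  "GL r = {g \<in> carrier_mat r r. invertible_mat g}"

definition unipotent :: "nat \<Rightarrow> complex mat set" where
  "unipotent r = {g \<in> GL r. upper_triangular g \<and> (\<forall>i < r. g $$ (i, i) = 1)}"

definition torus :: "nat \<Rightarrow> complex mat set" where
  "torus r = {g \<in> GL r. diagonal_mat g}"

definition torus_char :: "nat \<Rightarrow> (nat \<Rightarrow> nat) \<Rightarrow> complex mat \<Rightarrow> complex" where
  "torus_char r D a = (\<Prod>i < r. (a $$ (i, i)) ^ D i)"

definition embed :: "nat \<Rightarrow> nat \<Rightarrow> complex mat \<Rightarrow> complex mat" where
  "embed m n X = four_block_mat X (0\<^sub>m n (m - n)) (0\<^sub>m (m - n) n) (1\<^sub>m (m - n))"

definition minv :: "complex mat \<Rightarrow> complex mat" where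
  "minv g = the (mat_inverse g)"

subsection \<open>Representations of the general linear group on complex vector spaces\<close>

text \<open>A vector space is a subspace \<open>V\<close> of an ambient type with scalar multiplication \<open>sc\<close>.\<close>

definition linear_on ::
  "(complex \<Rightarrow> 'v \<Rightarrow> 'v) \<Rightarrow> (complex \<Rightarrow> 'w \<Rightarrow> 'w) \<Rightarrow> 'v set \<Rightarrow>
    ('v::ab_group_add \<Rightarrow> 'w::ab_group_add) \<Rightarrow> bool" where
  "linear_on sc sc' V T \<longleftrightarrow>
     (\<forall>x\<in>V. \<forall>y\<in>V. T (x + y) = T x + T y) \<and> (\<forall>c. \<forall>x\<in>V. T (sc c x) = sc' c (T x))"

definition isomorphic_spaces ::
  "(complex \<Rightarrow> 'v::ab_group_add \<Rightarrow> 'v) \<Rightarrow> 'v set \<Rightarrow> (complex \<Rightarrow> 'w::ab_group_add \<Rightarrow> 'w) \<Rightarrow> 'w set \<Rightarrow> bool"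
  where
  "isomorphic_spaces sc V sc' W \<longleftrightarrow> (\<exists>\<phi>. linear_on sc sc' V \<phi> \<and> bij_betw \<phi> V W)"

definition is_basis :: "(complex \<Rightarrow> 'v::ab_group_add \<Rightarrow> 'v) \<Rightarrow> 'v set \<Rightarrow> 'v set \<Rightarrow> bool" where
  "is_basis sc B V \<longleftrightarrow> \<not> Modules.module.dependent sc B \<and> Modules.module.span sc B = V"

definition GL_rep ::
  "nat \<Rightarrow> (complex \<Rightarrow> 'v::ab_group_add \<Rightarrow> 'v) \<Rightarrow> 'v set \<Rightarrow> (complex mat \<Rightarrow> 'v \<Rightarrow> 'v) \<Rightarrow> bool" where
  "GL_rep r sc V \<rho> \<longleftrightarrow>
     vector_space sc \<and> Modules.module.subspace sc V \<and>
     (\<forall>g \<in> GL r. \<rho> g ` V \<subseteq> V \<and> linear_on sc sc V (\<rho> g)) \<and>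
     (\<forall>x\<in>V. \<rho> (1\<^sub>m r) x = x) \<and>
     (\<forall>g \<in> GL r. \<forall>h \<in> GL r. \<forall>x\<in>V. \<rho> (g * h) x = \<rho> g (\<rho> h x))"

definition irreducible_rep ::
  "nat \<Rightarrow> (complex \<Rightarrow> 'v::ab_group_add \<Rightarrow> 'v) \<Rightarrow> 'v set \<Rightarrow> (complex mat \<Rightarrow> 'v \<Rightarrow> 'v) \<Rightarrow> bool" where
  "irreducible_rep r sc V \<rho> \<longleftrightarrow>
     GL_rep r sc V \<rho> \<and> V \<noteq> {0} \<and>
     (\<forall>W. W \<subseteq> V \<and> GL_rep r sc W \<rho> \<longrightarrow> W = {0} \<or> W = V)"

text \<open>The vectors of weight \<open>D\<close> under the diagonal matrices that are fixed by the upper triangular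
  unipotent matrices; the nonzero ones are the highest weight vectors of weight \<open>D\<close>.\<close>

definition hw_space ::
  "nat \<Rightarrow> (complex \<Rightarrow> 'v \<Rightarrow> 'v) \<Rightarrow> 'v set \<Rightarrow> (complex mat \<Rightarrow> 'v \<Rightarrow> 'v) \<Rightarrow> (nat \<Rightarrow> nat) \<Rightarrow> 'v set" where
  "hw_space r sc V \<rho> D =
     {x \<in> V. (\<forall>u \<in> unipotent r. \<rho> u x = x) \<and> (\<forall>a \<in> torus r. \<rho> a x = sc (torus_char r D a) x)}"

definition highest_weight_vector ::
  "nat \<Rightarrow> (complex \<Rightarrow> 'v::zero \<Rightarrow> 'v) \<Rightarrow> 'v set \<Rightarrow> (complex mat \<Rightarrow> 'v \<Rightarrow> 'v) \<Rightarrow> (nat \<Rightarrow> nat) \<Rightarrow> 'v \<Rightarrow> bool"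
  where
  "highest_weight_vector r sc V \<rho> D x \<longleftrightarrow> x \<in> hw_space r sc V \<rho> D \<and> x \<noteq> 0"

text \<open>The intertwining operators; they are set to \<open>0\<close> outside \<open>V\<close>, so that they correspond
  one-to-one to the equivariant linear maps with domain \<open>V\<close>.\<close>

definition HomGL ::
  "nat \<Rightarrow> (complex \<Rightarrow> 'v::ab_group_add \<Rightarrow> 'v) \<Rightarrow> 'v set \<Rightarrow> (complex mat \<Rightarrow> 'v \<Rightarrow> 'v) \<Rightarrow>
    (complex \<Rightarrow> 'w::ab_group_add \<Rightarrow> 'w) \<Rightarrow> 'w set \<Rightarrow> (complex mat \<Rightarrow> 'w \<Rightarrow> 'w) \<Rightarrow> ('v \<Rightarrow> 'w) set" where
  "HomGL r sc V \<rho> sc' W \<sigma> =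
     {T. T ` V \<subseteq> W \<and> (\<forall>x. x \<notin> V \<longrightarrow> T x = 0) \<and> linear_on sc sc' V T \<and>
         (\<forall>g \<in> GL r. \<forall>x\<in>V. T (\<rho> g x) = \<sigma> g (T x))}"

definition isomorphic_reps ::
  "nat \<Rightarrow> (complex \<Rightarrow> 'v::ab_group_add \<Rightarrow> 'v) \<Rightarrow> 'v set \<Rightarrow> (complex mat \<Rightarrow> 'v \<Rightarrow> 'v) \<Rightarrow>
    (complex \<Rightarrow> 'w::ab_group_add \<Rightarrow> 'w) \<Rightarrow> 'w set \<Rightarrow> (complex mat \<Rightarrow> 'w \<Rightarrow> 'w) \<Rightarrow> bool" where
  "isomorphic_reps r sc V \<rho> sc' W \<sigma> \<longleftrightarrow> (\<exists>T \<in> HomGL r sc V \<rho> sc' W \<sigma>. bij_betw T V W)"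

definition pointwise_scale :: "(complex \<Rightarrow> 'w \<Rightarrow> 'w) \<Rightarrow> complex \<Rightarrow> ('v \<Rightarrow> 'w) \<Rightarrow> 'v \<Rightarrow> 'w" where
  "pointwise_scale sc c T = (\<lambda>x. sc c (T x))"

subsection \<open>Polynomial functions on matrices\<close>

text \<open>The polynomial functions on the complex \<open>m \<times> k\<close> matrices, extended by \<open>0\<close> to matrices of
  other dimensions.\<close>

inductive_set poly_funs :: "nat \<Rightarrow> nat \<Rightarrow> (complex mat \<Rightarrow> complex) set" for m k :: nat where
  const: "(\<lambda>Q. if Q \<in> carrier_mat m k then c else 0) \<in> poly_funs m k"
| coord: "i < m \<Longrightarrow> j < k \<Longrightarrow> (\<lambda>Q. if Q \<in> carrier_mat m k then Q $$ (i, j) else 0) \<in> poly_funs m k"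
| add: "f \<in> poly_funs m k \<Longrightarrow> g \<in> poly_funs m k \<Longrightarrow> (\<lambda>Q. f Q + g Q) \<in> poly_funs m k"
| mult: "f \<in> poly_funs m k \<Longrightarrow> g \<in> poly_funs m k \<Longrightarrow> (\<lambda>Q. f Q * g Q) \<in> poly_funs m k"

abbreviation fscale :: "complex \<Rightarrow> (complex mat \<Rightarrow> complex) \<Rightarrow> complex mat \<Rightarrow> complex" where
  "fscale \<equiv> pointwise_scale (*)"

definition mat_act :: "complex mat \<Rightarrow> complex mat \<Rightarrow> complex mat \<Rightarrow> complex mat" where
  "mat_act g\<^sub>1 g\<^sub>2 Q = minv (transpose_mat g\<^sub>1) * Q * minv g\<^sub>2"

definition fun_act ::
  "nat \<Rightarrow> nat \<Rightarrow> complex mat \<Rightarrow> complex mat \<Rightarrow> (complex mat \<Rightarrow> complex) \<Rightarrow> complex mat \<Rightarrow> complex" where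
  "fun_act m k g\<^sub>1 g\<^sub>2 f =
     (\<lambda>Q. if Q \<in> carrier_mat m k then f (mat_act (minv g\<^sub>1) (minv g\<^sub>2) Q) else 0)"

definition GLn_act ::
  "nat \<Rightarrow> nat \<Rightarrow> nat \<Rightarrow> complex mat \<Rightarrow> (complex mat \<Rightarrow> complex) \<Rightarrow> complex mat \<Rightarrow> complex" where
  "GLn_act m k n X = fun_act m k (embed m n X) (1\<^sub>m k)"

text \<open>A finite-dimensional representation is polynomial if its matrix coefficients with respect to
  some basis are polynomials in the entries of the group element.\<close>

definition polynomial_rep ::
  "nat \<Rightarrow> (complex \<Rightarrow> 'v::ab_group_add \<Rightarrow> 'v) \<Rightarrow> 'v set \<Rightarrow> (complex mat \<Rightarrow> 'v \<Rightarrow> 'v) \<Rightarrow> bool" where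
  "polynomial_rep r sc V \<rho> \<longleftrightarrow>
     GL_rep r sc V \<rho> \<and>
     (\<exists>B p. finite B \<and> is_basis sc B V \<and>
        (\<forall>b\<in>B. \<forall>b'\<in>B. p b b' \<in> poly_funs r r) \<and>
        (\<forall>g \<in> GL r. \<forall>b\<in>B. \<rho> g b = (\<Sum>b'\<in>B. sc (p b b' g) b')))"

text \<open>\<open>(V, \<rho>)\<close> is (a model of) the irreducible polynomial representation of highest weight \<open>D\<close>.\<close>

definition irrep_hw ::
  "nat \<Rightarrow> (nat \<Rightarrow> nat) \<Rightarrow> (complex \<Rightarrow> 'v::ab_group_add \<Rightarrow> 'v) \<Rightarrow> 'v set \<Rightarrow> (complex mat \<Rightarrow> 'v \<Rightarrow> 'v) \<Rightarrow> bool"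
  where
  "irrep_hw r D sc V \<rho> \<longleftrightarrow>
     polynomial_rep r sc V \<rho> \<and> irreducible_rep r sc V \<rho> \<and>
     (\<exists>x. highest_weight_vector r sc V \<rho> D x)"

text \<open>The \<open>F\<close>-summand of the functions fixed by the unipotent subgroup of the second factor; it is
  the model of the representation of highest weight \<open>F\<close> of the first factor given by duality.\<close>

definition rho_summand :: "nat \<Rightarrow> nat \<Rightarrow> (nat \<Rightarrow> nat) \<Rightarrow> (complex mat \<Rightarrow> complex) set" where
  "rho_summand m k F = hw_space k fscale (poly_funs m k) (fun_act m k (1\<^sub>m m)) F"

definition B_component ::
  "nat \<Rightarrow> nat \<Rightarrow> nat \<Rightarrow> (nat \<Rightarrow> nat) \<Rightarrow> (nat \<Rightarrow> nat) \<Rightarrow> (complex mat \<Rightarrow> complex) set" where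
  "B_component m k n F D = hw_space n fscale (rho_summand m k F) (GLn_act m k n) D"

definition minor :: "nat set \<Rightarrow> complex mat \<Rightarrow> complex" where
  "minor I Q = det (submatrix Q I {..<card I})"

definition standard_monomial :: "nat \<Rightarrow> nat \<Rightarrow> nat set list \<Rightarrow> complex mat \<Rightarrow> complex" where
  "standard_monomial m k t =
     (\<lambda>Q. if Q \<in> carrier_mat m k then (\<Prod>I\<leftarrow>t. minor I Q) else 0)"

end

theory Submission
  imports Defs
begin

text \<open>A function in \<open>B(F, D)\<close> is invariant under upper unipotent column operations and under lower unipotent
  row operations in the first \<open>n\<close> rows. Write it as a polynomial in the last row \<open>q\<close>, with \<open>m > n\<close>, and order the exponents so
  that late columns dominate. The coefficient of the leading \<open>q\<^sup>\<beta>\<close> is again such a function, with one row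
  less and with \<open>F' = F - \<beta>\<close> in place of \<open>F\<close>, and an \<open>sl\<^sub>2\<close> argument shows that \<open>F'\<close> interlaces \<open>F\<close>. So
  \<open>F / F'\<close> is a horizontal strip, and by Laplace expansion the standard monomial of a tableau of shape
  \<open>F / D\<close> has as its leading coefficient the standard monomial of the tableau without the entries for the last row.
  Induction on \<open>m\<close> gives spanning and independence. For \<open>m = n\<close> the function is determined by its value at
  one matrix, since the \<open>L d U\<close> matrices are dense.

  Let \<open>v\<close> be a highest weight vector of a model \<open>V\<close> of \<open>\<rho>\<^sub>n\<^sup>D\<close> and \<open>f \<in> B(F, D)\<close>. The map \<open>g v \<mapsto> g f\<close> extends
  linearly to \<open>V\<close> if a relation \<open>\<Sum> c\<^sub>i g\<^sub>i v = 0\<close> implies \<open>\<Sum> c\<^sub>i g\<^sub>i f = 0\<close>. For the inner product on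
  homogeneous polynomials of degree \<open>N\<close> with \<open>\<langle>\<langle>r, \<cdot>\<rangle>\<^sup>N, \<langle>r', \<cdot>\<rangle>\<^sup>N\<rangle> = \<langle>r, r'\<rangle>\<^sup>N\<close> the adjoint of \<open>g\<close> is its conjugate
  transpose, so it is enough that \<open>\<Sum> c\<^sub>i \<langle>h g\<^sub>i f, f\<rangle> = 0\<close> for all \<open>h\<close>. The function \<open>g \<mapsto> \<langle>g f, f\<rangle>\<close> is determined
  by its values on the big cell, hence proportional to the weight \<open>D\<close> part of a matrix coefficient of
  \<open>V\<close>, for which the relation holds.\<close>

subsection \<open>Polynomial functions\<close>

text \<open>Highest weight conditions are tested on total arrays, so one type serves every number of
  rows, and on elementary operations, the form in which elimination uses them. The order of
  exponents is carried by the weight with factor \<open>(F 0 + 2) ^ j\<close> in column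
  \<open>j\<close>: the exponents that occur are at most \<open>F 0\<close>, hence digits, and equal
  weight means equal exponent. Subtracting monomials with a given leading term lowers the weight, so
  spanning is an induction on a weight bound inside the induction on \<open>m\<close>. The model
  \<open>V\<close> is abstract and comes without an inner product, so that
  \<open>g v \<mapsto> g f\<close> is well defined has to be shown on the side of functions. There
  positivity is explicit: a homogeneous polynomial is a sum of powers of linear forms, and the form
  on such powers becomes a sum of squares over words of length \<open>N\<close>. The matrix
  coefficient of \<open>V\<close> comes from an arbitrary coordinate functional and mixes several
  weights of the torus acting from the left; the part to be compared is cut out as one power of
  \<open>s\<close> along \<open>diag (1, s, s^2, ...)\<close>.\<close>

inductive_set polyf :: "'i set \<Rightarrow> (('i \<Rightarrow> complex) \<Rightarrow> complex) set" for X where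
  const: "(\<lambda>x. c) \<in> polyf X"
| coord: "i \<in> X \<Longrightarrow> (\<lambda>x. x i) \<in> polyf X"
| add: "f \<in> polyf X \<Longrightarrow> g \<in> polyf X \<Longrightarrow> (\<lambda>x. f x + g x) \<in> polyf X"
| mult: "f \<in> polyf X \<Longrightarrow> g \<in> polyf X \<Longrightarrow> (\<lambda>x. f x * g x) \<in> polyf X"

lemma polyf_sum: "(\<And>a. a \<in> A \<Longrightarrow> f a \<in> polyf X) \<Longrightarrow> (\<lambda>x. \<Sum>a\<in>A. f a x) \<in> polyf X"
  by (induction A rule: infinite_finite_induct) (auto intro: polyf.intros)

lemma polyf_prod: "(\<And>a. a \<in> A \<Longrightarrow> f a \<in> polyf X) \<Longrightarrow> (\<lambda>x. \<Prod>a\<in>A. f a x) \<in> polyf X"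
  by (induction A rule: infinite_finite_induct) (auto intro: polyf.intros)

lemma polyf_uminus: "f \<in> polyf X \<Longrightarrow> (\<lambda>x. - f x) \<in> polyf X"
  using polyf.mult[OF polyf.const[of "-1"]] by fastforce

lemma polyf_diff: "f \<in> polyf X \<Longrightarrow> g \<in> polyf X \<Longrightarrow> (\<lambda>x. f x - g x) \<in> polyf X"
  using polyf.add[OF _ polyf_uminus] by fastforce

lemma polyf_prod_list: "(\<And>a. a \<in> set A \<Longrightarrow> f a \<in> polyf X) \<Longrightarrow> (\<lambda>x. \<Prod>a\<leftarrow>A. f a x) \<in> polyf X"
  by (induction A) (auto intro: polyf.intros)

lemma polyf_cong:
  assumes "f \<in> polyf X" and "\<And>i. i \<in> X \<Longrightarrow> x i = y i"
  shows "f x = f y"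
  using assms(1) by induction (auto simp: assms(2))

lemma polyf_subst:
  assumes "f \<in> polyf X" and "\<And>i. i \<in> X \<Longrightarrow> \<phi> i \<in> polyf Y"
  shows "(\<lambda>y. f (\<lambda>i. \<phi> i y)) \<in> polyf Y"
  using assms(1) by induction (auto intro: polyf.intros assms(2))

text \<open>Restriction to a polynomial curve reduces vanishing arguments to the finiteness of the
  roots of a polynomial in one variable.\<close>

lemma polyf_line:
  assumes "f \<in> polyf X"
  shows "\<exists>p. \<forall>s. f (\<lambda>i. poly (c i) s) = poly p s"
  using assms
proof induction
  case (const a)
  show ?case by (rule exI[of _ "[:a:]"]) simp
next
  case (coord i)
  show ?case by blast
next
  case (add f g)
  then show ?case by (metis poly_add)
next
  case (mult f g)
  then show ?case by (metis poly_mult)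
qed

lemma poly_eq_0_if_cofinite:
  fixes p :: "complex poly"
  assumes "finite A" and "\<And>s. s \<notin> A \<Longrightarrow> poly p s = 0"
  shows "p = 0"
proof (rule ccontr)
  assume "p \<noteq> 0"
  then have "finite {s. poly p s = 0}" by (rule poly_roots_finite)
  moreover have "- A \<subseteq> {s. poly p s = 0}" using assms(2) by auto
  ultimately have "finite (- A)" using finite_subset by blast
  then have "finite (UNIV :: complex set)" using assms(1) by (metis finite_compl)
  then show False using infinite_UNIV_char_0 by blast
qed

text \<open>The exceptional set \<open>A\<close> is there because scaling identities hold for
  \<open>s \<noteq> 0\<close> only.\<close>

lemma coeffs_eq_0_if_cofinite:
  fixes a :: "nat \<Rightarrow> complex"
  assumes "finite A" and "\<And>s. s \<notin> A \<Longrightarrow> (\<Sum>e\<le>M. a e * s ^ e) = 0" and "e \<le> M"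
  shows "a e = 0"
proof -
  let ?p = "\<Sum>e\<le>M. monom (a e) e"
  have "?p = 0"
    by (rule poly_eq_0_if_cofinite[OF assms(1)]) (simp add: poly_sum poly_monom assms(2))
  moreover have "coeff ?p e = a e"
    using assms(3) by (simp add: coeff_sum coeff_monom)
  ultimately show ?thesis by simp
qed

text \<open>With \<open>w\<close> the row index this sorts a matrix coefficient by the powers of
  \<open>s\<close> when \<open>diag (1, s, s^2, ...)\<close> acts from the left. \<open>h e\<close>
  vanishes beyond \<open>M\<close>, so that the expansion of a product is a plain
  convolution.\<close>

lemma polyf_graded:
  assumes "f \<in> polyf X"
  shows "\<exists>M h. (\<forall>e. h e \<in> polyf X) \<and> (\<forall>e x. e > M \<longrightarrow> h e x = 0) \<and>
    (\<forall>s x. f (\<lambda>i. s ^ w i * x i) = (\<Sum>e\<le>M. h e x * s ^ e))"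
  using assms
proof induction
  case (const c)
  show ?case
    by (intro exI[of _ "0::nat"] exI[of _ "\<lambda>e x. if e = 0 then c else 0"])
      (auto intro: polyf.const)
next
  case (coord i)
  have "(\<lambda>x. if e = w i then x i else 0) \<in> polyf X" for e
    by (cases "e = w i") (auto intro: polyf.intros coord)
  then show ?case
    by (intro exI[of _ "w i"] exI[of _ "\<lambda>e x. if e = w i then x i else 0"])
      (auto simp: if_distrib[of "\<lambda>y. y * _"] sum.delta cong: if_cong)
next
  case (add f g)
  then obtain M h N l where fh: "\<forall>e. h e \<in> polyf X" "\<forall>e x. e > M \<longrightarrow> h e x = 0"
      "\<forall>s x. f (\<lambda>i. s ^ w i * x i) = (\<Sum>e\<le>M. h e x * s ^ e)"
    and gl: "\<forall>e. l e \<in> polyf X" "\<forall>e x. e > N \<longrightarrow> l e x = 0"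
      "\<forall>s x. g (\<lambda>i. s ^ w i * x i) = (\<Sum>e\<le>N. l e x * s ^ e)"
    by blast
  have 1: "(\<Sum>e\<le>M. h e x * s ^ e) = (\<Sum>e\<le>max M N. h e x * s ^ e)" for x s
    by (rule sum.mono_neutral_left) (use fh(2) in auto)
  have 2: "(\<Sum>e\<le>N. l e x * s ^ e) = (\<Sum>e\<le>max M N. l e x * s ^ e)" for x s
    by (rule sum.mono_neutral_left) (use gl(2) in auto)
  show ?case
    by (intro exI[of _ "max M N"] exI[of _ "\<lambda>e x. h e x + l e x"])
      (use fh gl in \<open>auto simp: 1 2 sum.distrib distrib_right intro: polyf.intros\<close>)
next
  case (mult f g)
  then obtain M h N l where fh: "\<forall>e. h e \<in> polyf X" "\<forall>e x. e > M \<longrightarrow> h e x = 0"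
      "\<forall>s x. f (\<lambda>i. s ^ w i * x i) = (\<Sum>e\<le>M. h e x * s ^ e)"
    and gl: "\<forall>e. l e \<in> polyf X" "\<forall>e x. e > N \<longrightarrow> l e x = 0"
      "\<forall>s x. g (\<lambda>i. s ^ w i * x i) = (\<Sum>e\<le>N. l e x * s ^ e)"
    by blast
  have *: "(\<Sum>e\<le>M. h e x * s ^ e) * (\<Sum>e\<le>N. l e x * s ^ e) =
      (\<Sum>r\<le>M + N. (\<Sum>k\<le>r. h k x * l (r - k) x) * s ^ r)" for x s
    by (rule polynomial_product) (use fh(2) gl(2) in auto)
  have z: "(\<Sum>k\<le>r. h k x * l (r - k) x) = 0" if "r > M + N" for r x
  proof (rule sum.neutral, intro ballI)
    fix k assume "k \<in> {..r}"
    have "k > M \<or> r - k > N" using that by linarith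
    then show "h k x * l (r - k) x = 0" using fh(2) gl(2) by auto
  qed
  show ?case
    by (intro exI[of _ "M + N"] exI[of _ "\<lambda>e x. \<Sum>k\<le>e. h k x * l (e - k) x"])
      (use fh gl z in \<open>auto simp: * intro!: polyf_sum polyf.mult\<close>)
qed

text \<open>The exponents \<open>\<phi> t\<close> need not be distinct, so only the sums over equal exponents vanish.\<close>

lemma monomials_independent:
  fixes c :: "'t \<Rightarrow> complex"
  assumes "finite I" and "\<And>q :: nat \<Rightarrow> complex. (\<Sum>t\<in>I. c t * (\<Prod>j<k. q j ^ \<phi> t j)) = 0"
  shows "(\<Sum>t | t \<in> I \<and> (\<forall>j<k. \<phi> t j = \<kappa> j). c t) = 0"
  using assms
proof (induction k arbitrary: I)
  case 0
  then show ?case by simp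
next
  case (Suc k)
  define M where "M = Max (insert (\<kappa> k) ((\<lambda>t. \<phi> t k) ` I))"
  have M: "\<kappa> k \<le> M" "\<And>t. t \<in> I \<Longrightarrow> \<phi> t k \<le> M"
    unfolding M_def using Suc.prems(1) by auto
  have "(\<Sum>t\<in>{t \<in> I. \<phi> t k = \<kappa> k}. c t * (\<Prod>j<k. q j ^ \<phi> t j)) = 0" for q
  proof -
    \<comment> \<open>The last variable is set to \<open>s\<close> and the sum is grouped by the
      power of \<open>s\<close>; every group is an identity in one variable less.\<close>
    let ?a = "\<lambda>e. \<Sum>t\<in>{t \<in> I. \<phi> t k = e}. c t * (\<Prod>j<k. q j ^ \<phi> t j)"
    have "(\<Sum>e\<le>M. ?a e * s ^ e) = 0" for s
    proof -
      have "(\<Sum>e\<le>M. ?a e * s ^ e) =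
        (\<Sum>e\<le>M. \<Sum>t\<in>{t \<in> I. \<phi> t k = e}. c t * (\<Prod>j<k. q j ^ \<phi> t j) * s ^ \<phi> t k)"
        by (simp add: sum_distrib_right)
      also have "\<dots> = (\<Sum>t\<in>I. c t * (\<Prod>j<k. q j ^ \<phi> t j) * s ^ \<phi> t k)"
        by (rule sum.group) (use Suc.prems(1) M(2) in auto)
      also have "\<dots> = (\<Sum>t\<in>I. c t * (\<Prod>j<Suc k. (q(k := s)) j ^ \<phi> t j))"
        by (intro sum.cong refl) simp
      also have "\<dots> = 0" by (rule Suc.prems(2))
      finally show ?thesis .
    qed
    from coeffs_eq_0_if_cofinite[of "{}" ?a M, OF _ this M(1)] show ?thesis by simp
  qed
  from Suc.IH[OF _ this] Suc.prems(1)
  have "(\<Sum>t | t \<in> {t \<in> I. \<phi> t k = \<kappa> k} \<and> (\<forall>j<k. \<phi> t j = \<kappa> j). c t) = 0" by simp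
  moreover have "{t. t \<in> {t \<in> I. \<phi> t k = \<kappa> k} \<and> (\<forall>j<k. \<phi> t j = \<kappa> j)} =
      {t. t \<in> I \<and> (\<forall>j<Suc k. \<phi> t j = \<kappa> j)}"
    by (auto simp: less_Suc_eq)
  ultimately show ?case by simp
qed

subsection \<open>Elimination and highest weight functions\<close>

type_synonym array = "nat \<times> nat \<Rightarrow> complex"

text \<open>For \<open>a < b\<close> row operations run downwards, since the group acts through the
  transpose, while column operations run to the right.\<close>

definition rowop :: "nat \<Rightarrow> nat \<Rightarrow> complex \<Rightarrow> array \<Rightarrow> array" where
  "rowop a b s x = (\<lambda>(i, j). x (i, j) + (if i = b then s * x (a, j) else 0))"

definition colop :: "nat \<Rightarrow> nat \<Rightarrow> complex \<Rightarrow> array \<Rightarrow> array" where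
  "colop a b s x = (\<lambda>(i, j). x (i, j) + (if j = b then s * x (i, a) else 0))"

definition rowscale :: "(nat \<Rightarrow> complex) \<Rightarrow> array \<Rightarrow> array" where
  "rowscale c x = (\<lambda>(i, j). c i * x (i, j))"

definition colscale :: "(nat \<Rightarrow> complex) \<Rightarrow> array \<Rightarrow> array" where
  "colscale c x = (\<lambda>(i, j). c j * x (i, j))"

text \<open>Gaussian elimination, where a vanishing pivot is avoided by moving along a line.\<close>

lemma diagonal_dense:
  fixes Z :: "array set"
  assumes line: "\<And>x r. r < n \<Longrightarrow> r < k \<Longrightarrow> (\<And>s. s \<noteq> 0 \<Longrightarrow> x((r, r) := s) \<in> Z) \<Longrightarrow> x \<in> Z"
    and row: "\<And>x a b s. a < b \<Longrightarrow> b < n \<Longrightarrow> rowop a b s x \<in> Z \<Longrightarrow> x \<in> Z"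
    and col: "\<And>x a b s. a < b \<Longrightarrow> b < k \<Longrightarrow> colop a b s x \<in> Z \<Longrightarrow> x \<in> Z"
    and diag: "\<And>x. (\<And>i j. i < n \<Longrightarrow> j < k \<Longrightarrow> i \<noteq> j \<Longrightarrow> x (i, j) = 0) \<Longrightarrow>
      (\<And>i. i < n \<Longrightarrow> i < k \<Longrightarrow> x (i, i) \<noteq> 0) \<Longrightarrow> x \<in> Z"
  shows "x \<in> Z"
proof -
  \<comment> \<open>Row \<open>r\<close> is not in \<open>S\<close>, so the operations for different
    \<open>b\<close> in \<open>S\<close> do not interfere and can be done one at a time.\<close>
  have rows: "x \<in> Z" if "finite S" "S \<subseteq> {r<..<n}"
    "(\<lambda>(i, j). x (i, j) + (if i \<in> S then c i * x (r, j) else 0)) \<in> Z" for S r c x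
    using that
  proof (induction S arbitrary: x rule: finite_induct)
    case empty
    then show ?case by (simp add: case_prod_unfold)
  next
    case (insert b S)
    have b: "r < b" "b < n" "r \<notin> S" using insert.prems(1) by auto
    have "rowop r b (c b) x \<in> Z"
    proof (rule insert.IH)
      show "S \<subseteq> {r<..<n}" using insert.prems(1) by auto
      have "(\<lambda>(i, j). rowop r b (c b) x (i, j) + (if i \<in> S then c i * rowop r b (c b) x (r, j) else 0)) =
        (\<lambda>(i, j). x (i, j) + (if i \<in> insert b S then c i * x (r, j) else 0))"
        using b insert.hyps by (auto simp: rowop_def fun_eq_iff)
      then show "(\<lambda>(i, j). rowop r b (c b) x (i, j) +
          (if i \<in> S then c i * rowop r b (c b) x (r, j) else 0)) \<in> Z"
        using insert.prems by simp
    qed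
    then show ?case using row b by blast
  qed
  have cols: "x \<in> Z" if "finite S" "S \<subseteq> {r<..<k}"
    "(\<lambda>(i, j). x (i, j) + (if j \<in> S then c j * x (i, r) else 0)) \<in> Z" for S r c x
    using that
  proof (induction S arbitrary: x rule: finite_induct)
    case empty
    then show ?case by (simp add: case_prod_unfold)
  next
    case (insert b S)
    have b: "r < b" "b < k" "r \<notin> S" using insert.prems(1) by auto
    have "colop r b (c b) x \<in> Z"
    proof (rule insert.IH)
      show "S \<subseteq> {r<..<k}" using insert.prems(1) by auto
      have "(\<lambda>(i, j). colop r b (c b) x (i, j) + (if j \<in> S then c j * colop r b (c b) x (i, r) else 0)) =
        (\<lambda>(i, j). x (i, j) + (if j \<in> insert b S then c j * x (i, r) else 0))"
        using b insert.hyps by (auto simp: colop_def fun_eq_iff)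
      then show "(\<lambda>(i, j). colop r b (c b) x (i, j) +
          (if j \<in> S then c j * colop r b (c b) x (i, r) else 0)) \<in> Z"
        using insert.prems by simp
    qed
    then show ?case using col b by blast
  qed
  \<comment> \<open>\<open>?D r x\<close>: rows and columns before \<open>r\<close> are cleared
    outside the diagonal, with nonzero pivots. The induction runs downwards from
    \<open>min n k\<close>, where \<open>?D\<close> is the hypothesis of
    \<open>diag\<close>.\<close>
  let ?D = "\<lambda>r (x :: array). (\<forall>i<n. \<forall>j<k. i \<noteq> j \<and> (i < r \<or> j < r) \<longrightarrow> x (i, j) = 0) \<and> (\<forall>i<r. x (i, i) \<noteq> 0)"
  have "\<forall>x. ?D (min n k - d) x \<longrightarrow> x \<in> Z" if "d \<le> min n k" for d
    using that
  proof (induction d)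
    case 0
    show ?case
    proof (intro allI impI)
      fix x :: array assume D: "?D (min n k - 0) x"
      show "x \<in> Z"
      proof (rule diag)
        fix i j assume "i < n" "j < k" "i \<noteq> j"
        moreover from this have "i < min n k \<or> j < min n k" by auto
        ultimately show "x (i, j) = 0" using D by simp
      qed (use D in auto)
    qed
  next
    case (Suc d)
    define r where "r = min n k - Suc d"
    have r: "min n k - d = Suc r" "r < n" "r < k" using Suc.prems unfolding r_def by auto
    have "\<forall>x. ?D r x \<longrightarrow> x \<in> Z"
    proof (intro allI impI)
      fix x :: array assume D: "?D r x"
      show "x \<in> Z"
      proof (rule line[OF r(2,3)])
        \<comment> \<open>The entry at \<open>(r, r)\<close> may be zero; \<open>line\<close>
          replaces it by an arbitrary nonzero \<open>s\<close>, which serves as pivot.\<close>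
        fix s :: complex assume s: "s \<noteq> 0"
        define y where "y = x((r, r) := s)"
        define y1 where "y1 = (\<lambda>(i, j). y (i, j) + (if i \<in> {r<..<n} then (- y (i, r) / s) * y (r, j) else 0))"
        define y2 where "y2 = (\<lambda>(i, j). y1 (i, j) + (if j \<in> {r<..<k} then (- y1 (r, j) / s) * y1 (i, r) else 0))"
        have yD: "?D r y" using D by (auto simp: y_def)
        have yr: "y (r, r) = s" by (simp add: y_def)
        have y1r: "y1 (i, r) = 0" if "i \<noteq> r" "i < n" for i
          using that yD r s yr by (cases "i < r") (auto simp: y1_def)
        have y1: "y1 (i, j) = y (i, j)" if "i \<le> r \<or> j < r" "j < k" for i j
          using that yD r by (auto simp: y1_def)
        have y2: "y2 (i, j) = y1 (i, j)" if "i \<noteq> r \<or> j \<le> r" "i < n" for i j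
          using that y1r by (auto simp: y2_def)
        have y2r: "y2 (r, j) = 0" if "j \<noteq> r" "j < k" for j
        proof (cases "j < r")
          case True
          then show ?thesis using y2[of r j] y1[of r j] yD r that by auto
        next
          case False
          then show ?thesis using that y1[of r r] yr s r by (auto simp: y2_def)
        qed
        have "?D (Suc r) y2"
        proof (intro conjI allI impI)
          fix i j assume a: "i < n" "j < k" "i \<noteq> j \<and> (i < Suc r \<or> j < Suc r)"
          consider "i = r" | "j = r" "i \<noteq> r" | "i \<noteq> r" "j \<noteq> r" "i < r \<or> j < r" using a by linarith
          then show "y2 (i, j) = 0"
          proof cases
            case 1 then show ?thesis using y2r a by auto
          next
            case 2 then show ?thesis using y2[of i j] y1r a by auto
          next
            case 3
            then show ?thesis using y2[of i j] y1[of i j] yD a by auto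
          qed
        next
          fix i assume "i < Suc r"
          then show "y2 (i, i) \<noteq> 0"
            using y2[of i i] y1[of i i] yD yr s r by (cases "i = r") auto
        qed
        then have "y2 \<in> Z" using Suc r(1) by auto
        then have "y1 \<in> Z"
          using cols[of "{r<..<k}" r y1 "\<lambda>j. - y1 (r, j) / s"] unfolding y2_def by simp
        then show "y \<in> Z"
          using rows[of "{r<..<n}" r y "\<lambda>i. - y (i, r) / s"] unfolding y1_def by simp
      qed
    qed
    then show ?case unfolding r_def .
  qed
  from this[of "min n k"] show ?thesis by simp
qed

text \<open>This is the hypothesis \<open>line\<close> of \<open>diagonal_dense\<close> for the zero
  set of a polynomial.\<close>

lemma polyf_line_entry:
  assumes "f \<in> polyf X" and "\<And>s. s \<noteq> 0 \<Longrightarrow> f (x(i := s)) = 0"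
  shows "f x = 0"
proof -
  obtain p where p: "\<And>s. f (\<lambda>j. poly (if j = i then [:0, 1:] else [:x j:]) s) = poly p s"
    using polyf_line[OF assms(1), of "\<lambda>j. if j = i then [:0, 1:] else [:x j:]"] by metis
  have *: "f (x(i := s)) = poly p s" for s
  proof -
    have "(\<lambda>j. poly (if j = i then [:0, 1:] else [:x j:]) s) = x(i := s)"
      by (auto simp: fun_eq_iff)
    then show ?thesis using p[of s] by simp
  qed
  have "p = 0"
    by (rule poly_eq_0_if_cofinite[of "{0}"]) (use assms(2) * in auto)
  then show ?thesis using *[of "x i"] by simp
qed

text \<open>The conditions of \<open>B_component\<close> on arrays, for elementary matrices and
  diagonal scalings. Rows from \<open>n\<close> on carry the factor 1 because the smaller group is
  embedded with an identity block.\<close>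

definition hw_array :: "nat \<Rightarrow> nat \<Rightarrow> nat \<Rightarrow> (nat \<Rightarrow> nat) \<Rightarrow> (nat \<Rightarrow> nat) \<Rightarrow> (array \<Rightarrow> complex) set" where
  "hw_array m k n F D = {p \<in> polyf ({..<m} \<times> {..<k}).
     (\<forall>a b s x. a < b \<and> b < k \<longrightarrow> p (colop a b s x) = p x) \<and>
     (\<forall>c x. (\<forall>j<k. c j \<noteq> 0) \<longrightarrow> p (colscale c x) = (\<Prod>j<k. c j ^ F j) * p x) \<and>
     (\<forall>a b s x. a < b \<and> b < n \<longrightarrow> p (rowop a b s x) = p x) \<and>
     (\<forall>c x. (\<forall>i<n. c i \<noteq> 0) \<longrightarrow>
        p (rowscale (\<lambda>i. if i < n then c i else 1) x) = (\<Prod>i<n. c i ^ D i) * p x)}"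

lemma hw_arrayD:
  assumes "p \<in> hw_array m k n F D"
  shows "p \<in> polyf ({..<m} \<times> {..<k})"
    and "a < b \<Longrightarrow> b < k \<Longrightarrow> p (colop a b s x) = p x"
    and "(\<And>j. j < k \<Longrightarrow> c j \<noteq> 0) \<Longrightarrow> p (colscale c x) = (\<Prod>j<k. c j ^ F j) * p x"
    and "a < b \<Longrightarrow> b < n \<Longrightarrow> p (rowop a b s x) = p x"
    and "(\<And>i. i < n \<Longrightarrow> c i \<noteq> 0) \<Longrightarrow>
      p (rowscale (\<lambda>i. if i < n then c i else 1) x) = (\<Prod>i<n. c i ^ D i) * p x"
  using assms unfolding hw_array_def by simp_all

lemma hw_array_diff:
  "p \<in> hw_array m k n F D \<Longrightarrow> q \<in> hw_array m k n F D \<Longrightarrow> (\<lambda>x. p x - q x) \<in> hw_array m k n F D"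
  by (auto simp: hw_array_def algebra_simps intro: polyf_diff)

lemma hw_array_sum:
  "(\<And>a. a \<in> A \<Longrightarrow> p a \<in> hw_array m k n F D) \<Longrightarrow>
    (\<lambda>x. \<Sum>a\<in>A. c a * p a x) \<in> hw_array m k n F D"
  unfolding hw_array_def
  by (auto simp: sum_distrib_left mult.left_commute intro!: polyf_sum polyf.mult polyf.const sum.cong)

section \<open>The square case \<open>m = n\<close>\<close>

definition J_array :: array where
  "J_array = (\<lambda>(i, j). if i = j then 1 else 0)"

text \<open>Elimination brings a generic array to a diagonal one, and a diagonal array with nonzero
  entries is a row scaling of \<open>J_array\<close>.\<close>

lemma hw_array_square_eq_0:
  assumes p: "p \<in> hw_array n k n F D" and "p J_array = 0"
  shows "p x = 0"
proof -
  have pf: "p \<in> polyf ({..<n} \<times> {..<k})" using p by (simp add: hw_array_def)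
  have "x \<in> {x. p x = 0}"
  proof (rule diagonal_dense[of n k])
    fix x :: array and r assume "\<And>s. s \<noteq> 0 \<Longrightarrow> x((r, r) := s) \<in> {x. p x = 0}"
    then show "x \<in> {x. p x = 0}" using polyf_line_entry[OF pf] by auto
  next
    fix x :: array
    assume d0: "\<And>i j. i < n \<Longrightarrow> j < k \<Longrightarrow> i \<noteq> j \<Longrightarrow> x (i, j) = 0"
      and d1: "\<And>i. i < n \<Longrightarrow> i < k \<Longrightarrow> x (i, i) \<noteq> 0"
    \<comment> \<open>Rows \<open>i \<ge> k\<close> of the array vanish in the columns below
      \<open>k\<close>; the factor 1 keeps the scaling invertible there.\<close>
    let ?c = "\<lambda>i. if i < k then x (i, i) else 1"
    have "p x = p (rowscale (\<lambda>i. if i < n then ?c i else 1) J_array)"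
      by (rule polyf_cong[OF pf]) (auto simp: rowscale_def J_array_def d0)
    also have "\<dots> = (\<Prod>i<n. ?c i ^ D i) * p J_array"
      by (rule hw_arrayD(5)[OF p]) (simp add: d1)
    finally show "x \<in> {x. p x = 0}" using assms(2) by simp
  qed (simp_all add: hw_arrayD(2,4)[OF p])
  then show ?thesis by simp
qed

text \<open>Scaling row \<open>i\<close> and scaling column \<open>i\<close> of
  \<open>J_array\<close> agree when both indices are in range; when one is out of range, the other
  scaling changes no relevant entry. The factor 2 tells exponents apart.\<close>

lemma hw_array_square_weights:
  assumes p: "p \<in> hw_array n k n F D" and "p x \<noteq> 0"
  shows "i < n \<Longrightarrow> i < k \<Longrightarrow> F i = D i" and "i < n \<Longrightarrow> k \<le> i \<Longrightarrow> D i = 0"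
    and "n \<le> i \<Longrightarrow> i < k \<Longrightarrow> F i = 0"
proof -
  have J: "p J_array \<noteq> 0" using hw_array_square_eq_0[OF p] assms(2) by blast
  have pf: "p \<in> polyf ({..<n} \<times> {..<k})" using p by (simp add: hw_array_def)
  let ?c = "\<lambda>i j :: nat. if j = i then 2 else 1 :: complex"
  have col: "p (colscale (?c i) J_array) = 2 ^ F i * p J_array" if "i < k" for i
  proof -
    have "p (colscale (?c i) J_array) = (\<Prod>j<k. ?c i j ^ F j) * p J_array"
      by (rule hw_arrayD(3)[OF p]) simp
    also have "(\<Prod>j<k. ?c i j ^ F j) = 2 ^ F i"
      using that by (simp add: if_distrib[of "\<lambda>z. z ^ _"] prod.delta cong: if_cong)
    finally show ?thesis .
  qed
  have row: "p (rowscale (?c i) J_array) = 2 ^ D i * p J_array" if "i < n" for i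
  proof -
    have "(\<lambda>l. if l < n then ?c i l else 1) = ?c i" using that by auto
    moreover have "p (rowscale (\<lambda>l. if l < n then ?c i l else 1) J_array) = (\<Prod>j<n. ?c i j ^ D j) * p J_array"
      by (rule hw_arrayD(5)[OF p]) simp
    moreover have "(\<Prod>j<n. ?c i j ^ D j) = 2 ^ D i"
      using that by (simp add: if_distrib[of "\<lambda>z. z ^ _"] prod.delta cong: if_cong)
    ultimately show ?thesis by simp
  qed
  have pow: "(2::complex) ^ a = 2 ^ b \<Longrightarrow> a = b" for a b
    by (metis of_nat_eq_iff of_nat_numeral of_nat_power power_inject_exp one_less_numeral_iff semiring_norm(76))
  show "F i = D i" if "i < n" "i < k"
  proof -
    have "rowscale (?c i) J_array = colscale (?c i) J_array"
      by (auto simp: rowscale_def colscale_def J_array_def fun_eq_iff)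
    then show ?thesis using row[OF that(1)] col[OF that(2)] J pow by auto
  qed
  show "D i = 0" if "i < n" "k \<le> i"
  proof -
    have "p (rowscale (?c i) J_array) = p J_array"
      by (rule polyf_cong[OF pf]) (use that in \<open>auto simp: rowscale_def J_array_def\<close>)
    then show ?thesis using row[OF that(1)] J pow[of "D i" 0] by simp
  qed
  show "F i = 0" if "n \<le> i" "i < k"
  proof -
    have "p (colscale (?c i) J_array) = p J_array"
      by (rule polyf_cong[OF pf]) (use that in \<open>auto simp: colscale_def J_array_def\<close>)
    then show ?thesis using col[OF that(2)] J pow[of "F i" 0] by simp
  qed
qed

subsection \<open>Standard tableaux\<close>

lemma sorted_list_of_set_nth_less_iff:
  fixes I :: "nat set"
  assumes "finite I" and "c < card I"
  shows "sorted_list_of_set I ! c < x \<longleftrightarrow> c < card (I \<inter> {..<x})"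
proof -
  let ?l = "sorted_list_of_set I"
  have l: "length ?l = card I" "set ?l = I" using assms(1) by auto
  have inj: "inj_on (\<lambda>i. ?l ! i) {..<card I}"
    by (rule inj_on_nth) (use l in auto)
  have sd: "?l ! i < ?l ! j" if "i < j" "j < card I" for i j
    using sorted_wrt_nth_less[OF strict_sorted_list_of_set that(1)] that(2) l(1) by simp
  have "I \<inter> {..<x} = (\<lambda>i. ?l ! i) ` {i. i < card I \<and> ?l ! i < x}"
  proof -
    have "i \<in> I \<longleftrightarrow> (\<exists>j<card I. ?l ! j = i)" for i
      using in_set_conv_nth[of i ?l] l by simp
    then show ?thesis by auto
  qed
  then have c: "card (I \<inter> {..<x}) = card {i. i < card I \<and> ?l ! i < x}"
    using card_image[OF inj_on_subset[OF inj, of "{i. i < card I \<and> ?l ! i < x}"]] by auto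
  show ?thesis
  proof (cases "?l ! c < x")
    case True
    then have "{..c} \<subseteq> {i. i < card I \<and> ?l ! i < x}"
      using sd[of _ c] assms(2) by (fastforce simp: le_less intro: less_trans)
    then have "card {..c} \<le> card {i. i < card I \<and> ?l ! i < x}"
      by (rule card_mono[rotated]) simp
    then show ?thesis using c True by simp
  next
    case False
    have "{i. i < card I \<and> ?l ! i < x} \<subseteq> {..<c}"
    proof
      fix i assume i: "i \<in> {i. i < card I \<and> ?l ! i < x}"
      show "i \<in> {..<c}"
      proof (rule ccontr)
        assume "i \<notin> {..<c}"
        then have "i = c \<or> c < i" by auto
        then show False using sd[of c i] i False by auto
      qed
    qed
    then have "card {i. i < card I \<and> ?l ! i < x} \<le> c"
      using card_mono[of "{..<c}"] by fastforce
    then show ?thesis using c False by simp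
  qed
qed

text \<open>Counting entries below \<open>x\<close> instead of comparing sorted lists is compatible
  with deleting the largest entry, and it makes sense for empty columns.\<close>

lemma preceq_iff_card:
  assumes "finite I" and "finite J"
  shows "I \<preceq> J \<longleftrightarrow> (\<forall>x. card (J \<inter> {..<x}) \<le> card (I \<inter> {..<x}))"
proof
  assume l: "I \<preceq> J"
  show "\<forall>x. card (J \<inter> {..<x}) \<le> card (I \<inter> {..<x})"
  proof
    fix x
    show "card (J \<inter> {..<x}) \<le> card (I \<inter> {..<x})"
    proof (cases "card (J \<inter> {..<x})")
      case (Suc c)
      have "card (J \<inter> {..<x}) \<le> card J" using assms(2) by (simp add: card_mono)
      then have c: "c < card J" "c < card I" using Suc l by (auto simp: preceq_def)
      then have "sorted_list_of_set J ! c < x"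
        using sorted_list_of_set_nth_less_iff[OF assms(2)] Suc by simp
      moreover have "sorted_list_of_set I ! c \<le> sorted_list_of_set J ! c"
        using l c by (auto simp: preceq_def)
      ultimately show ?thesis
        using sorted_list_of_set_nth_less_iff[OF assms(1) c(2), of x] Suc by simp
    qed simp
  qed
next
  assume a: "\<forall>x. card (J \<inter> {..<x}) \<le> card (I \<inter> {..<x})"
  obtain N where N: "\<forall>i\<in>I \<union> J. i < N" using assms finite_nat_set_iff_bounded by (metis finite_Un)
  then have "I \<inter> {..<N} = I" "J \<inter> {..<N} = J" by auto
  then have card: "card J \<le> card I" using a by metis
  moreover have "sorted_list_of_set I ! c \<le> sorted_list_of_set J ! c" if "c < card J" for c
  proof -
    let ?x = "Suc (sorted_list_of_set J ! c)"
    have "c < card (J \<inter> {..<?x})"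
      using sorted_list_of_set_nth_less_iff[OF assms(2) that, of ?x] by simp
    then have "c < card (I \<inter> {..<?x})" using a by (meson less_le_trans)
    then show ?thesis
      using sorted_list_of_set_nth_less_iff[OF assms(1), of c ?x] that card by simp
  qed
  ultimately show "I \<preceq> J" by (auto simp: preceq_def)
qed

text \<open>Padding by empty columns allows tableaux of different lengths to be compared column by
  column.\<close>

definition col_set :: "nat set list \<Rightarrow> nat \<Rightarrow> nat set" where
  "col_set t c = (if c < length t then t ! c else {})"

lemma LLn_finite: "I \<in> LLn m n \<Longrightarrow> finite I"
  unfolding LLn_def LL_def using finite_subset by blast

lemma standard_tableau_iff:
  "standard_tableau m n t \<longleftrightarrow> (\<forall>c<length t. t ! c \<in> LLn m n) \<and>
    (\<forall>c d x. c \<le> d \<longrightarrow> card (col_set t d \<inter> {..<x}) \<le> card (col_set t c \<inter> {..<x}))"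
  (is "_ \<longleftrightarrow> ?A \<and> ?B")
proof -
  have s: "set t \<subseteq> LLn m n \<longleftrightarrow> ?A"
    using all_set_conv_all_nth[of t "\<lambda>I. I \<in> LLn m n"] by (simp add: subset_eq)
  have "sorted_wrt (\<preceq>) t \<longleftrightarrow> ?B" if A: ?A
  proof -
    have fin: "finite (t ! c)" if "c < length t" for c using A that LLn_finite by blast
    have "sorted_wrt (\<preceq>) t \<longleftrightarrow> (\<forall>c d. c < d \<longrightarrow> d < length t \<longrightarrow>
        (\<forall>x. card (t ! d \<inter> {..<x}) \<le> card (t ! c \<inter> {..<x})))"
      unfolding sorted_wrt_iff_nth_less using preceq_iff_card fin by (meson less_trans)
    also have "\<dots> \<longleftrightarrow> ?B"
    proof
      assume l: "\<forall>c d. c < d \<longrightarrow> d < length t \<longrightarrow> (\<forall>x. card (t ! d \<inter> {..<x}) \<le> card (t ! c \<inter> {..<x}))"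
      show ?B
      proof (intro allI impI)
        fix c d x :: nat assume "c \<le> d"
        then show "card (col_set t d \<inter> {..<x}) \<le> card (col_set t c \<inter> {..<x})"
          using l by (cases "c = d") (auto simp: col_set_def)
      qed
    next
      assume r: ?B
      show "\<forall>c d. c < d \<longrightarrow> d < length t \<longrightarrow> (\<forall>x. card (t ! d \<inter> {..<x}) \<le> card (t ! c \<inter> {..<x}))"
      proof (intro allI impI)
        fix c d x assume "c < d" "d < length t"
        then show "card (t ! d \<inter> {..<x}) \<le> card (t ! c \<inter> {..<x})"
          using r[rule_format, of c d x] by (simp add: col_set_def)
      qed
    qed
    finally show ?thesis .
  qed
  then show ?thesis unfolding standard_tableau_def s by (rule conj_cong[OF refl])
qed

lemma standard_tableau_col:
  assumes "standard_tableau m n t"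
  shows "finite (col_set t c)" and "col_set t c \<subseteq> {..<m}"
    and "c \<le> d \<Longrightarrow> card (col_set t d) \<le> card (col_set t c)"
    and "c < length t \<Longrightarrow> col_set t c \<in> LLn m n" and "c < length t \<longleftrightarrow> col_set t c \<noteq> {}"
proof -
  show *: "col_set t c \<subseteq> {..<m}" for c
    using assms unfolding standard_tableau_iff by (auto simp: col_set_def LLn_def LL_def)
  then show "finite (col_set t c)" by (rule finite_subset) simp
  have "col_set t c \<inter> {..<m} = col_set t c" for c using * by blast
  then show "c \<le> d \<Longrightarrow> card (col_set t d) \<le> card (col_set t c)"
    using assms unfolding standard_tableau_iff by metis
  show 1: "c < length t \<Longrightarrow> col_set t c \<in> LLn m n"
    using assms unfolding standard_tableau_iff by (auto simp: col_set_def)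
  then show "c < length t \<longleftrightarrow> col_set t c \<noteq> {}"
    by (auto simp: LLn_def LL_def col_set_def)
qed

lemma card_eq_if_initial:
  fixes A :: "nat set"
  assumes "\<And>c. c \<in> A \<longleftrightarrow> c < k"
  shows "card A = k"
proof -
  have "A = {..<k}" using assms by auto
  then show ?thesis by simp
qed

text \<open>As the columns weakly shrink, those with more than \<open>r\<close> entries form an
  initial segment. The conjugate diagram thereby turns into an equivalence between two strict
  inequalities.\<close>

lemma outer_shape_eq_iff:
  assumes mono: "\<And>c d. c \<le> d \<Longrightarrow> card (col_set t d) \<le> card (col_set t c)"
  shows "outer_shape t = F \<longleftrightarrow> (\<forall>r c. r < card (col_set t c) \<longleftrightarrow> c < F r)"
proof -
  have o: "outer_shape t r = card {c. r < card (col_set t c)}" for r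
    unfolding outer_shape_def conjugate_diagram_def col_set_def
    by (rule arg_cong[of _ _ card]) auto
  have init: "r < card (col_set t c) \<longleftrightarrow> c < outer_shape t r" for r c
  proof -
    let ?A = "{c. r < card (col_set t c)}"
    have sub: "?A \<subseteq> {..<length t}" by (auto simp: col_set_def split: if_splits)
    then have fin: "finite ?A" by (rule finite_subset) simp
    show ?thesis
    proof
      assume "r < card (col_set t c)"
      then have "{..c} \<subseteq> ?A" using mono by (auto intro: less_le_trans)
      from card_mono[OF fin this] show "c < outer_shape t r" by (simp add: o)
    next
      assume l: "c < outer_shape t r"
      show "r < card (col_set t c)"
      proof (rule ccontr)
        assume n: "\<not> r < card (col_set t c)"
        have "?A \<subseteq> {..<c}"
        proof
          fix d assume "d \<in> ?A"
          then show "d \<in> {..<c}" using n mono[of c d] by (cases "c \<le> d") auto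
        qed
        from card_mono[OF _ this] l show False by (simp add: o)
      qed
    qed
  qed
  show ?thesis
  proof
    assume "\<forall>r c. r < card (col_set t c) \<longleftrightarrow> c < F r"
    then show "outer_shape t = F"
      by (auto simp: o fun_eq_iff intro!: card_eq_if_initial)
  qed (use init in auto)
qed

lemma inner_shape_col_set: "inner_shape n t r = (if r < n then card {c. r \<in> col_set t c} else 0)"
  unfolding inner_shape_def col_set_def by (auto intro: arg_cong[of _ _ card])

lemma tableaux_iff:
  "t \<in> tableaux m n F D \<longleftrightarrow> standard_tableau m n t \<and>
    (\<forall>r c. r < card (col_set t c) \<longleftrightarrow> c < F r) \<and> inner_shape n t = D"
  unfolding tableaux_def using outer_shape_eq_iff standard_tableau_col(3) by blast

lemma tableauxD:
  assumes "t \<in> tableaux m n F D"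
  shows "standard_tableau m n t" and "r < card (col_set t c) \<longleftrightarrow> c < F r" and "inner_shape n t = D"
  using assms[unfolded tableaux_iff] by simp_all

lemma tableaux_length:
  assumes "t \<in> tableaux m n F D"
  shows "length t = F 0"
proof -
  have "c < length t \<longleftrightarrow> c < F 0" for c
    using tableauxD(2)[OF assms, of 0 c] standard_tableau_col(1,5)[OF tableauxD(1)[OF assms], of c]
    by (simp add: card_gt_0_iff)
  then show ?thesis by (metis linorder_neqE_nat less_irrefl)
qed

lemma list_eq_if_col_set:
  assumes "length t = length u" and "\<And>c. col_set t c = col_set u c"
  shows "t = u"
proof (rule nth_equalityI)
  fix c assume "c < length t"
  then show "t ! c = u ! c" using assms(1) assms(2)[of c] by (simp add: col_set_def)
qed (rule assms(1))

lemma finite_tableaux: "finite (tableaux m n F D)"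
proof (rule finite_subset)
  show "tableaux m n F D \<subseteq> {t. set t \<subseteq> Pow {..<m} \<and> length t = F 0}"
  proof safe
    fix t x i assume t: "t \<in> tableaux m n F D" and "x \<in> set t" "i \<in> x"
    then have "x \<in> LLn m n" by (auto simp: tableaux_def standard_tableau_def)
    then show "i < m" using \<open>i \<in> x\<close> by (auto simp: LLn_def LL_def)
  qed (rule tableaux_length)
  show "finite {t. set t \<subseteq> Pow {..<m} \<and> length t = F 0}"
    by (rule finite_lists_length_eq) simp
qed

section \<open>Horizontal strips formed by the entries for the last row\<close>

definition interlaces :: "(nat \<Rightarrow> nat) \<Rightarrow> (nat \<Rightarrow> nat) \<Rightarrow> bool" where
  "interlaces F' F \<longleftrightarrow> (\<forall>r. F (Suc r) \<le> F' r \<and> F' r \<le> F r)"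

text \<open>A column \<open>c\<close> of a tableau of outer shape \<open>F\<close> has more than \<open>r\<close> entries iff \<open>c < F r\<close>. So a column
  with \<open>r\<close> entries has to receive the new entry \<open>m\<close> iff \<open>c < F r\<close>.\<close>

definition add_strip :: "nat \<Rightarrow> (nat \<Rightarrow> nat) \<Rightarrow> nat set list \<Rightarrow> nat set list" where
  "add_strip m F t = map (\<lambda>c. if c < F (card (col_set t c)) then insert m (col_set t c) else col_set t c) [0..<F 0]"

text \<open>A column \<open>{m}\<close> becomes empty. In a standard tableau such columns come last,
  so \<open>takeWhile\<close> discards exactly these.\<close>

definition remove_strip :: "nat \<Rightarrow> nat set list \<Rightarrow> nat set list" where
  "remove_strip m t = takeWhile (\<lambda>I. I \<noteq> {}) (map (\<lambda>I. I - {m}) t)"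

lemma interlaces_antimono:
  assumes "interlaces F' F"
  shows "antimono F" and "antimono F'"
proof -
  have "F (Suc r) \<le> F r" "F' (Suc r) \<le> F' r" for r
    using assms[unfolded interlaces_def, rule_format, of r] assms[unfolded interlaces_def, rule_format, of "Suc r"]
    by simp_all
  then show "antimono F" "antimono F'" by (auto simp: decseq_Suc_iff)
qed

text \<open>The formula also covers columns beyond the end of \<open>t\<close>: they count as empty
  and receive \<open>m\<close> iff \<open>c < F 0\<close>.\<close>

lemma col_set_add_strip:
  assumes "t \<in> tableaux m n F' D" and "interlaces F' F"
  shows "col_set (add_strip m F t) c =
    (if c < F (card (col_set t c)) then insert m (col_set t c) else col_set t c)"
proof (cases "c < F 0")
  case False
  then have "\<not> c < length t"
    using tableaux_length[OF assms(1)] assms(2) by (metis interlaces_def order_less_le_trans)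
  then have "col_set t c = {}" by (simp add: col_set_def)
  moreover have "col_set (add_strip m F t) c = {}" using False by (simp add: col_set_def add_strip_def)
  ultimately show ?thesis using False by simp
next
  case True
  then have "col_set (add_strip m F t) c = add_strip m F t ! c" by (simp add: col_set_def add_strip_def)
  then show ?thesis using True by (simp add: add_strip_def)
qed

text \<open>Interlacing allows at most one new entry in a column. The new entry \<open>m\<close>
  changes no count below \<open>x \<le> m\<close>, and for larger \<open>x\<close> the counts are
  the column lengths, which are governed by \<open>F\<close>.\<close>

lemma add_strip_tableaux:
  assumes t: "t \<in> tableaux m n F' D" and i: "interlaces F' F" and "n \<le> m"
  shows "add_strip m F t \<in> tableaux (Suc m) n F D"
proof -
  let ?u = "add_strip m F t"
  note st = tableauxD(1)[OF t] and sh = tableauxD(2)[OF t] and inn = tableauxD(3)[OF t]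
  note col = standard_tableau_col[OF st]
  note cu = col_set_add_strip[OF t i]
  have F: "F b \<le> F a" if "a \<le> b" for a b
    using interlaces_antimono(1)[OF i] that by (rule antimonoD)
  have m: "m \<notin> col_set t c" for c using col(2)[of c] by auto
  have shape: "r < card (col_set ?u c) \<longleftrightarrow> c < F r" for r c
  proof (cases "c < F (card (col_set t c))")
    case True
    then have card: "card (col_set ?u c) = Suc (card (col_set t c))"
      using m col(1) by (simp add: cu)
    show ?thesis
    proof (cases "r \<le> card (col_set t c)")
      case t: True
      then show ?thesis using card True F[OF t] by linarith
    next
      case False
      \<comment> \<open>If \<open>c < F r\<close> held here, column \<open>c\<close> would need two
        new entries; \<open>F (Suc q) \<le> F' q\<close> excludes that.\<close>
      then obtain q where q: "r = Suc q" "card (col_set t c) \<le> q" by (cases r) auto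
      then have "\<not> c < F' q" using sh[of q c] by simp
      then have "\<not> c < F r" using i q by (metis interlaces_def order_less_le_trans)
      then show ?thesis using False card by simp
    qed
  next
    case False
    then have card: "card (col_set ?u c) = card (col_set t c)" by (simp add: cu)
    show ?thesis
    proof (cases "r < card (col_set t c)")
      case True
      then have "c < F r" using sh i by (metis interlaces_def order_less_le_trans)
      then show ?thesis using True card by simp
    next
      case g: False
      then have "F r \<le> F (card (col_set t c))" using F by simp
      then show ?thesis using g False card by simp
    qed
  qed
  have mono: "card (col_set ?u d) \<le> card (col_set ?u c)" if "c \<le> d" for c d
  proof (rule ccontr)
    assume "\<not> ?thesis"
    then have "d < F (card (col_set ?u c))" by (simp add: shape[symmetric])
    then have "c < F (card (col_set ?u c))" using that by simp
    then show False by (simp add: shape[symmetric])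
  qed
  have "standard_tableau (Suc m) n ?u"
    unfolding standard_tableau_iff
  proof (intro conjI allI impI)
    fix c assume c: "c < length ?u"
    then have "c < F 0" by (simp add: add_strip_def)
    then have ne: "col_set ?u c \<noteq> {}" using shape[of 0 c] by auto
    have "\<exists>r S. r \<le> n \<and> S \<subseteq> {n..<m} \<and> col_set t c = {..<r} \<union> S"
    proof (cases "c < length t")
      case True
      then show ?thesis using col(4) by (auto simp: LLn_def)
    next
      case False
      then show ?thesis by (intro exI[of _ 0] exI[of _ "{}"]) (simp add: col_set_def)
    qed
    then obtain r S where rS: "r \<le> n" "S \<subseteq> {n..<m}" "col_set t c = {..<r} \<union> S" by blast
    have "\<exists>r S. r \<le> n \<and> S \<subseteq> {n..<Suc m} \<and> col_set ?u c = {..<r} \<union> S"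
    proof (cases "c < F (card (col_set t c))")
      case True
      then show ?thesis using rS assms(3)
        by (intro exI[of _ r] exI[of _ "insert m S"]) (auto simp: cu)
    next
      case False
      then show ?thesis using rS
        by (intro exI[of _ r] exI[of _ S]) (auto simp: cu)
    qed
    moreover have "col_set ?u c \<subseteq> {..<Suc m}" using col(2)[of c] by (auto simp: cu)
    ultimately have "col_set ?u c \<in> LLn (Suc m) n"
      using ne by (simp add: LLn_def LL_def)
    then show "?u ! c \<in> LLn (Suc m) n" using c by (simp add: col_set_def)
  next
    fix c d x :: nat assume cd: "c \<le> d"
    show "card (col_set ?u d \<inter> {..<x}) \<le> card (col_set ?u c \<inter> {..<x})"
    proof (cases "x \<le> m")
      case True
      then have "col_set ?u c \<inter> {..<x} = col_set t c \<inter> {..<x}" for c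
        by (auto simp: cu)
      then show ?thesis using st cd unfolding standard_tableau_iff by simp
    next
      case False
      then have "col_set ?u c \<inter> {..<x} = col_set ?u c" for c
        using col(2)[of c] by (auto simp: cu)
      then show ?thesis using mono[OF cd] by simp
    qed
  qed
  moreover have "inner_shape n ?u = D"
  proof -
    have "r \<in> col_set ?u c \<longleftrightarrow> r \<in> col_set t c" if "r < n" for r c
      using that assms(3) by (auto simp: cu)
    then show ?thesis unfolding inn[symmetric] by (auto simp: inner_shape_col_set fun_eq_iff)
  qed
  ultimately show ?thesis using shape unfolding tableaux_iff by blast
qed

text \<open>A column contains \<open>m\<close> at most once, so its length drops by at most one;
  read off the row lengths this is interlacing.\<close>

lemma remove_strip_tableaux:
  assumes t: "t \<in> tableaux (Suc m) n F D" and "n \<le> m"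
  defines "u \<equiv> remove_strip m t"
  shows "u \<in> tableaux m n (outer_shape u) D" and "interlaces (outer_shape u) F" and "add_strip m F u = t"
proof -
  note st = tableauxD(1)[OF t] and sh = tableauxD(2)[OF t] and inn = tableauxD(3)[OF t]
  note col = standard_tableau_col[OF st]
  have smono: "card (col_set t d \<inter> {..<x}) \<le> card (col_set t c \<inter> {..<x})" if "c \<le> d" for c d x
    by (rule st[unfolded standard_tableau_iff, THEN conjunct2, rule_format, OF that])
  have meet: "col_set t c - {m} = col_set t c \<inter> {..<m}" for c using col(2)[of c] by auto
  have len: "length u \<le> length t"
    unfolding u_def remove_strip_def by (metis length_map length_takeWhile_le)
  have cu: "col_set u c = col_set t c - {m}" for c
  proof (cases "c < length u")
    case True
    then have "c < length t" using len by simp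
    then show ?thesis using True takeWhile_nth[of c "\<lambda>I. I \<noteq> {}" "map (\<lambda>I. I - {m}) t"]
      by (simp add: col_set_def u_def remove_strip_def)
  next
    case False
    \<comment> \<open>Column \<open>length u\<close> is the first to lose all its entries. The
      counts below \<open>m\<close> decrease from column to column, so every later column is emptied
      as well.\<close>
    have "col_set t c - {m} = {}" if "c < length t"
    proof -
      have l: "length u < length t" using that False by simp
      then have "map (\<lambda>I. I - {m}) t ! length u = {}"
        unfolding u_def remove_strip_def
        using nth_length_takeWhile[of "\<lambda>I. I \<noteq> {}" "map (\<lambda>I. I - {m}) t"] by simp
      then have "col_set t (length u) - {m} = {}" using l by (simp add: col_set_def)
      then have "card (col_set t c \<inter> {..<m}) = 0"
        using smono[of "length u" c m] False by (simp add: meet)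
      then show ?thesis unfolding meet using col(1) by simp
    qed
    then show ?thesis using False by (cases "c < length t") (auto simp: col_set_def)
  qed
  have s: "standard_tableau m n u"
    unfolding standard_tableau_iff
  proof (intro conjI allI impI)
    fix c assume c: "c < length u"
    then have "c < length t" using len by simp
    then have "col_set t c \<in> LLn (Suc m) n" by (rule col(4))
    then obtain r S where rS: "r \<le> n" "S \<subseteq> {n..<Suc m}" "col_set t c = {..<r} \<union> S"
      unfolding LLn_def by blast
    have "u ! c \<in> set u" using c by simp
    then have ne: "u ! c \<noteq> {}" unfolding u_def remove_strip_def by (auto dest: set_takeWhileD)
    have "u ! c = {..<r} \<union> (S - {m})"
      using cu[of c] c rS assms(2) by (auto simp: col_set_def)
    moreover have "S - {m} \<subseteq> {n..<m}" using rS(2) by auto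
    moreover from this have "{..<r} \<union> (S - {m}) \<subseteq> {..<m}" using rS(1) assms(2) by auto
    ultimately show "u ! c \<in> LLn m n"
      using ne rS(1) unfolding LLn_def LL_def mem_Collect_eq by metis
  next
    fix c d x :: nat assume "c \<le> d"
    moreover have "col_set u c \<inter> {..<x} = col_set t c \<inter> {..<min x m}" for c
      unfolding cu meet by auto
    ultimately show "card (col_set u d \<inter> {..<x}) \<le> card (col_set u c \<inter> {..<x})"
      using smono by simp
  qed
  have inn': "inner_shape n u = D"
    using assms(2) unfolding inn[symmetric] by (auto simp: inner_shape_col_set fun_eq_iff cu intro!: arg_cong[of _ _ card])
  show u: "u \<in> tableaux m n (outer_shape u) D" using s inn' by (simp add: tableaux_def)
  then have sh': "r < card (col_set u c) \<longleftrightarrow> c < outer_shape u r" for r c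
    unfolding tableaux_iff by blast
  have le: "card (col_set u c) \<le> card (col_set t c)" "card (col_set t c) \<le> Suc (card (col_set u c))" for c
    using col(1)[of c] by (auto simp: cu card_Diff_singleton_if)
  show int: "interlaces (outer_shape u) F"
    unfolding interlaces_def
  proof (intro allI conjI)
    fix r
    have "c < outer_shape u r" if "c < F (Suc r)" for c
      using that le(2)[of c] unfolding sh[symmetric] sh'[symmetric] by linarith
    then show "F (Suc r) \<le> outer_shape u r" by (meson leI less_irrefl)
    have "c < F r" if "c < outer_shape u r" for c
      using that le(1)[of c] unfolding sh[symmetric] sh'[symmetric] by linarith
    then show "outer_shape u r \<le> F r" by (meson leI less_irrefl)
  qed
  show "add_strip m F u = t"
  proof (rule list_eq_if_col_set)
    show "length (add_strip m F u) = length t"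
      using tableaux_length[OF t] by (simp add: add_strip_def)
    fix c
    have "c < F (card (col_set u c)) \<longleftrightarrow> m \<in> col_set t c"
      unfolding sh[symmetric] cu using col(1)[of c]
      by (auto simp: card_Diff_singleton_if card_gt_0_iff intro!: diff_less)
    then show "col_set (add_strip m F u) c = col_set t c"
      unfolding col_set_add_strip[OF u int] by (auto simp: cu)
  qed
qed

text \<open>Deleting \<open>m\<close> recovers the columns, and the columns determine the outer
  shape; hence tableaux of different shapes also have different images.\<close>

lemma add_strip_inj:
  assumes "t \<in> tableaux m n F' D" "u \<in> tableaux m n F'' D" "interlaces F' F" "interlaces F'' F"
    and "add_strip m F t = add_strip m F u"
  shows "t = u" and "F' = F''"
proof -
  have "standard_tableau m n t" "standard_tableau m n u"
    using assms(1,2) by (auto dest: tableauxD(1))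
  then have "m \<notin> col_set t c" "m \<notin> col_set u c" for c
    using standard_tableau_col(2) by blast+
  then have "col_set (add_strip m F t) c - {m} = col_set t c"
    "col_set (add_strip m F u) c - {m} = col_set u c" for c
    using col_set_add_strip[OF assms(1,3)] col_set_add_strip[OF assms(2,4)] by auto
  then have eq: "col_set t c = col_set u c" for c using assms(5) by metis
  have *: "c < F' r \<longleftrightarrow> c < F'' r" for c r
    using tableauxD(2)[OF assms(1), of r c] tableauxD(2)[OF assms(2), of r c] eq[of c] by simp
  show F: "F' = F''"
  proof
    show "F' r = F'' r" for r using *[of "F' r" r] *[of "F'' r" r] by simp
  qed
  show "t = u"
    by (rule list_eq_if_col_set) (simp_all add: eq F tableaux_length[OF assms(1)] tableaux_length[OF assms(2)])
qed

text \<open>For \<open>m = n\<close> there are no entries from \<open>n\<close> on, so every column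
  is an initial segment and is fixed by its length.\<close>

lemma tableaux_square_col:
  assumes "t \<in> tableaux n n F D"
  shows "col_set t c = {r. c < F r}"
proof -
  note st = tableauxD(1)[OF assms] and sh = tableauxD(2)[OF assms]
  have "\<exists>r. col_set t c = {..<r}"
  proof (cases "c < length t")
    case True
    then show ?thesis using standard_tableau_col(4)[OF st True] by (auto simp: LLn_def)
  qed (auto simp: col_set_def)
  then obtain r where "col_set t c = {..<r}" by blast
  moreover from this have "q < r \<longleftrightarrow> c < F q" for q using sh[of q c] by simp
  ultimately show ?thesis by auto
qed

lemma tableaux_square_unique:
  assumes "t \<in> tableaux n n F D" "u \<in> tableaux n n F D"
  shows "t = u"
  by (rule list_eq_if_col_set)
    (simp_all add: tableaux_square_col[OF assms(1)] tableaux_square_col[OF assms(2)]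
      tableaux_length[OF assms(1)] tableaux_length[OF assms(2)])

text \<open>When all columns are initial segments, index \<open>r\<close> occurs in as many columns
  as row \<open>r\<close> is long; this is why the inner shape is again \<open>F\<close>.\<close>

lemma tableaux_square_exists:
  assumes "antimono F" and "\<And>i. n \<le> i \<Longrightarrow> F i = 0"
  shows "map (\<lambda>c. {r. c < F r}) [0..<F 0] \<in> tableaux n n F F" (is "?t \<in> _")
proof -
  have mono: "F b \<le> F a" if "a \<le> b" for a b using assms(1) that by (rule antimonoD)
  have sub: "{r. c < F r} \<subseteq> {..<n}" for c
  proof
    fix r assume "r \<in> {r. c < F r}"
    then show "r \<in> {..<n}" using assms(2)[of r] by (cases "n \<le> r") auto
  qed
  then have fin: "finite {r. c < F r}" for c by (rule finite_subset) simp
  have col: "col_set ?t c = {r. c < F r}" for c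
    using mono[of 0] by (auto simp: col_set_def intro: less_le_trans)
  have init: "r < card {r. c < F r} \<longleftrightarrow> c < F r" for r c
  proof
    assume a: "r < card {r. c < F r}"
    show "c < F r"
    proof (rule ccontr)
      assume "\<not> c < F r"
      then have "{r. c < F r} \<subseteq> {..<r}" using mono[of r] by (auto intro: leI dest: less_le_trans)
      from card_mono[OF _ this] a show False by simp
    qed
  next
    assume "c < F r"
    then have "{..r} \<subseteq> {r. c < F r}" using mono by (auto intro: less_le_trans)
    from card_mono[OF fin this] show "r < card {r. c < F r}" by simp
  qed
  have seg: "{r. c < F r} = {..<card {r. c < F r}}" for c using init by auto
  have "standard_tableau n n ?t"
    unfolding standard_tableau_iff col
  proof (intro conjI allI impI)
    fix c assume c: "c < length ?t"
    then have "0 \<in> {r. c < F r}" by simp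
    moreover have "card {r. c < F r} \<le> n" using card_mono[OF _ sub[of c]] by simp
    ultimately have "{r. c < F r} \<in> LLn n n"
      unfolding LLn_def LL_def using sub[of c] seg[of c] by blast
    then show "?t ! c \<in> LLn n n" using c by simp
  next
    fix c d x :: nat assume "c \<le> d"
    then have "{r. d < F r} \<inter> {..<x} \<subseteq> {r. c < F r} \<inter> {..<x}" by auto
    then show "card ({r. d < F r} \<inter> {..<x}) \<le> card ({r. c < F r} \<inter> {..<x})"
      by (rule card_mono[rotated]) simp
  qed
  moreover have "inner_shape n ?t = F"
    unfolding inner_shape_col_set col using assms(2) by (auto simp: fun_eq_iff)
  ultimately show ?thesis unfolding tableaux_iff col using init by blast
qed

subsection \<open>Matrix groups and their action\<close>

lemma GL_iff_det: "g \<in> GL r \<longleftrightarrow> g \<in> carrier_mat r r \<and> det g \<noteq> 0"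
proof
  assume g: "g \<in> GL r"
  then have c: "g \<in> carrier_mat r r" by (simp add: GL_def)
  obtain h where gh: "g * h = 1\<^sub>m r" and "h * g = 1\<^sub>m (dim_row h)"
    using g by (auto simp: GL_def invertible_mat_def inverts_mat_def)
  then have "dim_col (h * g) = dim_row h" "dim_col (g * h) = r" by simp_all
  then have "h \<in> carrier_mat r r" using c by auto
  then have "det g * det h = 1" using gh c det_mult by (metis det_one)
  then show "g \<in> carrier_mat r r \<and> det g \<noteq> 0" using c by auto
next
  assume a: "g \<in> carrier_mat r r \<and> det g \<noteq> 0"
  then have "g \<in> Units (ring_mat TYPE(complex) r ())" by (intro det_non_zero_imp_unit) auto
  then obtain h where "h \<in> carrier_mat r r" "h * g = 1\<^sub>m r" "g * h = 1\<^sub>m r"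
    by (auto simp: Units_def ring_mat_def)
  then show "g \<in> GL r" using a
    by (auto simp: GL_def invertible_mat_def inverts_mat_def intro!: exI[of _ h])
qed

lemma GL_carrier: "g \<in> GL r \<Longrightarrow> g \<in> carrier_mat r r"
  by (simp add: GL_iff_det)

lemma GL_one: "1\<^sub>m r \<in> GL r"
  by (simp add: GL_iff_det)

lemma GL_mult: "g \<in> GL r \<Longrightarrow> h \<in> GL r \<Longrightarrow> g * h \<in> GL r"
  by (auto simp: GL_iff_det det_mult)

lemma GL_transpose: "g \<in> GL r \<Longrightarrow> transpose_mat g \<in> GL r"
  by (auto simp: GL_iff_det det_transpose)

lemma minv:
  assumes "g \<in> GL r"
  shows "minv g \<in> GL r" and "minv g * g = 1\<^sub>m r" and "g * minv g = 1\<^sub>m r"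
proof -
  have c: "g \<in> carrier_mat r r" and d: "det g \<noteq> 0" using assms by (auto simp: GL_iff_det)
  have "mat_inverse g \<noteq> None"
    using mat_inverse(1)[OF c, of "()"] det_non_zero_imp_unit[OF c d, of "()"] by blast
  then have "mat_inverse g = Some (minv g)" by (auto simp: minv_def)
  from mat_inverse(2)[OF c this]
  have m: "g * minv g = 1\<^sub>m r" "minv g * g = 1\<^sub>m r" "minv g \<in> carrier_mat r r" by auto
  then show "minv g * g = 1\<^sub>m r" "g * minv g = 1\<^sub>m r" by auto
  have "det g * det (minv g) = 1" using m c det_mult by (metis det_one)
  then show "minv g \<in> GL r" using m by (auto simp: GL_iff_det)
qed

lemma minv_unique:
  assumes "g \<in> GL r" and "h \<in> carrier_mat r r" and "h * g = 1\<^sub>m r"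
  shows "minv g = h"
proof -
  have "minv g = h * g * minv g"
    unfolding assms(3) using GL_carrier[OF minv(1)[OF assms(1)]] by simp
  also have "\<dots> = h * (g * minv g)"
    using assms(1,2) minv(1)[OF assms(1)] GL_carrier by (meson assoc_mult_mat)
  also have "\<dots> = h" using minv(3)[OF assms(1)] assms(2) by simp
  finally show ?thesis .
qed

lemma minv_minv: "g \<in> GL r \<Longrightarrow> minv (minv g) = g"
  by (rule minv_unique) (use minv GL_carrier in auto)

lemma minv_transpose_minv: "g \<in> GL r \<Longrightarrow> minv (transpose_mat (minv g)) = transpose_mat g"
proof (rule minv_unique)
  assume g: "g \<in> GL r"
  show "transpose_mat (minv g) \<in> GL r" by (rule GL_transpose[OF minv(1)[OF g]])
  show "transpose_mat g \<in> carrier_mat r r" using GL_carrier[OF g] by simp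
  have "transpose_mat (minv g * g) = transpose_mat g * transpose_mat (minv g)"
    by (rule transpose_mult) (use GL_carrier[OF g] GL_carrier[OF minv(1)[OF g]] in auto)
  then show "transpose_mat g * transpose_mat (minv g) = 1\<^sub>m r"
    using minv(2)[OF g] by simp
qed

text \<open>The inverses in the action on functions cancel those in the action on matrices, so later
  computations are free of inverses.\<close>

lemma fun_act_apply:
  assumes "g \<in> GL m" and "h \<in> GL k"
  shows "fun_act m k g h f = (\<lambda>Q. if Q \<in> carrier_mat m k then f (transpose_mat g * Q * h) else 0)"
  unfolding fun_act_def mat_act_def minv_transpose_minv[OF assms(1)] minv_minv[OF assms(2)] by simp

lemma embed_carrier: "n \<le> m \<Longrightarrow> X \<in> carrier_mat n n \<Longrightarrow> embed m n X \<in> carrier_mat m m"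
  unfolding embed_def by (metis add_diff_inverse_nat four_block_carrier_mat le_antisym nat_less_le not_less one_carrier_mat)

lemma embed_index:
  assumes "n \<le> m" and "X \<in> carrier_mat n n" and "i < m" and "j < m"
  shows "embed m n X $$ (i, j) = (if i < n \<and> j < n then X $$ (i, j) else if i = j then 1 else 0)"
  using assms unfolding embed_def by (subst index_mat_four_block) (auto simp: four_block_mat_def Let_def)

lemma embed_GL:
  assumes "n \<le> m" and "X \<in> GL n"
  shows "embed m n X \<in> GL m"
proof -
  have "det (embed m n X) = det X * det (1\<^sub>m (m - n))"
    unfolding embed_def
    by (rule det_four_block_mat_upper_right_zero) (use GL_carrier[OF assms(2)] in auto)
  then show ?thesis using assms embed_carrier by (auto simp: GL_iff_det)
qed

lemma embed_mult:
  assumes "n \<le> m" and "X \<in> carrier_mat n n" and "Y \<in> carrier_mat n n"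
  shows "embed m n (X * Y) = embed m n X * embed m n Y"
  unfolding embed_def
  by (subst mult_four_block_mat[of X n n _ "m - n" _ "m - n"]) (use assms in auto)

lemma embed_one: "n \<le> m \<Longrightarrow> embed m n (1\<^sub>m n) = 1\<^sub>m m"
  by (rule eq_matI) (auto simp: embed_index, auto simp: embed_def)

lemma GLn_act_apply:
  assumes "n \<le> m" and "X \<in> GL n"
  shows "GLn_act m k n X f =
    (\<lambda>Q. if Q \<in> carrier_mat m k then f (transpose_mat (embed m n X) * Q) else 0)"
proof -
  have "transpose_mat (embed m n X) * Q * 1\<^sub>m k = transpose_mat (embed m n X) * Q"
    if "Q \<in> carrier_mat m k" for Q
    using that GL_carrier[OF embed_GL[OF assms]] by (intro right_mult_one_mat) auto
  then show ?thesis
    unfolding GLn_act_def fun_act_apply[OF embed_GL[OF assms] GL_one] by (auto simp: fun_eq_iff)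
qed

lemma fun_act_right_apply:
  assumes "h \<in> GL k"
  shows "fun_act m k (1\<^sub>m m) h f = (\<lambda>Q. if Q \<in> carrier_mat m k then f (Q * h) else 0)"
  unfolding fun_act_apply[OF GL_one assms] by (auto simp: fun_eq_iff)

section \<open>Functions on matrices and functions on arrays\<close>

definition on_mat :: "nat \<Rightarrow> nat \<Rightarrow> (array \<Rightarrow> complex) \<Rightarrow> complex mat \<Rightarrow> complex" where
  "on_mat m k p = (\<lambda>Q. if Q \<in> carrier_mat m k then p (($$) Q) else 0)"

lemma on_mat_in_poly_funs: "p \<in> polyf ({..<m} \<times> {..<k}) \<Longrightarrow> on_mat m k p \<in> poly_funs m k"
proof (induction rule: polyf.induct)
  case (const c)
  then show ?case unfolding on_mat_def by (rule poly_funs.const)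
next
  case (coord i)
  then show ?case unfolding on_mat_def by (cases i) (auto intro: poly_funs.coord)
next
  case (add p q)
  have "on_mat m k (\<lambda>x. p x + q x) = (\<lambda>Q. on_mat m k p Q + on_mat m k q Q)"
    by (auto simp: on_mat_def)
  then show ?case using add by (auto intro: poly_funs.add)
next
  case (mult p q)
  have "on_mat m k (\<lambda>x. p x * q x) = (\<lambda>Q. on_mat m k p Q * on_mat m k q Q)"
    by (auto simp: on_mat_def)
  then show ?case using mult by (auto intro: poly_funs.mult)
qed

lemma poly_funs_imp_polyf:
  assumes "f \<in> poly_funs m k"
  shows "(\<lambda>x. f (mat m k x)) \<in> polyf ({..<m} \<times> {..<k})"
  using assms by induction (auto intro: polyf.intros)

lemma poly_funs_outside: "f \<in> poly_funs m k \<Longrightarrow> Q \<notin> carrier_mat m k \<Longrightarrow> f Q = 0"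
  by (induction rule: poly_funs.induct) auto

lemma mat_index_eta: "Q \<in> carrier_mat m k \<Longrightarrow> mat m k (($$) Q) = Q"
  by (rule eq_matI) auto

lemma poly_funs_eq_on_mat:
  "f \<in> poly_funs m k \<Longrightarrow> f = on_mat m k (\<lambda>x. f (mat m k x))"
  using poly_funs_outside by (fastforce simp: on_mat_def mat_index_eta)

lemma on_mat_mat: "p \<in> polyf ({..<m} \<times> {..<k}) \<Longrightarrow> on_mat m k p (mat m k x) = p x"
  by (simp add: on_mat_def, rule polyf_cong[where X = "{..<m} \<times> {..<k}"]) auto

lemma unipotent_GL: "u \<in> unipotent r \<Longrightarrow> u \<in> GL r"
  by (simp add: unipotent_def)

lemma torus_GL: "u \<in> torus r \<Longrightarrow> u \<in> GL r"
  by (simp add: torus_def)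

lemma hw_right_iff:
  assumes "f \<in> poly_funs m k"
  shows "f \<in> rho_summand m k F \<longleftrightarrow>
    (\<forall>u\<in>unipotent k. \<forall>Q\<in>carrier_mat m k. f (Q * u) = f Q) \<and>
    (\<forall>a\<in>torus k. \<forall>Q\<in>carrier_mat m k. f (Q * a) = torus_char k F a * f Q)"
proof -
  have eq: "fun_act m k (1\<^sub>m m) g f = fscale c f \<longleftrightarrow> (\<forall>Q\<in>carrier_mat m k. f (Q * g) = c * f Q)"
    if "g \<in> GL k" for g c
    using poly_funs_outside[OF assms]
    by (auto simp: fun_act_right_apply[OF that] pointwise_scale_def fun_eq_iff)
  have eq1: "fun_act m k (1\<^sub>m m) g f = f \<longleftrightarrow> (\<forall>Q\<in>carrier_mat m k. f (Q * g) = f Q)"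
    if "g \<in> GL k" for g
    using poly_funs_outside[OF assms]
    by (auto simp: fun_act_right_apply[OF that] fun_eq_iff)
  show ?thesis
    unfolding rho_summand_def hw_space_def using assms
    by (auto simp: eq1 eq unipotent_GL torus_GL)
qed

lemma rho_summand_poly_funs: "f \<in> rho_summand m k F \<Longrightarrow> f \<in> poly_funs m k"
  by (simp add: rho_summand_def hw_space_def)

lemma B_component_iff:
  assumes "n \<le> m"
  shows "f \<in> B_component m k n F D \<longleftrightarrow> f \<in> rho_summand m k F \<and>
    (\<forall>u\<in>unipotent n. \<forall>Q\<in>carrier_mat m k. f (transpose_mat (embed m n u) * Q) = f Q) \<and>
    (\<forall>a\<in>torus n. \<forall>Q\<in>carrier_mat m k. f (transpose_mat (embed m n a) * Q) = torus_char n D a * f Q)"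
proof (cases "f \<in> rho_summand m k F")
  case True
  note p = rho_summand_poly_funs[OF True]
  have eq: "GLn_act m k n g f = fscale c f \<longleftrightarrow>
      (\<forall>Q\<in>carrier_mat m k. f (transpose_mat (embed m n g) * Q) = c * f Q)"
    if "g \<in> GL n" for g c
    using poly_funs_outside[OF p]
    by (auto simp: GLn_act_apply[OF assms that] pointwise_scale_def fun_eq_iff)
  have eq1: "GLn_act m k n g f = f \<longleftrightarrow>
      (\<forall>Q\<in>carrier_mat m k. f (transpose_mat (embed m n g) * Q) = f Q)"
    if "g \<in> GL n" for g
    using poly_funs_outside[OF p]
    by (auto simp: GLn_act_apply[OF assms that] fun_eq_iff)
  show ?thesis
    unfolding B_component_def hw_space_def using True
    by (auto simp: eq1 eq unipotent_GL torus_GL)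
qed (simp add: B_component_def hw_space_def)

lemma torus_diag:
  assumes "\<And>i. i < r \<Longrightarrow> c i \<noteq> 0"
  shows "mat r r (\<lambda>(i, j). if i = j then c i else 0) \<in> torus r" (is "?a \<in> _")
proof -
  have "det ?a = prod_list (diag_mat ?a)"
    by (rule det_upper_triangular[of _ r]) auto
  also have "\<dots> = (\<Prod>i = 0..<r. c i)" by (simp add: prod_list_diag_prod)
  finally have "det ?a \<noteq> 0" using assms by simp
  then show ?thesis by (auto simp: torus_def GL_iff_det diagonal_mat_def)
qed

lemma unipotentI:
  assumes "u \<in> carrier_mat r r" and "\<And>i j. i < r \<Longrightarrow> j < i \<Longrightarrow> u $$ (i, j) = 0" and "\<And>i. i < r \<Longrightarrow> u $$ (i, i) = 1"
  shows "u \<in> unipotent r"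
proof -
  have ut: "upper_triangular u" using assms(1,2) by auto
  have "det u = prod_list (diag_mat u)"
    by (rule det_upper_triangular[OF ut assms(1)])
  also have "\<dots> = 1" using assms by (simp add: prod_list_diag_prod)
  finally show ?thesis using assms ut by (auto simp: unipotent_def GL_iff_det)
qed

text \<open>Each elementary operation or scaling is multiplication by a unipotent or diagonal
  matrix. On the left the transpose occurs, so that an upper unipotent matrix adds row
  \<open>a\<close> to a later row \<open>b\<close>.\<close>

lemma B_component_hw_array:
  assumes "n \<le> m" and f: "f \<in> B_component m k n F D"
  shows "(\<lambda>x. f (mat m k x)) \<in> hw_array m k n F D"
proof -
  have r: "f \<in> rho_summand m k F"
    and row1: "\<And>u Q. u \<in> unipotent n \<Longrightarrow> Q \<in> carrier_mat m k \<Longrightarrow> f (transpose_mat (embed m n u) * Q) = f Q"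
    and row2: "\<And>a Q. a \<in> torus n \<Longrightarrow> Q \<in> carrier_mat m k \<Longrightarrow>
      f (transpose_mat (embed m n a) * Q) = torus_char n D a * f Q"
    using f unfolding B_component_iff[OF assms(1)] by blast+
  note p = rho_summand_poly_funs[OF r]
  have col1: "\<And>u Q. u \<in> unipotent k \<Longrightarrow> Q \<in> carrier_mat m k \<Longrightarrow> f (Q * u) = f Q"
    and col2: "\<And>a Q. a \<in> torus k \<Longrightarrow> Q \<in> carrier_mat m k \<Longrightarrow> f (Q * a) = torus_char k F a * f Q"
    using r unfolding hw_right_iff[OF p] by blast+
  show ?thesis
    unfolding hw_array_def mem_Collect_eq
  proof (intro conjI allI impI)
    show "(\<lambda>x. f (mat m k x)) \<in> polyf ({..<m} \<times> {..<k})" by (rule poly_funs_imp_polyf[OF p])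
  next
    fix a b :: nat and s :: complex and x :: array assume ab: "a < b \<and> b < k"
    let ?u = "mat k k (\<lambda>(i, j). if i = j then 1 else if i = a \<and> j = b then s else 0)"
    have "mat m k (colop a b s x) = mat m k x * ?u"
    proof (rule eq_matI)
      fix i j assume "i < dim_row (mat m k x * ?u)" "j < dim_col (mat m k x * ?u)"
      then have ij: "i < m" "j < k" by auto
      have "(mat m k x * ?u) $$ (i, j) =
          (\<Sum>l = 0..<k. x (i, l) * (if l = j then 1 else if l = a \<and> j = b then s else 0))"
        using ij by (simp add: scalar_prod_def)
      also have "\<dots> = (\<Sum>l = 0..<k. (if l = j then x (i, l) else 0) + (if l = a then if j = b then s * x (i, l) else 0 else 0))"
        by (rule sum.cong) (use ab in auto)
      also have "\<dots> = colop a b s x (i, j)"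
        using ij ab by (simp add: sum.distrib sum.delta colop_def)
      finally show "mat m k (colop a b s x) $$ (i, j) = (mat m k x * ?u) $$ (i, j)" using ij by simp
    qed auto
    moreover have "?u \<in> unipotent k" by (rule unipotentI) (use ab in auto)
    ultimately show "f (mat m k (colop a b s x)) = f (mat m k x)" using col1 by simp
  next
    fix c :: "nat \<Rightarrow> complex" and x :: array assume c: "\<forall>j<k. c j \<noteq> 0"
    let ?a = "mat k k (\<lambda>(i, j). if i = j then c i else 0)"
    have "mat m k (colscale c x) = mat m k x * ?a"
      by (rule eq_matI) (auto simp: scalar_prod_def colscale_def if_distrib[of "\<lambda>z. _ * z"] sum.delta' cong: if_cong)
    moreover have "?a \<in> torus k" by (rule torus_diag) (use c in auto)
    moreover have "torus_char k F ?a = (\<Prod>j<k. c j ^ F j)" by (simp add: torus_char_def)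
    ultimately show "f (mat m k (colscale c x)) = (\<Prod>j<k. c j ^ F j) * f (mat m k x)" using col2 by simp
  next
    fix a b :: nat and s :: complex and x :: array assume ab: "a < b \<and> b < n"
    let ?u = "mat n n (\<lambda>(i, j). if i = j then 1 else if i = a \<and> j = b then s else 0)"
    have c: "?u \<in> carrier_mat n n" by simp
    note e = embed_index[OF assms(1) c]
    have "mat m k (rowop a b s x) = transpose_mat (embed m n ?u) * mat m k x"
    proof (rule eq_matI)
      fix i j assume "i < dim_row (transpose_mat (embed m n ?u) * mat m k x)"
        "j < dim_col (transpose_mat (embed m n ?u) * mat m k x)"
      then have ij: "i < m" "j < k" using embed_carrier[OF assms(1) c] by auto
      have "(transpose_mat (embed m n ?u) * mat m k x) $$ (i, j) =
          (\<Sum>l = 0..<m. embed m n ?u $$ (l, i) * x (l, j))"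
        using ij embed_carrier[OF assms(1) c] by (auto simp: scalar_prod_def intro!: sum.cong)
      also have "\<dots> = (\<Sum>l = 0..<m. (if l = i then x (l, j) else 0) + (if l = a then if i = b then s * x (l, j) else 0 else 0))"
        by (rule sum.cong) (use ab ij assms(1) in \<open>auto simp: e\<close>)
      also have "\<dots> = rowop a b s x (i, j)"
        using ij ab assms(1) by (simp add: sum.distrib sum.delta rowop_def)
      finally show "mat m k (rowop a b s x) $$ (i, j) = (transpose_mat (embed m n ?u) * mat m k x) $$ (i, j)"
        using ij by simp
    qed (use embed_carrier[OF assms(1) c] in auto)
    moreover have "?u \<in> unipotent n" by (rule unipotentI) (use ab in auto)
    ultimately show "f (mat m k (rowop a b s x)) = f (mat m k x)" using row1 by simp
  next
    fix c :: "nat \<Rightarrow> complex" and x :: array assume c: "\<forall>i<n. c i \<noteq> 0"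
    let ?a = "mat n n (\<lambda>(i, j). if i = j then c i else 0)"
    have ca: "?a \<in> carrier_mat n n" by simp
    note e = embed_index[OF assms(1) ca]
    have "mat m k (rowscale (\<lambda>i. if i < n then c i else 1) x) = transpose_mat (embed m n ?a) * mat m k x"
    proof (rule eq_matI)
      fix i j assume "i < dim_row (transpose_mat (embed m n ?a) * mat m k x)"
        "j < dim_col (transpose_mat (embed m n ?a) * mat m k x)"
      then have ij: "i < m" "j < k" using embed_carrier[OF assms(1) ca] by auto
      have "(transpose_mat (embed m n ?a) * mat m k x) $$ (i, j) =
          (\<Sum>l = 0..<m. embed m n ?a $$ (l, i) * x (l, j))"
        using ij embed_carrier[OF assms(1) ca] by (auto simp: scalar_prod_def intro!: sum.cong)
      also have "\<dots> = (\<Sum>l = 0..<m. if l = i then (if i < n then c i else 1) * x (l, j) else 0)"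
        by (rule sum.cong) (use ij assms(1) in \<open>auto simp: e\<close>)
      also have "\<dots> = rowscale (\<lambda>i. if i < n then c i else 1) x (i, j)"
        using ij by (simp add: rowscale_def)
      finally show "mat m k (rowscale (\<lambda>i. if i < n then c i else 1) x) $$ (i, j) =
        (transpose_mat (embed m n ?a) * mat m k x) $$ (i, j)"
        using ij by simp
    qed (use embed_carrier[OF assms(1) ca] in auto)
    moreover have "?a \<in> torus n" by (rule torus_diag) (use c in auto)
    moreover have "torus_char n D ?a = (\<Prod>i<n. c i ^ D i)" by (simp add: torus_char_def)
    ultimately show "f (mat m k (rowscale (\<lambda>i. if i < n then c i else 1) x)) = (\<Prod>i<n. c i ^ D i) * f (mat m k x)"
      using row2 by simp
  qed
qed

subsection \<open>Minors and standard monomials\<close>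

text \<open>The counterpart of \<open>minor\<close> on arrays. With \<open>pick\<close> no number of
  rows enters, so the same function is used for all \<open>m\<close>.\<close>

definition row_minor :: "nat set \<Rightarrow> array \<Rightarrow> complex" where
  "row_minor I x = det (mat (card I) (card I) (\<lambda>(a, b). x (pick I a, b)))"

definition array_monomial :: "nat set list \<Rightarrow> array \<Rightarrow> complex" where
  "array_monomial t x = (\<Prod>I\<leftarrow>t. row_minor I x)"

lemma pick_lessThan: "j < r \<Longrightarrow> pick {..<r} j = j"
proof -
  assume "j < r"
  then have "{a \<in> {..<r}. a < j} = {..<j}" by auto
  then show ?thesis using pick_card_in_set[of j "{..<r}"] \<open>j < r\<close> by simp
qed

lemma bij_betw_pick:
  assumes "finite I"
  shows "bij_betw (pick I) {..<card I} I"
proof -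
  have "inj_on (pick I) {..<card I}"
  proof (rule inj_onI)
    fix a b assume "a \<in> {..<card I}" "b \<in> {..<card I}" "pick I a = pick I b"
    then show "a = b" using pick_mono_le[of a I b] pick_mono_le[of b I a] by (cases a b rule: linorder_cases) auto
  qed
  moreover have "pick I ` {..<card I} \<subseteq> I" using pick_in_set_le by auto
  moreover have "card (pick I ` {..<card I}) = card I" using calculation(1) by (simp add: card_image)
  ultimately show ?thesis using assms by (auto simp: bij_betw_def card_subset_eq)
qed

lemma minor_eq_row_minor:
  assumes "Q \<in> carrier_mat m k" and "I \<subseteq> {..<m}" and "card I \<le> k"
  shows "minor I Q = row_minor I (($$) Q)"
proof -
  have I: "{i. i < dim_row Q \<and> i \<in> I} = I" using assms by auto
  have J: "{j. j < dim_col Q \<and> j \<in> {..<card I}} = {..<card I}" using assms by auto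
  show ?thesis unfolding minor_def row_minor_def submatrix_def I J
    by (rule arg_cong[of _ _ det], rule cong_mat) (auto simp: pick_lessThan)
qed

lemma det_polyf:
  assumes "\<And>a b. a < r \<Longrightarrow> b < r \<Longrightarrow> f a b \<in> polyf X"
  shows "(\<lambda>x. det (mat r r (\<lambda>(a, b). f a b x))) \<in> polyf X"
proof -
  have i: "p i < r" if "p permutes {0..<r}" "i < r" for p i
    using permutes_in_image[OF that(1)] that(2) by simp
  have "(\<lambda>x. det (mat r r (\<lambda>(a, b). f a b x))) =
      (\<lambda>x. \<Sum>p\<in>{p. p permutes {0..<r}}. signof p * (\<Prod>i = 0..<r. f i (p i) x))"
    by (subst det_def'[of _ r]) (auto intro!: sum.cong simp: i)
  also have "\<dots> \<in> polyf X"
    by (intro polyf_sum polyf.mult polyf.const polyf_prod assms) (auto simp: i)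
  finally show ?thesis .
qed

lemma row_minor_polyf:
  assumes "I \<subseteq> {..<m}" and "card I \<le> k"
  shows "row_minor I \<in> polyf ({..<m} \<times> {..<k})"
  unfolding row_minor_def[abs_def]
proof (rule det_polyf, rule polyf.coord)
  fix a b assume "a < card I" "b < card I"
  then show "(pick I a, b) \<in> {..<m} \<times> {..<k}" using pick_in_set_le[of a I] assms by auto
qed

text \<open>For upper triangular \<open>b\<close> the first columns of \<open>Q * b\<close> depend
  only on as many first columns of \<open>Q\<close>, so Cauchy-Binet has a single term.\<close>

lemma row_minor_mult_right:
  assumes Q: "Q \<in> carrier_mat m k" and b: "b \<in> carrier_mat k k"
    and ut: "\<And>i j. i < k \<Longrightarrow> j < i \<Longrightarrow> b $$ (i, j) = 0"
    and I: "I \<subseteq> {..<m}" "card I \<le> k"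
  shows "row_minor I (($$) (Q * b)) = (\<Prod>j<card I. b $$ (j, j)) * row_minor I (($$) Q)"
proof -
  let ?r = "card I"
  let ?A = "mat ?r ?r (\<lambda>(a, c). Q $$ (pick I a, c))"
  let ?B = "mat ?r ?r (($$) b)"
  have pm: "pick I a < m" if "a < ?r" for a using pick_in_set_le[OF that] I by auto
  have "mat ?r ?r (\<lambda>(a, c). (Q * b) $$ (pick I a, c)) = ?A * ?B"
  proof (rule eq_matI)
    fix a c assume "a < dim_row (?A * ?B)" "c < dim_col (?A * ?B)"
    then have ac: "a < ?r" "c < ?r" by auto
    have "(Q * b) $$ (pick I a, c) = (\<Sum>l = 0..<k. Q $$ (pick I a, l) * b $$ (l, c))"
      using Q b ac I pm[OF ac(1)] by (simp add: scalar_prod_def)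
    also have "\<dots> = (\<Sum>l = 0..<?r. Q $$ (pick I a, l) * b $$ (l, c))"
      by (rule sum.mono_neutral_right) (use I ut ac in auto)
    also have "\<dots> = (?A * ?B) $$ (a, c)" using ac by (simp add: scalar_prod_def)
    finally show "mat ?r ?r (\<lambda>(a, c). (Q * b) $$ (pick I a, c)) $$ (a, c) = (?A * ?B) $$ (a, c)"
      using ac by simp
  qed auto
  then have "row_minor I (($$) (Q * b)) = det ?A * det ?B"
    unfolding row_minor_def using det_mult[of ?A ?r ?B] by simp
  moreover have "det ?B = (\<Prod>j<?r. b $$ (j, j))"
  proof -
    have "det ?B = prod_list (diag_mat ?B)"
      by (rule det_upper_triangular[of _ ?r]) (use I ut in auto)
    then show ?thesis by (simp add: prod_list_diag_prod atLeast0LessThan)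
  qed
  ultimately show ?thesis by (simp add: row_minor_def)
qed

text \<open>The rows of \<open>Y\<close> with index in \<open>I\<close> are supported on
  \<open>I\<close> and lower triangular there, which again leaves one term. The sets
  \<open>{..<r} \<union> S\<close> in \<open>LLn\<close> have this property for transposed embedded
  upper triangular matrices.\<close>

lemma row_minor_mult_left:
  assumes Q: "Q \<in> carrier_mat m k" and Y: "Y \<in> carrier_mat m m"
    and Y0: "\<And>i l. i \<in> I \<Longrightarrow> l < m \<Longrightarrow> l \<notin> I \<or> i < l \<Longrightarrow> Y $$ (i, l) = 0"
    and I: "I \<subseteq> {..<m}" "card I \<le> k"
  shows "row_minor I (($$) (Y * Q)) = (\<Prod>i\<in>I. Y $$ (i, i)) * row_minor I (($$) Q)"
proof -
  let ?r = "card I"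
  have fin: "finite I" using I(1) by (rule finite_subset) simp
  let ?A = "mat ?r ?r (\<lambda>(a, c). Q $$ (pick I a, c))"
  let ?B = "mat ?r ?r (\<lambda>(a, c). Y $$ (pick I a, pick I c))"
  have pm: "pick I a < m" "pick I a \<in> I" if "a < ?r" for a using pick_in_set_le[OF that] I by auto
  have "mat ?r ?r (\<lambda>(a, c). (Y * Q) $$ (pick I a, c)) = ?B * ?A"
  proof (rule eq_matI)
    fix a c assume "a < dim_row (?B * ?A)" "c < dim_col (?B * ?A)"
    then have ac: "a < ?r" "c < ?r" by auto
    have "(Y * Q) $$ (pick I a, c) = (\<Sum>l = 0..<m. Y $$ (pick I a, l) * Q $$ (l, c))"
      using Q Y ac I pm[OF ac(1)] by (simp add: scalar_prod_def)
    also have "\<dots> = (\<Sum>l\<in>I. Y $$ (pick I a, l) * Q $$ (l, c))"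
      by (rule sum.mono_neutral_right) (use I Y0 pm[OF ac(1)] in auto)
    also have "\<dots> = (\<Sum>b<?r. Y $$ (pick I a, pick I b) * Q $$ (pick I b, c))"
      by (rule sum.reindex_bij_betw[OF bij_betw_pick[OF fin], symmetric])
    also have "\<dots> = (?B * ?A) $$ (a, c)" using ac by (simp add: scalar_prod_def atLeast0LessThan)
    finally show "mat ?r ?r (\<lambda>(a, c). (Y * Q) $$ (pick I a, c)) $$ (a, c) = (?B * ?A) $$ (a, c)"
      using ac by simp
  qed auto
  then have "row_minor I (($$) (Y * Q)) = det ?B * det ?A"
    unfolding row_minor_def using det_mult[of ?B ?r ?A] by simp
  moreover have "det ?B = (\<Prod>i\<in>I. Y $$ (i, i))"
  proof -
    have "det ?B = prod_list (diag_mat ?B)"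
    proof (rule det_lower_triangular)
      fix a c assume "a < c" "c < ?r"
      then show "?B $$ (a, c) = 0" using Y0[of "pick I a" "pick I c"] pm[of a] pm[of c] pick_mono_le[of c I a] by auto
    qed simp
    also have "\<dots> = (\<Prod>a<?r. Y $$ (pick I a, pick I a))"
      by (simp add: prod_list_diag_prod atLeast0LessThan)
    also have "\<dots> = (\<Prod>i\<in>I. Y $$ (i, i))"
      by (rule prod.reindex_bij_betw[OF bij_betw_pick[OF fin]])
    finally show ?thesis .
  qed
  ultimately show ?thesis by (simp add: row_minor_def)
qed

lemma prod_list_map_nth:
  fixes f :: "'a \<Rightarrow> 'b::comm_monoid_mult"
  shows "(\<Prod>I\<leftarrow>t. f I) = (\<Prod>c<length t. f (t ! c))"
  by (induction t) (simp_all add: prod.lessThan_Suc_shift del: prod.lessThan_Suc)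

lemma prod_list_prod_count:
  fixes b :: "nat \<Rightarrow> complex"
  shows "(\<Prod>I\<leftarrow>t. \<Prod>j | j < N \<and> P j I. b j) = (\<Prod>j<N. b j ^ card {c. c < length t \<and> P j (t ! c)})"
proof -
  have "(\<Prod>I\<leftarrow>t. \<Prod>j | j < N \<and> P j I. b j) = (\<Prod>c<length t. \<Prod>j | j < N \<and> P j (t ! c). b j)"
    by (rule prod_list_map_nth)
  also have "\<dots> = (\<Prod>c<length t. \<Prod>j<N. if P j (t ! c) then b j else 1)"
    by (rule prod.cong[OF refl]) (simp add: prod.inter_filter[symmetric])
  also have "\<dots> = (\<Prod>j<N. \<Prod>c<length t. if P j (t ! c) then b j else 1)" by (rule prod.swap)
  also have "\<dots> = (\<Prod>j<N. b j ^ card {c. c < length t \<and> P j (t ! c)})"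
    by (rule prod.cong[OF refl]) (simp add: prod.inter_filter[symmetric])
  finally show ?thesis .
qed

lemma prod_list_mult_distrib:
  fixes f g :: "'a \<Rightarrow> complex"
  shows "(\<Prod>I\<leftarrow>t. f I * g I) = (\<Prod>I\<leftarrow>t. f I) * (\<Prod>I\<leftarrow>t. g I)"
  by (induction t) auto

lemma tableaux_mem:
  assumes "t \<in> tableaux m n F D" and "\<forall>r\<ge>k. F r = 0" and "I \<in> set t"
  shows "I \<subseteq> {..<m}" and "card I \<le> k" and "I \<in> LLn m n"
proof -
  obtain c where c: "c < length t" "I = t ! c" using assms(3) by (metis in_set_conv_nth)
  show "I \<in> LLn m n" using assms(1,3) by (auto simp: tableaux_def standard_tableau_def)
  then show "I \<subseteq> {..<m}" by (auto simp: LLn_def LL_def)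
  have "\<not> k < card (col_set t c)" using tableauxD(2)[OF assms(1), of k c] assms(2) by simp
  then show "card I \<le> k" using c by (simp add: col_set_def)
qed

lemma standard_monomial_on_mat:
  assumes "t \<in> tableaux m n F D" and "\<forall>r\<ge>k. F r = 0"
  shows "standard_monomial m k t = on_mat m k (array_monomial t)"
  unfolding standard_monomial_def on_mat_def array_monomial_def
  using tableaux_mem[OF assms] minor_eq_row_minor
  by (fastforce simp: fun_eq_iff intro!: arg_cong[of _ _ prod_list])

lemma array_monomial_polyf:
  assumes "t \<in> tableaux m n F D" and "\<forall>r\<ge>k. F r = 0"
  shows "array_monomial t \<in> polyf ({..<m} \<times> {..<k})"
  unfolding array_monomial_def
  by (rule polyf_prod_list) (use tableaux_mem[OF assms] row_minor_polyf in blast)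

text \<open>Triangular \<open>b\<close> treats unipotent and diagonal matrices at once. Its diagonal
  entry \<open>j\<close> enters once for every column of \<open>t\<close> with more than
  \<open>j\<close> entries, hence \<open>F j\<close> times.\<close>

lemma array_monomial_mult_right:
  assumes t: "t \<in> tableaux m n F D" and k: "\<forall>r\<ge>k. F r = 0"
    and Q: "Q \<in> carrier_mat m k" and b: "b \<in> carrier_mat k k"
    and ut: "\<And>i j. i < k \<Longrightarrow> j < i \<Longrightarrow> b $$ (i, j) = 0"
  shows "array_monomial t (($$) (Q * b)) = (\<Prod>j<k. b $$ (j, j) ^ F j) * array_monomial t (($$) Q)"
proof -
  have "array_monomial t (($$) (Q * b)) =
      (\<Prod>I\<leftarrow>t. (\<Prod>j | j < k \<and> j < card I. b $$ (j, j)) * row_minor I (($$) Q))"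
    unfolding array_monomial_def
  proof (rule arg_cong[of _ _ prod_list], rule map_cong[OF refl])
    fix I assume I: "I \<in> set t"
    have "{j. j < k \<and> j < card I} = {..<card I}" using tableaux_mem(2)[OF t k I] by auto
    then show "row_minor I (($$) (Q * b)) = (\<Prod>j | j < k \<and> j < card I. b $$ (j, j)) * row_minor I (($$) Q)"
      using row_minor_mult_right[OF Q b ut tableaux_mem(1,2)[OF t k I]] by simp
  qed
  also have "\<dots> = (\<Prod>j<k. b $$ (j, j) ^ card {c. c < length t \<and> j < card (t ! c)}) * array_monomial t (($$) Q)"
    unfolding prod_list_mult_distrib prod_list_prod_count array_monomial_def ..
  finally have eq: "array_monomial t (($$) (Q * b)) =
    (\<Prod>j<k. b $$ (j, j) ^ card {c. c < length t \<and> j < card (t ! c)}) * array_monomial t (($$) Q)" .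
  have "card {c. c < length t \<and> j < card (t ! c)} = F j" for j
  proof (rule card_eq_if_initial)
    fix c
    show "c \<in> {c. c < length t \<and> j < card (t ! c)} \<longleftrightarrow> c < F j"
      unfolding tableauxD(2)[OF t, symmetric] by (auto simp: col_set_def)
  qed
  then show ?thesis using eq by simp
qed

lemma array_monomial_mult_left:
  assumes t: "t \<in> tableaux m n F D" and k: "\<forall>r\<ge>k. F r = 0" and "n \<le> m"
    and Q: "Q \<in> carrier_mat m k" and b: "b \<in> carrier_mat n n"
    and ut: "\<And>i j. i < n \<Longrightarrow> j < i \<Longrightarrow> b $$ (i, j) = 0"
  shows "array_monomial t (($$) (transpose_mat (embed m n b) * Q)) = (\<Prod>i<n. b $$ (i, i) ^ D i) * array_monomial t (($$) Q)"
proof -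
  let ?Y = "transpose_mat (embed m n b)"
  have Y: "?Y \<in> carrier_mat m m" using embed_carrier[OF assms(3) b] by simp
  have Yi: "?Y $$ (i, l) = (if l < n \<and> i < n then b $$ (l, i) else if i = l then 1 else 0)"
    if "i < m" "l < m" for i l
    using that embed_carrier[OF assms(3) b] embed_index[OF assms(3) b that(2,1)] by auto
  have "array_monomial t (($$) (?Y * Q)) =
      (\<Prod>I\<leftarrow>t. (\<Prod>i | i < n \<and> i \<in> I. b $$ (i, i)) * row_minor I (($$) Q))"
    unfolding array_monomial_def
  proof (rule arg_cong[of _ _ prod_list], rule map_cong[OF refl])
    fix I assume I: "I \<in> set t"
    obtain r S where rS: "r \<le> n" "S \<subseteq> {n..<m}" "I = {..<r} \<union> S"
      using tableaux_mem(3)[OF t k I] unfolding LLn_def by blast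
    have Im: "I \<subseteq> {..<m}" by (rule tableaux_mem(1)[OF t k I])
    \<comment> \<open>Row \<open>i < n\<close> of \<open>?Y\<close> lives on indices
      \<open>l \<le> i\<close>, which belong to \<open>{..<r}\<close> together with
      \<open>i\<close>; the rows from \<open>n\<close> on are those of the identity.\<close>
    have "?Y $$ (i, l) = 0" if "i \<in> I" "l < m" "l \<notin> I \<or> i < l" for i l
    proof (cases "i < n")
      case True
      then have "i < r" using that(1) rS by auto
      then have "i < l" using that(3) rS by auto
      then show ?thesis using Yi[of i l] that(1,2) Im ut by auto
    next
      case False
      then show ?thesis using Yi[of i l] that Im by auto
    qed
    note row_minor_mult_left[OF Q Y this Im tableaux_mem(2)[OF t k I]]
    moreover have "(\<Prod>i\<in>I. ?Y $$ (i, i)) = (\<Prod>i | i < n \<and> i \<in> I. b $$ (i, i))"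
    proof -
      have Yd: "?Y $$ (i, i) = (if i < n then b $$ (i, i) else 1)" if "i \<in> I" for i
        using Yi[of i i] that Im by auto
      have "(\<Prod>i\<in>I. ?Y $$ (i, i)) = (\<Prod>i | i < n \<and> i \<in> I. ?Y $$ (i, i))"
        by (rule prod.mono_neutral_right) (use finite_subset[OF Im] in \<open>auto simp: Yd\<close>)
      also have "\<dots> = (\<Prod>i | i < n \<and> i \<in> I. b $$ (i, i))"
        by (rule prod.cong) (auto simp: Yd)
      finally show ?thesis .
    qed
    ultimately show "row_minor I (($$) (?Y * Q)) = (\<Prod>i | i < n \<and> i \<in> I. b $$ (i, i)) * row_minor I (($$) Q)"
      by simp
  qed
  also have "\<dots> = (\<Prod>j<n. b $$ (j, j) ^ card {c. c < length t \<and> j \<in> t ! c}) * array_monomial t (($$) Q)"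
    unfolding prod_list_mult_distrib prod_list_prod_count array_monomial_def ..
  also have "(\<Prod>j<n. b $$ (j, j) ^ card {c. c < length t \<and> j \<in> t ! c}) = (\<Prod>i<n. b $$ (i, i) ^ D i)"
    unfolding tableauxD(3)[OF t, symmetric] inner_shape_def by simp
  finally show ?thesis .
qed

lemma unipotentD:
  assumes "u \<in> unipotent r"
  shows "u \<in> carrier_mat r r" and "i < r \<Longrightarrow> j < i \<Longrightarrow> u $$ (i, j) = 0" and "i < r \<Longrightarrow> u $$ (i, i) = 1"
  using assms GL_carrier[of u r] unfolding unipotent_def by (auto simp: upper_triangular_def)

lemma torusD:
  assumes "u \<in> torus r"
  shows "u \<in> carrier_mat r r" and "i < r \<Longrightarrow> j < r \<Longrightarrow> i \<noteq> j \<Longrightarrow> u $$ (i, j) = 0"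
  using assms GL_carrier[of u r] unfolding torus_def by (auto simp: diagonal_mat_def)

lemma standard_monomial_B_component:
  assumes t: "t \<in> tableaux m n F D" and k: "\<forall>r\<ge>k. F r = 0" and "n \<le> m"
  shows "standard_monomial m k t \<in> B_component m k n F D"
proof -
  let ?f = "standard_monomial m k t"
  have f: "?f Q = array_monomial t (($$) Q)" if "Q \<in> carrier_mat m k" for Q
    using that standard_monomial_on_mat[OF t k] by (simp add: on_mat_def)
  have p: "?f \<in> poly_funs m k"
    using on_mat_in_poly_funs[OF array_monomial_polyf[OF t k]] standard_monomial_on_mat[OF t k] by simp
  have "?f (Q * u) = ?f Q" if u: "u \<in> unipotent k" and Q: "Q \<in> carrier_mat m k" for u Q
  proof -
    note ud = unipotentD[OF u]
    have "Q * u \<in> carrier_mat m k" using Q ud(1) by simp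
    then show ?thesis using array_monomial_mult_right[OF t k Q ud(1,2)] ud(3) Q by (simp add: f)
  qed
  moreover have "?f (Q * u) = torus_char k F u * ?f Q" if u: "u \<in> torus k" and Q: "Q \<in> carrier_mat m k" for u Q
  proof -
    note ud = torusD[OF u]
    have "Q * u \<in> carrier_mat m k" using Q ud(1) by simp
    moreover have "array_monomial t (($$) (Q * u)) = (\<Prod>j<k. u $$ (j, j) ^ F j) * array_monomial t (($$) Q)"
      by (rule array_monomial_mult_right[OF t k Q ud(1)]) (use ud(2) in auto)
    ultimately show ?thesis using Q by (simp add: f torus_char_def)
  qed
  ultimately have r: "?f \<in> rho_summand m k F" unfolding hw_right_iff[OF p] by blast
  moreover have "?f (transpose_mat (embed m n u) * Q) = ?f Q"
    if u: "u \<in> unipotent n" and Q: "Q \<in> carrier_mat m k" for u Q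
  proof -
    note ud = unipotentD[OF u]
    have "transpose_mat (embed m n u) * Q \<in> carrier_mat m k"
      using Q embed_carrier[OF assms(3) ud(1)] by (intro mult_carrier_mat) auto
    then show ?thesis using array_monomial_mult_left[OF t k assms(3) Q ud(1,2)] ud(3) Q by (simp add: f)
  qed
  moreover have "?f (transpose_mat (embed m n u) * Q) = torus_char n D u * ?f Q"
    if u: "u \<in> torus n" and Q: "Q \<in> carrier_mat m k" for u Q
  proof -
    note ud = torusD[OF u]
    have "transpose_mat (embed m n u) * Q \<in> carrier_mat m k"
      using Q embed_carrier[OF assms(3) ud(1)] by (intro mult_carrier_mat) auto
    moreover have "array_monomial t (($$) (transpose_mat (embed m n u) * Q)) =
        (\<Prod>i<n. u $$ (i, i) ^ D i) * array_monomial t (($$) Q)"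
      by (rule array_monomial_mult_left[OF t k assms(3) Q ud(1)]) (use ud(2) in auto)
    ultimately show ?thesis using Q by (simp add: f torus_char_def)
  qed
  ultimately show ?thesis unfolding B_component_iff[OF assms(3)] by blast
qed

lemma array_monomial_hw_array:
  assumes t: "t \<in> tableaux m n F D" and k: "\<forall>r\<ge>k. F r = 0" and "n \<le> m"
  shows "array_monomial t \<in> hw_array m k n F D"
proof -
  have "standard_monomial m k t (mat m k x) = array_monomial t x" for x
    using standard_monomial_on_mat[OF t k] on_mat_mat[OF array_monomial_polyf[OF t k]] by simp
  then show ?thesis
    using B_component_hw_array[OF assms(3) standard_monomial_B_component[OF t k assms(3)]] by simp
qed

subsection \<open>Leading terms in the last row\<close>

definition row_monomial :: "nat \<Rightarrow> nat \<Rightarrow> (nat \<Rightarrow> nat) \<Rightarrow> array \<Rightarrow> complex" where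
  "row_monomial m k \<gamma> x = (\<Prod>j<k. x (m, j) ^ \<gamma> j)"

text \<open>The factors \<open>w\<close> stay abstract for now: leading terms of minors require them
  to increase with the column, and powers of a suitable base will make exponents
  distinguishable.\<close>

definition weight :: "(nat \<Rightarrow> nat) \<Rightarrow> nat \<Rightarrow> (nat \<Rightarrow> nat) \<Rightarrow> nat" where
  "weight w k \<gamma> = (\<Sum>j<k. \<gamma> j * w j)"

text \<open>The possible remainders after a leading term of weight \<open>R\<close> in the entries of row \<open>m\<close>.\<close>

inductive_set low :: "nat \<Rightarrow> nat \<Rightarrow> (nat \<Rightarrow> nat) \<Rightarrow> nat \<Rightarrow> (array \<Rightarrow> complex) set" for m k w R where
  zero: "(\<lambda>x. 0) \<in> low m k w R"
| step: "c \<in> polyf ({..<m} \<times> {..<k}) \<Longrightarrow> weight w k \<gamma> < R \<Longrightarrow> p \<in> low m k w R \<Longrightarrow>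
    (\<lambda>x. c x * row_monomial m k \<gamma> x + p x) \<in> low m k w R"

lemma row_monomial_add: "row_monomial m k (\<lambda>j. \<gamma> j + \<delta> j) x = row_monomial m k \<gamma> x * row_monomial m k \<delta> x"
  by (simp add: row_monomial_def power_add prod.distrib)

lemma weight_add: "weight w k (\<lambda>j. \<gamma> j + \<delta> j) = weight w k \<gamma> + weight w k \<delta>"
  by (simp add: weight_def distrib_right sum.distrib)

lemma low_mono: "p \<in> low m k w R \<Longrightarrow> R \<le> R' \<Longrightarrow> p \<in> low m k w R'"
  by (induction rule: low.induct) (auto intro: low.intros)

lemma low_term: "c \<in> polyf ({..<m} \<times> {..<k}) \<Longrightarrow> weight w k \<gamma> < R \<Longrightarrow>
    (\<lambda>x. c x * row_monomial m k \<gamma> x) \<in> low m k w R"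
  using low.step[OF _ _ low.zero] by simp

lemma low_add: "p \<in> low m k w R \<Longrightarrow> q \<in> low m k w R \<Longrightarrow> (\<lambda>x. p x + q x) \<in> low m k w R"
  by (induction rule: low.induct) (auto simp: add.assoc intro: low.intros)

lemma low_sum: "(\<And>a. a \<in> A \<Longrightarrow> p a \<in> low m k w R) \<Longrightarrow> (\<lambda>x. \<Sum>a\<in>A. p a x) \<in> low m k w R"
  by (induction A rule: infinite_finite_induct) (auto intro: low.zero low_add)

lemma low_mult_term:
  assumes "p \<in> low m k w R" and "c \<in> polyf ({..<m} \<times> {..<k})" and "weight w k \<beta> \<le> R'"
  shows "(\<lambda>x. c x * row_monomial m k \<beta> x * p x) \<in> low m k w (R + R')"
  using assms(1)
proof induction
  case zero
  then show ?case by (simp add: low.zero)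
next
  case (step d \<gamma> p)
  have "(\<lambda>x. (c x * d x) * row_monomial m k (\<lambda>j. \<gamma> j + \<beta> j) x + c x * row_monomial m k \<beta> x * p x)
      \<in> low m k w (R + R')"
    by (rule low.step) (use step assms in \<open>auto simp: weight_add intro: polyf.mult\<close>)
  then show ?case by (simp add: row_monomial_add algebra_simps)
qed

lemma low_mult_polyf:
  assumes "p \<in> low m k w R" and "c \<in> polyf ({..<m} \<times> {..<k})"
  shows "(\<lambda>x. c x * p x) \<in> low m k w R"
  using low_mult_term[OF assms, of "\<lambda>_. 0" 0] by (simp add: weight_def row_monomial_def)

lemma low_mult:
  assumes "p \<in> low m k w R" and "q \<in> low m k w R'"
  shows "(\<lambda>x. p x * q x) \<in> low m k w (R + R')"
  using assms(1)
proof induction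
  case zero
  then show ?case by (simp add: low.zero)
next
  case (step d \<gamma> p)
  have "(\<lambda>x. d x * row_monomial m k \<gamma> x * q x) \<in> low m k w (R' + R)"
    by (rule low_mult_term[OF assms(2)]) (use step in auto)
  from low_add[OF this[unfolded add.commute[of R']] step.IH] show ?case
    by (simp add: algebra_simps)
qed

lemma row_monomial_unit:
  "j < k \<Longrightarrow> row_monomial m k (\<lambda>i. if i = j then 1 else 0) x = x (m, j)"
  by (simp add: row_monomial_def if_distrib prod.delta cong: if_cong)

lemma weight_unit: "j < k \<Longrightarrow> weight w k (\<lambda>i. if i = j then 1 else 0) = w j"
  by (simp add: weight_def if_distrib[of "\<lambda>z. z * _"] sum.delta cong: if_cong)

text \<open>Provides the initial bound for the induction on the weight.\<close>

lemma polyf_low: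
  assumes "p \<in> polyf ({..<Suc m} \<times> {..<k})"
  obtains R where "p \<in> low m k w R"
proof -
  have base: "c \<in> low m k w 1" if "c \<in> polyf ({..<m} \<times> {..<k})" for c
    using low_term[OF that, of w "\<lambda>_. 0" 1] by (simp add: weight_def row_monomial_def)
  have "\<exists>R. p \<in> low m k w R"
    using assms
  proof induction
    case (const c)
    show ?case using base[OF polyf.const] by blast
  next
    case (coord i)
    obtain a j where i: "i = (a, j)" "a < Suc m" "j < k" using coord by auto
    show ?case
    proof (cases "a = m")
      case True
      have "(\<lambda>x. 1 * row_monomial m k (\<lambda>i. if i = j then 1 else 0) x) \<in> low m k w (Suc (w j))"
        by (rule low_term) (auto simp: weight_unit[OF i(3)] intro: polyf.const)
      then show ?thesis using i True by (auto simp: row_monomial_unit)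
    next
      case False
      then have "(\<lambda>x. x i) \<in> polyf ({..<m} \<times> {..<k})" using i by (intro polyf.coord) auto
      then show ?thesis using base by blast
    qed
  next
    case (add p q)
    then obtain R R' where "p \<in> low m k w R" "q \<in> low m k w R'" by blast
    then have "p \<in> low m k w (max R R')" "q \<in> low m k w (max R R')" by (auto intro: low_mono)
    then show ?case using low_add by blast
  next
    case (mult p q)
    then show ?case using low_mult by blast
  qed
  then show ?thesis using that by blast
qed

lemma low_collect:
  assumes "p \<in> low m k w R"
  shows "\<exists>S c. finite S \<and> (\<forall>\<gamma>\<in>S. weight w k \<gamma> < R) \<and> (\<forall>\<gamma>\<in>S. \<forall>j\<ge>k. \<gamma> j = 0) \<and>
      (\<forall>\<gamma>. c \<gamma> \<in> polyf ({..<m} \<times> {..<k})) \<and> (\<forall>x. p x = (\<Sum>\<gamma>\<in>S. c \<gamma> x * row_monomial m k \<gamma> x))"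
  using assms
proof induction
  case zero
  show ?case by (rule exI[of _ "{}"], rule exI[of _ "\<lambda>_ _. 0"]) (auto intro: polyf.const)
next
  case (step d \<delta> p)
  then obtain S c where S: "finite S" "\<forall>\<gamma>\<in>S. weight w k \<gamma> < R" "\<forall>\<gamma>\<in>S. \<forall>j\<ge>k. \<gamma> j = 0"
    "\<forall>\<gamma>. c \<gamma> \<in> polyf ({..<m} \<times> {..<k})" and p: "\<forall>x. p x = (\<Sum>\<gamma>\<in>S. c \<gamma> x * row_monomial m k \<gamma> x)"
    by blast
  \<comment> \<open>Values of an exponent at \<open>j \<ge> k\<close> are invisible to
    \<open>row_monomial\<close>. Setting them to 0 allows equal monomials to be recognised by
    equality of exponents.\<close>
  define \<delta>' where "\<delta>' = (\<lambda>j. if j < k then \<delta> j else 0)"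
  define c' where "c' = (\<lambda>\<gamma> x. (if \<gamma> \<in> S then c \<gamma> x else 0) + (if \<gamma> = \<delta>' then d x else 0))"
  have d: "row_monomial m k \<delta> x = row_monomial m k \<delta>' x" for x
    by (simp add: row_monomial_def \<delta>'_def)
  have w: "weight w k \<delta>' < R" using step(2) by (simp add: weight_def \<delta>'_def)
  have "c' \<gamma> \<in> polyf ({..<m} \<times> {..<k})" for \<gamma>
    unfolding c'_def by (cases "\<gamma> \<in> S"; cases "\<gamma> = \<delta>'") (use S(4) step(1) in \<open>auto intro: polyf.intros\<close>)
  moreover have "d x * row_monomial m k \<delta> x + p x = (\<Sum>\<gamma>\<in>insert \<delta>' S. c' \<gamma> x * row_monomial m k \<gamma> x)" for x
  proof -
    have "(\<Sum>\<gamma>\<in>insert \<delta>' S. c' \<gamma> x * row_monomial m k \<gamma> x) =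
        (\<Sum>\<gamma>\<in>insert \<delta>' S. if \<gamma> \<in> S then c \<gamma> x * row_monomial m k \<gamma> x else 0) +
        (\<Sum>\<gamma>\<in>insert \<delta>' S. if \<gamma> = \<delta>' then d x * row_monomial m k \<gamma> x else 0)"
      unfolding sum.distrib[symmetric] by (rule sum.cong) (auto simp: c'_def distrib_right)
    also have "(\<Sum>\<gamma>\<in>insert \<delta>' S. if \<gamma> \<in> S then c \<gamma> x * row_monomial m k \<gamma> x else 0) = p x"
      unfolding p[rule_format] by (rule sum.mono_neutral_cong_right) (use S(1) in auto)
    also have "(\<Sum>\<gamma>\<in>insert \<delta>' S. if \<gamma> = \<delta>' then d x * row_monomial m k \<gamma> x else 0) = d x * row_monomial m k \<delta> x"
      using S(1) by (simp add: sum.delta' sum.delta d)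
    finally show ?thesis by simp
  qed
  ultimately show ?case
    using S(1-3) w by (intro exI[of _ "insert \<delta>' S"] exI[of _ c']) (auto simp: \<delta>'_def)
qed

definition set_row :: "nat \<Rightarrow> (nat \<Rightarrow> complex) \<Rightarrow> array \<Rightarrow> array" where
  "set_row m q x = (\<lambda>(i, j). if i = m then q j else x (i, j))"

lemma polyf_set_row: "c \<in> polyf ({..<m} \<times> {..<k}) \<Longrightarrow> c (set_row m q x) = c x"
  by (erule polyf_cong) (auto simp: set_row_def)

lemma row_monomial_set_row: "row_monomial m k \<gamma> (set_row m q x) = (\<Prod>j<k. q j ^ \<gamma> j)"
  by (simp add: row_monomial_def set_row_def)

text \<open>All exponents in \<open>l\<close> have smaller weight than \<open>\<beta>\<close>, so
  none of them can cancel its monomial once the entries of row \<open>m\<close> vary freely.\<close>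

lemma leading_coefficient_unique:
  assumes G: "G \<in> polyf ({..<m} \<times> {..<k})" and l: "l \<in> low m k w (weight w k \<beta>)"
    and zero: "\<And>x. G x * row_monomial m k \<beta> x + l x = 0"
  shows "G x = 0"
proof -
  from low_collect[OF l] obtain S c where S: "finite S" "\<forall>\<gamma>\<in>S. weight w k \<gamma> < weight w k \<beta>"
    and "\<forall>\<gamma>\<in>S. \<forall>j\<ge>k. \<gamma> j = 0" and c: "\<forall>\<gamma>. c \<gamma> \<in> polyf ({..<m} \<times> {..<k})"
    and lx: "\<forall>x. l x = (\<Sum>\<gamma>\<in>S. c \<gamma> x * row_monomial m k \<gamma> x)"
    by (elim exE conjE)
  have nS: "\<beta> \<notin> S" using S(2) by blast
  define d where "d \<gamma> = (if \<gamma> = \<beta> then G x else c \<gamma> x)" for \<gamma>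
  have "(\<Sum>\<gamma>\<in>insert \<beta> S. d \<gamma> * (\<Prod>j<k. q j ^ \<gamma> j)) = 0" for q
  proof -
    have "(\<Sum>\<gamma>\<in>S. d \<gamma> * (\<Prod>j<k. q j ^ \<gamma> j)) = l (set_row m q x)"
      unfolding lx[rule_format] using nS
      by (intro sum.cong) (auto simp: d_def polyf_set_row[OF c[rule_format]] row_monomial_set_row)
    then show ?thesis
      using zero[of "set_row m q x"] S(1) nS
      by (simp add: d_def polyf_set_row[OF G] row_monomial_set_row)
  qed
  from monomials_independent[OF _ this, of \<beta>] S(1)
  have "(\<Sum>\<gamma> | \<gamma> \<in> insert \<beta> S \<and> (\<forall>j<k. \<gamma> j = \<beta> j). d \<gamma>) = 0" by simp
  moreover have "{\<gamma>. \<gamma> \<in> insert \<beta> S \<and> (\<forall>j<k. \<gamma> j = \<beta> j)} = {\<beta>}"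
  proof -
    have "\<gamma> = \<beta>" if \<gamma>: "\<gamma> \<in> insert \<beta> S" "\<forall>j<k. \<gamma> j = \<beta> j" for \<gamma>
    proof (rule ccontr)
      assume "\<gamma> \<noteq> \<beta>"
      then have "weight w k \<gamma> < weight w k \<beta>" using S(2) \<gamma>(1) by blast
      then show False using \<gamma>(2) by (simp add: weight_def)
    qed
    then show ?thesis by auto
  qed
  ultimately show ?thesis by (simp add: d_def)
qed

section \<open>Leading terms of minors and of monomials\<close>

lemma pick_remove_max:
  assumes "I \<subseteq> {..<Suc m}" and "m \<in> I" and "card I = Suc r"
  shows "pick I r = m" and "a < r \<Longrightarrow> pick I a = pick (I - {m}) a"
proof -
  have fin: "finite I" using assms(1) by (rule finite_subset) simp
  obtain b where b: "b < Suc r" "pick I b = m"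
    using bij_betw_pick[OF fin] assms(2,3) unfolding bij_betw_def by (metis imageE lessThan_iff)
  have "\<not> b < r"
    using pick_mono_le[of r I b] pick_in_set_le[of r I] assms b by auto
  then show m: "pick I r = m" using b by (cases "b = r") auto
  show "pick I a = pick (I - {m}) a" if "a < r"
  proof -
    let ?i = "pick I a"
    have i: "?i \<in> I" "?i < m" using pick_in_set_le[of a I] pick_mono_le[of r I a] that assms(3) m by auto
    then have "{b \<in> I - {m}. b < ?i} = {b \<in> I. b < ?i}" by auto
    then have "card {b \<in> I - {m}. b < ?i} = a" using card_pick_le[of a I] that assms(3) by simp
    moreover have "?i \<in> I - {m}" using i by auto
    ultimately show ?thesis using pick_card_in_set[of ?i "I - {m}"] by simp
  qed
qed

text \<open>Laplace expansion along the last row; the weights increase with the column.\<close>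

lemma row_minor_lead:
  assumes I: "I \<subseteq> {..<Suc m}" "m \<in> I" "card I = Suc r" "r < k" and w: "\<And>a b. a < b \<Longrightarrow> w a < (w b :: nat)"
  obtains l where "l \<in> low m k w (w r)"
    and "\<And>x. row_minor I x = row_minor (I - {m}) x * x (m, r) + l x"
proof -
  note pk = pick_remove_max[OF I(1-3)]
  have card: "card (I - {m}) = r" using I(2,3) by simp
  define A where "A x = mat (Suc r) (Suc r) (\<lambda>(a, b). x (pick I a, b))" for x :: array
  have A: "A x \<in> carrier_mat (Suc r) (Suc r)" for x by (simp add: A_def)
  have del: "mat_delete (A x) r j = mat r r (\<lambda>(a, b). x (pick (I - {m}) a, if b < j then b else Suc b))"
    if "j < Suc r" for j x
    by (rule eq_matI) (auto simp: mat_delete_def A_def pk(2))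
  have ex: "row_minor I x = (\<Sum>j<Suc r. x (m, j) * cofactor (A x) r j)" for x
    unfolding row_minor_def I(3) using laplace_expansion_row[OF A[of x], of r]
    by (simp add: A_def pk(1))
  \<comment> \<open>This cofactor carries the sign \<open>(- 1) ^ (r + r)\<close>, which is
    1.\<close>
  have last: "cofactor (A x) r r = row_minor (I - {m}) x" for x
  proof -
    have "mat_delete (A x) r r = mat r r (\<lambda>(a, b). x (pick (I - {m}) a, b))"
      unfolding del[OF lessI] by (rule cong_mat) auto
    then show ?thesis unfolding cofactor_def row_minor_def card by (simp flip: mult_2)
  qed
  have pf: "(\<lambda>x. cofactor (A x) r j) \<in> polyf ({..<m} \<times> {..<k})" if "j < r" for j
  proof -
    have j: "j < Suc r" using that by simp
    have "pick (I - {m}) a < m" if "a < r" for a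
      using pick_in_set_le[of a "I - {m}"] that card I(1) by auto
    then have "(\<lambda>x. det (mat r r (\<lambda>(a, b). x (pick (I - {m}) a, if b < j then b else Suc b)))) \<in> polyf ({..<m} \<times> {..<k})"
      using I(4) by (intro det_polyf polyf.coord) auto
    then show ?thesis unfolding cofactor_def del[OF j] by (intro polyf.mult polyf.const)
  qed
  show ?thesis
  proof
    show "(\<lambda>x. \<Sum>j<r. cofactor (A x) r j * row_monomial m k (\<lambda>i. if i = j then 1 else 0) x) \<in> low m k w (w r)"
      by (intro low_sum low_term) (use I(4) pf w in \<open>auto simp: weight_unit\<close>)
    show "row_minor I x = row_minor (I - {m}) x * x (m, r) +
        (\<Sum>j<r. cofactor (A x) r j * row_monomial m k (\<lambda>i. if i = j then 1 else 0) x)" for x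
      using I(4) by (simp add: ex last row_monomial_unit mult.commute)
  qed
qed

text \<open>The exponent of \<open>x (m, j)\<close> in the leading term: a minor of size
  \<open>j + 1\<close> that uses row \<open>m\<close> contributes the entry of that row in its last
  column \<open>j\<close>.\<close>

definition strip_exponent :: "nat \<Rightarrow> nat set list \<Rightarrow> nat \<Rightarrow> nat" where
  "strip_exponent m t j = (\<Sum>I\<leftarrow>t. if m \<in> I \<and> card I = Suc j then 1 else 0)"

lemma array_monomial_lead:
  assumes "\<And>I. I \<in> set t \<Longrightarrow> I \<subseteq> {..<Suc m} \<and> card I \<le> k" and w: "\<And>a b. a < b \<Longrightarrow> w a < (w b :: nat)"
  shows "\<exists>l\<in>low m k w (weight w k (strip_exponent m t)). \<forall>x. array_monomial t x =
    (\<Prod>I\<leftarrow>t. row_minor (I - {m}) x) * row_monomial m k (strip_exponent m t) x + l x"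
  using assms(1)
proof (induction t)
  case Nil
  show ?case
    by (rule bexI[of _ "\<lambda>_. 0"]) (auto simp: array_monomial_def row_monomial_def strip_exponent_def low.zero)
next
  case (Cons I t)
  let ?g = "\<lambda>x. \<Prod>I\<leftarrow>t. row_minor (I - {m}) x"
  obtain l where l: "l \<in> low m k w (weight w k (strip_exponent m t))"
    and lx: "\<And>x. array_monomial t x = ?g x * row_monomial m k (strip_exponent m t) x + l x"
    using Cons by auto
  have I: "I \<subseteq> {..<Suc m}" "card I \<le> k" using Cons.prems[of I] by auto
  have fin: "finite I" using I(1) by (rule finite_subset) simp
  define e where "e = (\<lambda>j. if m \<in> I \<and> card I = Suc j then 1 else 0 :: nat)"
  have g1: "row_minor (I - {m}) \<in> polyf ({..<m} \<times> {..<k})"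
    using I card_mono[OF fin, of "I - {m}"] by (intro row_minor_polyf) auto
  have g2: "?g \<in> polyf ({..<m} \<times> {..<k})"
  proof (rule polyf_prod_list)
    fix J assume "J \<in> set t"
    then have J: "J \<subseteq> {..<Suc m}" "card J \<le> k" using Cons.prems by auto
    then have "card (J - {m}) \<le> k" by (meson card_Diff1_le finite_lessThan finite_subset le_trans)
    then show "row_minor (J - {m}) \<in> polyf ({..<m} \<times> {..<k})" using J by (intro row_minor_polyf) auto
  qed
  obtain l1 where l1: "l1 \<in> low m k w (weight w k e)"
    and l1x: "\<And>x. row_minor I x = row_minor (I - {m}) x * row_monomial m k e x + l1 x"
  proof (cases "m \<in> I")
    case True
    then obtain r where r: "card I = Suc r" using fin by (metis card_0_eq empty_iff not0_implies_Suc)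
    then have rk: "r < k" using I by simp
    have e: "e = (\<lambda>i. if i = r then 1 else 0)" using True r by (auto simp: e_def fun_eq_iff)
    from row_minor_lead[OF I(1) True r rk, of w] w
    obtain l where "l \<in> low m k w (w r)" "\<And>x. row_minor I x = row_minor (I - {m}) x * x (m, r) + l x"
      by blast
    then show ?thesis using that rk by (simp add: e weight_unit row_monomial_unit)
  next
    case False
    then have "e = (\<lambda>_. 0)" by (simp add: e_def)
    then show ?thesis using that[OF low.zero] False by (simp add: row_monomial_def)
  qed
  have s: "strip_exponent m (I # t) = (\<lambda>j. e j + strip_exponent m t j)"
    by (auto simp: strip_exponent_def e_def fun_eq_iff)
  \<comment> \<open>What remains of a product \<open>(A + l1) * (B + l)\<close> besides
    \<open>A * B\<close>: three products, each with a factor of smaller weight than the leading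
    one.\<close>
  let ?l = "\<lambda>x. (row_minor (I - {m}) x * row_monomial m k e x * l x +
    ?g x * row_monomial m k (strip_exponent m t) x * l1 x) + l1 x * l x"
  have "?l \<in> low m k w (weight w k (strip_exponent m (I # t)))"
    unfolding s weight_add
  proof (intro low_add)
    show "(\<lambda>x. row_minor (I - {m}) x * row_monomial m k e x * l x) \<in>
        low m k w (weight w k e + weight w k (strip_exponent m t))"
      using low_mult_term[OF l g1 order_refl] by (simp add: add.commute)
    show "(\<lambda>x. ?g x * row_monomial m k (strip_exponent m t) x * l1 x) \<in>
        low m k w (weight w k e + weight w k (strip_exponent m t))"
      by (rule low_mult_term[OF l1 g2 order_refl])
  qed (rule low_mult[OF l1 l])
  then show ?case
  proof (rule bexI[rotated], intro allI)
    fix x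
    show "array_monomial (I # t) x = (\<Prod>J\<leftarrow>I # t. row_minor (J - {m}) x) *
      row_monomial m k (strip_exponent m (I # t)) x + ?l x"
    proof -
      have "array_monomial (I # t) x = row_minor I x * array_monomial t x"
        by (simp add: array_monomial_def)
      then show ?thesis unfolding s row_monomial_add lx l1x by (simp add: algebra_simps)
    qed
  qed
qed

text \<open>Column \<open>c\<close> has \<open>m\<close> as its entry number \<open>j + 1\<close>
  iff \<open>F' j \<le> c < F j\<close>, so the exponent at \<open>j\<close> counts the boxes of the
  strip in row \<open>j\<close>.\<close>

lemma add_strip_lead:
  assumes u: "u \<in> tableaux m n F' D" and i: "interlaces F' F" and k: "\<forall>r\<ge>k. F r = 0" and "n \<le> m"
    and w: "\<And>a b. a < b \<Longrightarrow> w a < (w b :: nat)"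
  shows "\<exists>l\<in>low m k w (weight w k (\<lambda>j. F j - F' j)). \<forall>x. array_monomial (add_strip m F u) x =
    array_monomial u x * row_monomial m k (\<lambda>j. F j - F' j) x + l x"
proof -
  let ?t = "add_strip m F u"
  have t: "?t \<in> tableaux (Suc m) n F D" by (rule add_strip_tableaux[OF u i assms(4)])
  have len: "length ?t = F 0" by (simp add: add_strip_def)
  have nth: "?t ! c = col_set ?t c" if "c < F 0" for c using that len by (simp add: col_set_def)
  note ct = col_set_add_strip[OF u i]
  have mu: "m \<notin> col_set u c" "finite (col_set u c)" for c
    using standard_tableau_col(1,2)[OF tableauxD(1)[OF u], of c] by auto
  have "strip_exponent m ?t j = F j - F' j" for j
  proof -
    have "strip_exponent m ?t j = (\<Sum>c<F 0. if m \<in> ?t ! c \<and> card (?t ! c) = Suc j then 1 else 0)"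
      unfolding strip_exponent_def by (simp add: sum_list_sum_nth len atLeast0LessThan)
    also have "\<dots> = (\<Sum>c<F 0. if c \<in> {F' j..<F j} then 1 else 0)"
    proof (rule sum.cong[OF refl])
      fix c assume "c \<in> {..<F 0}"
      then have c: "c < F 0" by simp
      have "m \<in> ?t ! c \<and> card (?t ! c) = Suc j \<longleftrightarrow> c < F j \<and> card (col_set u c) = j"
        unfolding nth[OF c] ct using mu[of c] by auto
      also have "\<dots> \<longleftrightarrow> c \<in> {F' j..<F j}"
      proof
        assume "c < F j \<and> card (col_set u c) = j"
        then show "c \<in> {F' j..<F j}" using tableauxD(2)[OF u, of j c] by auto
      next
        assume a: "c \<in> {F' j..<F j}"
        then have le: "card (col_set u c) \<le> j" using tableauxD(2)[OF u, of j c] by auto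
        have "\<not> card (col_set u c) < j"
        proof
          assume "card (col_set u c) < j"
          then obtain q where q: "j = Suc q" "card (col_set u c) \<le> q" by (cases j) auto
          then have "F' q \<le> c" using tableauxD(2)[OF u, of q c] by auto
          moreover have "F (Suc q) \<le> F' q" using i by (simp add: interlaces_def)
          ultimately show False using a q(1) by simp
        qed
        then show "c < F j \<and> card (col_set u c) = j" using le a by simp
      qed
      finally show "(if m \<in> ?t ! c \<and> card (?t ! c) = Suc j then 1 else 0) =
          (if c \<in> {F' j..<F j} then 1 else (0::nat))" by simp
    qed
    also have "\<dots> = card ({..<F 0} \<inter> {F' j..<F j})"
      by (simp add: sum.If_cases) (rule arg_cong[of _ _ card], auto)
    also have "{..<F 0} \<inter> {F' j..<F j} = {F' j..<F j}"
      using antimonoD[OF interlaces_antimono(1)[OF i], of 0 j] by auto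
    finally show ?thesis by simp
  qed
  then have s: "strip_exponent m ?t = (\<lambda>j. F j - F' j)" by auto
  have g: "(\<Prod>I\<leftarrow>?t. row_minor (I - {m}) x) = array_monomial u x" for x
  proof -
    have "length u = F' 0" by (rule tableaux_length[OF u])
    then have lu: "length u \<le> F 0" using i by (simp add: interlaces_def)
    have "(\<Prod>I\<leftarrow>?t. row_minor (I - {m}) x) = (\<Prod>c<F 0. row_minor (?t ! c - {m}) x)"
      by (simp add: prod_list_map_nth len)
    also have "\<dots> = (\<Prod>c<F 0. row_minor (col_set u c) x)"
    proof (rule prod.cong[OF refl])
      fix c assume "c \<in> {..<F 0}"
      then have "?t ! c - {m} = col_set u c" using nth[of c] mu[of c] by (auto simp: ct)
      then show "row_minor (?t ! c - {m}) x = row_minor (col_set u c) x" by simp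
    qed
    \<comment> \<open>Columns beyond \<open>u\<close> give the minor of the empty set, which is
      1.\<close>
    also have "\<dots> = (\<Prod>c<length u. row_minor (u ! c) x)"
      by (rule prod.mono_neutral_cong_right) (use lu in \<open>auto simp: col_set_def row_minor_def\<close>)
    finally show ?thesis by (simp add: array_monomial_def prod_list_map_nth)
  qed
  have "I \<subseteq> {..<Suc m} \<and> card I \<le> k" if "I \<in> set ?t" for I
    using tableaux_mem[OF t k that] by blast
  from array_monomial_lead[of ?t m k w, OF this w] show ?thesis unfolding s g .
qed

text \<open>Makes \<open>weight\<close> injective on exponents below \<open>N\<close> when its
  factors are the powers of \<open>N\<close>.\<close>

lemma digits_unique:
  fixes a b :: "nat \<Rightarrow> nat"
  assumes "\<And>j. j < k \<Longrightarrow> a j < N" and "\<And>j. j < k \<Longrightarrow> b j < N"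
    and "(\<Sum>j<k. a j * N ^ j) = (\<Sum>j<k. b j * N ^ j)" and "j < k"
  shows "a j = b j"
  using assms
proof (induction k arbitrary: a b j)
  case 0
  then show ?case by simp
next
  case (Suc k)
  have e: "(\<Sum>j<Suc k. c j * N ^ j) = c 0 + N * (\<Sum>j<k. c (Suc j) * N ^ j)" for c :: "nat \<Rightarrow> nat"
    by (simp add: sum.lessThan_Suc_shift sum_distrib_left mult_ac del: sum.lessThan_Suc)
  have eq: "a 0 + N * (\<Sum>j<k. a (Suc j) * N ^ j) = b 0 + N * (\<Sum>j<k. b (Suc j) * N ^ j)"
    using Suc.prems(3) unfolding e .
  have lt: "a 0 < N" "b 0 < N" using Suc.prems(1,2) by auto
  have 0: "a 0 = b 0" using arg_cong[OF eq, of "\<lambda>x. x mod N"] lt by simp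
  then have "(\<Sum>j<k. a (Suc j) * N ^ j) = (\<Sum>j<k. b (Suc j) * N ^ j)" using eq lt by simp
  then have "a (Suc i) = b (Suc i)" if "i < k" for i
    using Suc.IH[of "\<lambda>j. a (Suc j)" "\<lambda>j. b (Suc j)" i] Suc.prems(1,2) that by simp
  then show ?case using 0 Suc.prems(4) by (cases j) auto
qed

subsection \<open>Leading coefficients of highest weight functions\<close>

text \<open>A shift of the variable preserves the top coefficient. This will give the invariance of
  a leading coefficient under column operations.\<close>

lemma leading_coeff_translate:
  fixes u v :: "nat \<Rightarrow> complex"
  assumes "\<And>y. (\<Sum>l\<le>e. u l * (y + z) ^ l) = (\<Sum>l\<le>e. v l * y ^ l)"
  shows "u e = v e"
proof -
  let ?P = "\<Sum>l\<le>e. smult (u l) ([:z, 1:] ^ l)"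
  let ?Q = "\<Sum>l\<le>e. monom (v l) l"
  have "poly ?P y = poly ?Q y" for y
    using assms[of y] by (simp add: poly_sum poly_monom poly_power add.commute)
  then have "?P = ?Q" by (simp add: poly_eq_poly_eq_iff[symmetric] fun_eq_iff)
  moreover have "coeff ?P e = u e"
  proof -
    have "coeff ([:z, 1:] ^ l) e = (if l = e then 1 else 0)" if "l \<le> e" for l
    proof (cases "l = e")
      case True
      have "lead_coeff ([:z, 1:] ^ e) = 1" by (simp add: lead_coeff_power)
      then show ?thesis using True by (simp add: degree_linear_power)
    next
      case False
      then show ?thesis using that by (simp add: coeff_eq_0 degree_linear_power)
    qed
    then have "coeff ?P e = (\<Sum>l\<le>e. if l = e then u l else 0)"
      unfolding coeff_sum by (intro sum.cong) auto
    then show ?thesis by simp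
  qed
  moreover have "coeff ?Q e = v e" by (simp add: coeff_sum coeff_monom)
  ultimately show ?thesis by simp
qed

text \<open>The pole of \<open>poly P (1 / s)\<close> at 0 has order \<open>degree P\<close> and
  must be absorbed by \<open>s ^ A\<close>. This turns homogeneity in a column into a degree
  bound.\<close>

lemma degree_le_if_reversed:
  fixes P R :: "complex poly"
  assumes "\<And>s. s \<noteq> 0 \<Longrightarrow> poly R s = s ^ A * poly P (1 / s)"
  shows "degree P \<le> A"
proof (cases "P = 0")
  case False
  \<comment> \<open>The hypothesis at \<open>s = 1 / w\<close>, with denominators cleared.\<close>
  have "monom 1 (degree R) * P - monom 1 A * reflect_poly R = 0"
  proof (rule poly_eq_0_if_cofinite[of "{0}"])
    fix w :: complex assume "w \<notin> {0}"
    then have w: "w \<noteq> 0" by simp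
    have "w ^ A * (w ^ degree R * poly R (1 / w)) = w ^ degree R * poly P w"
      using assms[of "1 / w"] w by (simp add: power_divide)
    then show "poly (monom 1 (degree R) * P - monom 1 A * reflect_poly R) w = 0"
      using w by (simp add: poly_monom poly_reflect_poly_nz inverse_eq_divide)
  qed simp
  then have "degree (monom 1 (degree R) * P) = degree (monom 1 A * reflect_poly R)" by simp
  moreover have "degree (monom 1 (degree R) * P) = degree R + degree P"
    using False by (subst degree_mult_eq) (auto simp: degree_monom_eq monom_eq_0_iff)
  moreover have "degree (monom 1 A * reflect_poly R) \<le> A + degree R"
    using degree_mult_le[of "monom 1 A" "reflect_poly R"] degree_reflect_poly_le[of R]
    by (simp add: degree_monom_eq)
  ultimately show ?thesis by simp
qed simp

text \<open>The expansion of \<open>p\<close> in the entries of row \<open>m\<close>.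
  \<open>supp\<close> lets exponents be compared by equality, and \<open>zero\<close> lets sums run
  over exponents outside \<open>S\<close>.\<close>

locale row_expansion =
  fixes m k n :: nat and F D :: "nat \<Rightarrow> nat" and p :: "array \<Rightarrow> complex"
    and S :: "(nat \<Rightarrow> nat) set" and c :: "(nat \<Rightarrow> nat) \<Rightarrow> array \<Rightarrow> complex"
  assumes hw: "p \<in> hw_array (Suc m) k n F D" and nm: "n \<le> m" and fin: "finite S"
    and supp: "\<gamma> \<in> S \<Longrightarrow> k \<le> j \<Longrightarrow> \<gamma> j = 0"
    and poly: "c \<gamma> \<in> polyf ({..<m} \<times> {..<k})" and zero: "\<gamma> \<notin> S \<Longrightarrow> c \<gamma> x = 0"
    and expand: "p x = (\<Sum>\<gamma>\<in>S. c \<gamma> x * row_monomial m k \<gamma> x)"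
begin

lemma coef_cong: "(\<And>i j. i < m \<Longrightarrow> j < k \<Longrightarrow> x (i, j) = y (i, j)) \<Longrightarrow> c \<gamma> x = c \<gamma> y"
  by (rule polyf_cong[OF poly]) auto

text \<open>As \<open>d\<close> does not see row \<open>m\<close>, the entries of that row are free
  variables and coefficients can be compared.\<close>

lemma coef_compare:
  assumes "\<And>\<gamma> q. d \<gamma> (set_row m q x) = d \<gamma> x"
    and "\<And>x. (\<Sum>\<gamma>\<in>S. d \<gamma> x * row_monomial m k \<gamma> x) = 0" and "\<gamma> \<in> S"
  shows "d \<gamma> x = 0"
proof -
  have "(\<Sum>t\<in>S. d t x * (\<Prod>j<k. q j ^ t j)) = 0" for q
    using assms(2)[of "set_row m q x"] by (simp add: assms(1) row_monomial_set_row)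
  from monomials_independent[OF fin this, of \<gamma>]
  have "(\<Sum>t | t \<in> S \<and> (\<forall>j<k. t j = \<gamma> j). d t x) = 0" by simp
  moreover have "{t. t \<in> S \<and> (\<forall>j<k. t j = \<gamma> j)} = {\<gamma>}"
  proof (intro equalityI subsetI)
    fix t assume t: "t \<in> {t. t \<in> S \<and> (\<forall>j<k. t j = \<gamma> j)}"
    have "t j = \<gamma> j" for j
      using t supp[of t j] supp[OF assms(3), of j] by (cases "j < k") auto
    then show "t \<in> {\<gamma>}" by auto
  qed (use assms(3) in auto)
  ultimately show ?thesis by simp
qed

lemma coef_rowop:
  assumes "a < b" "b < n"
  shows "c \<gamma> (rowop a b s x) = c \<gamma> x"
proof (cases "\<gamma> \<in> S")
  case True
  have "c \<gamma> (rowop a b s x) - c \<gamma> x = 0"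
  proof (rule coef_compare[where d = "\<lambda>\<gamma> x. c \<gamma> (rowop a b s x) - c \<gamma> x", OF _ _ True])
    fix \<gamma> q
    show "c \<gamma> (rowop a b s (set_row m q x)) - c \<gamma> (set_row m q x) = c \<gamma> (rowop a b s x) - c \<gamma> x"
      using assms nm by (intro arg_cong2[of _ _ _ _ minus] coef_cong) (auto simp: rowop_def set_row_def)
  next
    fix x
    have "row_monomial m k \<gamma> (rowop a b s x) = row_monomial m k \<gamma> x" for \<gamma>
      using assms nm by (simp add: row_monomial_def rowop_def)
    then have "p (rowop a b s x) = (\<Sum>\<gamma>\<in>S. c \<gamma> (rowop a b s x) * row_monomial m k \<gamma> x)"
      by (simp add: expand)
    then show "(\<Sum>\<gamma>\<in>S. (c \<gamma> (rowop a b s x) - c \<gamma> x) * row_monomial m k \<gamma> x) = 0"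
      using hw_arrayD(4)[OF hw assms, of s x] by (simp add: left_diff_distrib sum_subtractf expand)
  qed
  then show ?thesis by simp
qed (simp add: zero)

lemma coef_rowscale:
  assumes "\<And>i. i < n \<Longrightarrow> e i \<noteq> 0"
  shows "c \<gamma> (rowscale (\<lambda>i. if i < n then e i else 1) x) = (\<Prod>i<n. e i ^ D i) * c \<gamma> x"
proof (cases "\<gamma> \<in> S")
  case True
  let ?r = "rowscale (\<lambda>i. if i < n then e i else 1)"
  have "c \<gamma> (?r x) - (\<Prod>i<n. e i ^ D i) * c \<gamma> x = 0"
  proof (rule coef_compare[where d = "\<lambda>\<gamma> x. c \<gamma> (?r x) - (\<Prod>i<n. e i ^ D i) * c \<gamma> x", OF _ _ True])
    fix \<gamma> q
    have "c \<gamma> (?r (set_row m q x)) = c \<gamma> (?r x)" "c \<gamma> (set_row m q x) = c \<gamma> x"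
      by (rule coef_cong; simp add: rowscale_def set_row_def)+
    then show "c \<gamma> (?r (set_row m q x)) - (\<Prod>i<n. e i ^ D i) * c \<gamma> (set_row m q x) =
        c \<gamma> (?r x) - (\<Prod>i<n. e i ^ D i) * c \<gamma> x" by simp
  next
    fix x
    have "row_monomial m k \<gamma> (?r x) = row_monomial m k \<gamma> x" for \<gamma>
      using nm by (simp add: row_monomial_def rowscale_def)
    then have "p (?r x) = (\<Sum>\<gamma>\<in>S. c \<gamma> (?r x) * row_monomial m k \<gamma> x)"
      by (simp add: expand)
    moreover have "p (?r x) = (\<Prod>i<n. e i ^ D i) * p x" by (rule hw_arrayD(5)[OF hw assms])
    ultimately show "(\<Sum>\<gamma>\<in>S. (c \<gamma> (?r x) - (\<Prod>i<n. e i ^ D i) * c \<gamma> x) * row_monomial m k \<gamma> x) = 0"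
      by (simp add: left_diff_distrib sum_subtractf expand sum_distrib_left mult.assoc)
  qed
  then show ?thesis by simp
qed (simp add: zero)

text \<open>The powers with exponent \<open>\<gamma> j\<close> stay on the left, since the
  difference \<open>F j - \<gamma> j\<close> is meaningful only after
  \<open>\<gamma> j \<le> F j\<close>, which is derived from this identity.\<close>

lemma coef_colscale_exponent:
  assumes e: "\<And>j. j < k \<Longrightarrow> e j \<noteq> 0"
  shows "c \<gamma> (colscale e x) * (\<Prod>j<k. e j ^ \<gamma> j) = (\<Prod>j<k. e j ^ F j) * c \<gamma> x"
proof (cases "\<gamma> \<in> S")
  case True
  let ?d = "\<lambda>\<gamma> x. c \<gamma> (colscale e x) * (\<Prod>j<k. e j ^ \<gamma> j) - (\<Prod>j<k. e j ^ F j) * c \<gamma> x"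
  have "?d \<gamma> x = 0"
  proof (rule coef_compare[where d = ?d, OF _ _ True])
    fix \<gamma> q
    have "c \<gamma> (colscale e (set_row m q x)) = c \<gamma> (colscale e x)" "c \<gamma> (set_row m q x) = c \<gamma> x"
      by (rule coef_cong; simp add: colscale_def set_row_def)+
    then show "?d \<gamma> (set_row m q x) = ?d \<gamma> x" by simp
  next
    fix x
    have "row_monomial m k \<gamma> (colscale e x) = (\<Prod>j<k. e j ^ \<gamma> j) * row_monomial m k \<gamma> x" for \<gamma>
      by (simp add: row_monomial_def colscale_def power_mult_distrib prod.distrib)
    then have "p (colscale e x) = (\<Sum>\<gamma>\<in>S. c \<gamma> (colscale e x) * (\<Prod>j<k. e j ^ \<gamma> j) * row_monomial m k \<gamma> x)"
      by (simp add: expand mult.assoc)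
    moreover have "p (colscale e x) = (\<Prod>j<k. e j ^ F j) * p x" by (rule hw_arrayD(3)[OF hw e])
    ultimately show "(\<Sum>\<gamma>\<in>S. ?d \<gamma> x * row_monomial m k \<gamma> x) = 0"
      by (simp add: left_diff_distrib sum_subtractf expand sum_distrib_left mult.assoc)
  qed
  then show ?thesis by simp
qed (simp add: zero)

text \<open>Otherwise \<open>c \<gamma>\<close> at the array with column \<open>j\<close> scaled by
  \<open>s\<close>, times a positive power of \<open>s\<close>, would be the nonzero constant
  \<open>c \<gamma> x\<close>; at \<open>s = 0\<close> the product vanishes.\<close>

lemma coef_exponent_le:
  assumes "j < k" and "c \<gamma> x \<noteq> 0"
  shows "\<gamma> j \<le> F j"
proof (rule ccontr)
  assume n: "\<not> ?thesis"
  let ?e = "\<lambda>s i :: nat. if i = j then s else 1 :: complex"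
  obtain P where P: "\<forall>s. c \<gamma> (\<lambda>i. poly (if snd i = j then [:0, x i:] else [:x i:]) s) = Polynomial.poly P s"
    using polyf_line[OF poly] by (rule exE)
  have cs: "c \<gamma> (colscale (?e s) x) = Polynomial.poly P s" for s
  proof -
    have "(\<lambda>i. poly (if snd i = j then [:0, x i:] else [:x i:]) s) = colscale (?e s) x"
      by (auto simp: colscale_def fun_eq_iff)
    then show ?thesis using P[rule_format, of s] by simp
  qed
  have e: "(\<Prod>i<k. ?e s i ^ \<delta> i) = s ^ \<delta> j" for s :: complex and \<delta> :: "nat \<Rightarrow> nat"
    using assms(1) by (simp add: if_distrib[of "\<lambda>z. z ^ _"] prod.delta cong: if_cong)
  have "monom 1 (\<gamma> j - F j) * P - [:c \<gamma> x:] = 0"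
  proof (rule poly_eq_0_if_cofinite[of "{0}"])
    fix s :: complex assume "s \<notin> {0}"
    then have s: "s \<noteq> 0" by simp
    have "Polynomial.poly P s * s ^ \<gamma> j = s ^ F j * c \<gamma> x"
      using coef_colscale_exponent[of "?e s" \<gamma> x] s by (simp add: e cs)
    moreover have "s ^ \<gamma> j = s ^ F j * s ^ (\<gamma> j - F j)" using n by (simp flip: power_add)
    ultimately have "Polynomial.poly P s * s ^ (\<gamma> j - F j) = c \<gamma> x" using s by simp
    then show "Polynomial.poly (monom 1 (\<gamma> j - F j) * P - [:c \<gamma> x:]) s = 0"
      by (simp add: poly_monom mult.commute)
  qed simp
  then have "Polynomial.poly (monom 1 (\<gamma> j - F j) * P - [:c \<gamma> x:]) 0 = 0" by simp
  then show False using n assms(2) by (simp add: poly_monom power_0_left)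
qed

lemma coef_colscale:
  assumes e: "\<And>j. j < k \<Longrightarrow> e j \<noteq> 0"
  shows "c \<gamma> (colscale e x) = (\<Prod>j<k. e j ^ (F j - \<gamma> j)) * c \<gamma> x"
proof (cases "c \<gamma> x = 0")
  case True
  have "(\<Prod>j<k. e j ^ \<gamma> j) \<noteq> 0" using e by simp
  then show ?thesis using coef_colscale_exponent[of e \<gamma> x] e True by simp
next
  case False
  have "(\<Prod>j<k. e j ^ F j) = (\<Prod>j<k. e j ^ (F j - \<gamma> j)) * (\<Prod>j<k. e j ^ \<gamma> j)"
    unfolding prod.distrib[symmetric] using coef_exponent_le[OF _ False]
    by (intro prod.cong) (auto simp flip: power_add)
  moreover have "(\<Prod>j<k. e j ^ \<gamma> j) \<noteq> 0" using e by simp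
  ultimately show ?thesis using coef_colscale_exponent[of e \<gamma> x] e by simp
qed

lemma coef_colscale_single:
  assumes "j < k" and "s \<noteq> 0"
  shows "c \<gamma> (colscale (\<lambda>i. if i = j then s else 1) x) = s ^ (F j - \<gamma> j) * c \<gamma> x"
proof -
  have "(\<Prod>i<k. (if i = j then s else 1) ^ (F i - \<gamma> i)) = s ^ (F j - \<gamma> j)"
    using assms(1) by (simp add: if_distrib[of "\<lambda>z. z ^ _"] prod.delta cong: if_cong)
  then show ?thesis using coef_colscale[of "\<lambda>i. if i = j then s else 1" \<gamma> x] assms(2) by simp
qed

text \<open>Column \<open>a\<close> times \<open>z\<close> is added to column \<open>b\<close>. Putting \<open>q\<^sub>b = y q\<^sub>a\<close> in the last row merges
  the exponents at \<open>a\<close> and \<open>b\<close>, so the members of a class are told apart by the power of \<open>y\<close>.\<close>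

definition shift :: "nat \<Rightarrow> nat \<Rightarrow> (nat \<Rightarrow> nat) \<Rightarrow> nat \<Rightarrow> nat \<Rightarrow> nat" where
  "shift a b \<beta> l = \<beta>(a := \<beta> a + \<beta> b - l, b := l)"

text \<open>The column operation replaces \<open>y\<close> by \<open>y + z\<close> in the last row.
  \<open>bound\<close> confines the class of \<open>\<beta>\<close> to \<open>l \<le> e\<close>; for
  a leading exponent \<open>e\<close> will be \<open>\<beta> b\<close>.\<close>

lemma coef_colop_class:
  assumes ab: "a < b" "b < k" and \<beta>: "\<And>j. k \<le> j \<Longrightarrow> \<beta> j = 0" and e: "e \<le> \<beta> a + \<beta> b"
    and bound: "\<And>l. e < l \<Longrightarrow> l \<le> \<beta> a + \<beta> b \<Longrightarrow> shift a b \<beta> l \<notin> S"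
  shows "(\<Sum>l\<le>e. c (shift a b \<beta> l) (colop a b z x) * (y + z) ^ l) = (\<Sum>l\<le>e. c (shift a b \<beta> l) x * y ^ l)"
proof -
  \<comment> \<open>\<open>tl\<close> moves the exponent at \<open>b\<close> to \<open>a\<close>,
    which is what \<open>q b = y * q a\<close> does to the monomial; its fibres are the
    classes.\<close>
  define tl where "tl \<gamma> = (\<gamma> :: nat \<Rightarrow> nat)(a := \<gamma> a + \<gamma> b, b := 0)" for \<gamma>
  have split: "(\<Prod>j<k. f j) = f a * f b * (\<Prod>j\<in>{..<k} - {a} - {b}. f j)" for f :: "nat \<Rightarrow> complex"
    using ab by (subst prod.remove[of _ a], simp, simp, subst prod.remove[of _ b]) (auto simp: mult.assoc)
  have mon: "(\<Prod>j<k. (q(b := y * q a)) j ^ \<gamma> j) = y ^ \<gamma> b * (\<Prod>j<k. q j ^ tl \<gamma> j)"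
    for q :: "nat \<Rightarrow> complex" and y \<gamma>
  proof -
    have "(\<Prod>j\<in>{..<k} - {a} - {b}. (q(b := y * q a)) j ^ \<gamma> j) = (\<Prod>j\<in>{..<k} - {a} - {b}. q j ^ tl \<gamma> j)"
      by (rule prod.cong) (auto simp: tl_def)
    then show ?thesis unfolding split[of "\<lambda>j. (q(b := y * q a)) j ^ \<gamma> j"] split[of "\<lambda>j. q j ^ tl \<gamma> j"]
      using ab by (simp add: tl_def power_mult_distrib power_add mult_ac)
  qed
  have px: "p (set_row m (q(b := y * q a)) u) = (\<Sum>\<gamma>\<in>S. c \<gamma> u * y ^ \<gamma> b * (\<Prod>j<k. q j ^ tl \<gamma> j))" for q y u
    unfolding expand polyf_set_row[OF poly] row_monomial_set_row mon by (simp add: mult.assoc)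
  have "(\<Sum>\<gamma>\<in>S. (c \<gamma> (colop a b z x) * (y + z) ^ \<gamma> b - c \<gamma> x * y ^ \<gamma> b) * (\<Prod>j<k. q j ^ tl \<gamma> j)) = 0" for q
  proof -
    have "colop a b z (set_row m (q(b := y * q a)) x) = set_row m (q(b := (y + z) * q a)) (colop a b z x)"
      using ab by (auto simp: colop_def set_row_def fun_eq_iff distrib_right)
    then have "p (set_row m (q(b := (y + z) * q a)) (colop a b z x)) = p (set_row m (q(b := y * q a)) x)"
      using hw_arrayD(2)[OF hw ab, of z "set_row m (q(b := y * q a)) x"] by simp
    then show ?thesis unfolding px by (simp add: left_diff_distrib sum_subtractf)
  qed
  from monomials_independent[OF fin this, of "tl \<beta>"]
  have "(\<Sum>\<gamma> | \<gamma> \<in> S \<and> (\<forall>j<k. tl \<gamma> j = tl \<beta> j). c \<gamma> (colop a b z x) * (y + z) ^ \<gamma> b - c \<gamma> x * y ^ \<gamma> b) = 0" .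
  also have "(\<Sum>\<gamma> | \<gamma> \<in> S \<and> (\<forall>j<k. tl \<gamma> j = tl \<beta> j). c \<gamma> (colop a b z x) * (y + z) ^ \<gamma> b - c \<gamma> x * y ^ \<gamma> b) =
      (\<Sum>\<gamma>\<in>shift a b \<beta> ` {..e}. c \<gamma> (colop a b z x) * (y + z) ^ \<gamma> b - c \<gamma> x * y ^ \<gamma> b)"
  proof (rule sum.mono_neutral_left)
    show "{\<gamma>. \<gamma> \<in> S \<and> (\<forall>j<k. tl \<gamma> j = tl \<beta> j)} \<subseteq> shift a b \<beta> ` {..e}"
    proof
      fix \<gamma> assume "\<gamma> \<in> {\<gamma>. \<gamma> \<in> S \<and> (\<forall>j<k. tl \<gamma> j = tl \<beta> j)}"
      then have \<gamma>: "\<gamma> \<in> S" "\<And>j. j < k \<Longrightarrow> tl \<gamma> j = tl \<beta> j" by auto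
      have ga: "\<gamma> a + \<gamma> b = \<beta> a + \<beta> b" using \<gamma>(2)[of a] ab by (simp add: tl_def)
      have "\<gamma> j = shift a b \<beta> (\<gamma> b) j" for j
        using \<gamma>(2)[of j] supp[OF \<gamma>(1), of j] \<beta>[of j] ga ab
        by (cases "j < k"; cases "j = a"; cases "j = b") (auto simp: shift_def tl_def)
      then have eq: "\<gamma> = shift a b \<beta> (\<gamma> b)" by (rule ext)
      moreover have "\<gamma> b \<le> e"
        using bound[of "\<gamma> b"] \<gamma>(1) eq ga by (metis le_add2 not_less)
      ultimately show "\<gamma> \<in> shift a b \<beta> ` {..e}" by blast
    qed
    show "\<forall>\<gamma>\<in>shift a b \<beta> ` {..e} - {\<gamma>. \<gamma> \<in> S \<and> (\<forall>j<k. tl \<gamma> j = tl \<beta> j)}.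
        c \<gamma> (colop a b z x) * (y + z) ^ \<gamma> b - c \<gamma> x * y ^ \<gamma> b = 0"
    proof
      fix \<gamma> assume a: "\<gamma> \<in> shift a b \<beta> ` {..e} - {\<gamma>. \<gamma> \<in> S \<and> (\<forall>j<k. tl \<gamma> j = tl \<beta> j)}"
      then obtain l where l: "\<gamma> = shift a b \<beta> l" "l \<le> e" by auto
      then have "tl \<gamma> = tl \<beta>" using e ab by (auto simp: tl_def shift_def fun_eq_iff)
      then have "\<gamma> \<notin> S" using a by simp
      then show "c \<gamma> (colop a b z x) * (y + z) ^ \<gamma> b - c \<gamma> x * y ^ \<gamma> b = 0" by (simp add: zero)
    qed
  qed simp
  also have "\<dots> = (\<Sum>l\<le>e. c (shift a b \<beta> l) (colop a b z x) * (y + z) ^ l - c (shift a b \<beta> l) x * y ^ l)"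
  proof (subst sum.reindex)
    show "inj_on (shift a b \<beta>) {..e}"
      by (rule inj_onI) (metis fun_upd_same shift_def)
  qed (simp add: shift_def)
  finally show ?thesis by (simp add: sum_subtractf)
qed

text \<open>Exponents moved to a later column weigh more. Hence the class of an exponent of maximal
  weight meets \<open>S\<close> only for \<open>l \<le> \<beta> b\<close>.\<close>

lemma weight_shift:
  assumes ab: "a < b" "b < k" and w: "w a < (w b :: nat)" and l: "\<beta> b < l" "l \<le> \<beta> a + \<beta> b"
  shows "weight w k \<beta> < weight w k (shift a b \<beta> l)"
proof -
  have split: "(\<Sum>j<k. f j) = f a + f b + (\<Sum>j\<in>{..<k} - {a} - {b}. f j)" for f :: "nat \<Rightarrow> nat"
    using ab by (subst sum.remove[of _ a], simp, simp, subst sum.remove[of _ b]) (auto simp: add.assoc)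
  obtain i where i: "l = \<beta> b + i" "0 < i" using l(1) less_imp_add_positive by blast
  then obtain r where r: "\<beta> a = i + r" using l(2) le_iff_add[of i "\<beta> a"] by auto
  have "(\<Sum>j\<in>{..<k} - {a} - {b}. shift a b \<beta> l j * w j) = (\<Sum>j\<in>{..<k} - {a} - {b}. \<beta> j * w j)"
    by (rule sum.cong) (auto simp: shift_def)
  moreover have "\<beta> a * w a + \<beta> b * w b < shift a b \<beta> l a * w a + shift a b \<beta> l b * w b"
    using ab i r w by (simp add: shift_def algebra_simps)
  ultimately show ?thesis
    unfolding weight_def split[of "\<lambda>j. \<beta> j * w j"] split[of "\<lambda>j. shift a b \<beta> l j * w j"] by simp
qed

context
  fixes \<beta> :: "nat \<Rightarrow> nat" and w :: "nat \<Rightarrow> nat"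
  assumes \<beta>: "\<beta> \<in> S" and max: "\<And>\<gamma>. \<gamma> \<in> S \<Longrightarrow> weight w k \<gamma> \<le> weight w k \<beta>"
    and w: "\<And>a b. a < b \<Longrightarrow> w a < w b"
begin

lemma leading_class:
  assumes "a < b" "b < k"
  shows "(\<Sum>l\<le>\<beta> b. c (shift a b \<beta> l) (colop a b z x) * (y + z) ^ l) = (\<Sum>l\<le>\<beta> b. c (shift a b \<beta> l) x * y ^ l)"
proof (rule coef_colop_class[OF assms supp[OF \<beta>]])
  fix l assume "\<beta> b < l" "l \<le> \<beta> a + \<beta> b"
  from weight_shift[OF assms w[OF assms(1)] this] max show "shift a b \<beta> l \<notin> S"
    by (metis not_less)
qed simp_all

lemma shift_self: "shift a b \<beta> (\<beta> b) = \<beta>"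
  by (simp add: shift_def)

lemma leading_colop:
  assumes "a < b" "b < k"
  shows "c \<beta> (colop a b z x) = c \<beta> x"
  using leading_coeff_translate[where e = "\<beta> b" and u = "\<lambda>l. c (shift a b \<beta> l) (colop a b z x)"
      and z = z, OF leading_class[OF assms]]
  by (simp only: shift_self)

text \<open>The member \<open>h 0\<close> of the class, without exponent at \<open>b\<close>, is
  homogeneous of degree \<open>A\<close> in column \<open>a\<close>, and it is nonzero because its
  translates involve all \<open>h l\<close>. Now write an array as the result of a column operation
  on one whose column \<open>b\<close> is \<open>w * Y\<close>. This expresses \<open>h 0\<close> by
  the \<open>h l\<close>, which have degree \<open>F b - l \<ge> F b - e\<close> in column
  \<open>b\<close>. If \<open>A + e < F b\<close>, a polynomial in \<open>w\<close> of degree at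
  most \<open>A\<close> is divisible by \<open>w ^ (F b - e)\<close> and vanishes.\<close>

lemma leading_interlaces:
  assumes ab: "a < b" "b < k" and nz: "c \<beta> x0 \<noteq> 0"
  shows "F b \<le> F a - \<beta> a"
proof (rule ccontr)
  assume neg: "\<not> ?thesis"
  define h where "h l = c (shift a b \<beta> l)" for l
  define e where "e = \<beta> b"
  \<comment> \<open>With \<open>y = - z\<close> only the term \<open>l = 0\<close> survives on the
    left of \<open>leading_class\<close>.\<close>
  have h0: "h 0 (colop a b z x) = (\<Sum>l\<le>e. h l x * (- z) ^ l)" for z x
  proof -
    have "(\<Sum>l\<le>e. h l (colop a b z x) * (- z + z) ^ l) = (\<Sum>l\<le>e. if l = 0 then h l (colop a b z x) else 0)"
      by (rule sum.cong) auto
    then show ?thesis using leading_class[OF ab, of z x "- z"] by (simp add: h_def e_def)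
  qed
  have "\<exists>x. h 0 x \<noteq> 0"
  proof (rule ccontr)
    assume "\<not> ?thesis"
    then have z: "h 0 x = 0" for x by simp
    have "(\<Sum>l\<le>e. h l x0 * s ^ l) = 0" for s
      using h0[of "- s" x0] by (simp add: z)
    then have "h e x0 = 0" using coeffs_eq_0_if_cofinite[of "{}" "\<lambda>l. h l x0" e e] by simp
    then show False using nz by (simp add: h_def e_def shift_self)
  qed
  then obtain x where x: "h 0 x \<noteq> 0" by blast
  define A where "A = F a - (\<beta> a + \<beta> b)"
  have "shift a b \<beta> 0 a \<le> F a"
    by (rule coef_exponent_le) (use ab x in \<open>auto simp: h_def\<close>)
  then have "\<beta> a + \<beta> b \<le> F a" using ab by (simp add: shift_def)
  then have AB: "A + e < F b" using neg by (simp add: A_def e_def)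
  \<comment> \<open>\<open>xw 1\<close> is \<open>x\<close>. Scaling column \<open>b\<close> of
    \<open>yw w\<close> by \<open>w\<close> and then adding column \<open>a\<close> to it gives
    \<open>xw w\<close>, and \<open>zs s\<close> is \<open>xw (1 / s)\<close> with column
    \<open>a\<close> scaled by \<open>s\<close>.\<close>
  define Y where "Y i = x (i, b) - x (i, a)" for i
  define xw where "xw w = (\<lambda>(i, j). if j = a then x (i, b) - w * Y i else x (i, j))" for w :: complex
  define yw where "yw w = (\<lambda>(i, j). if j = a then x (i, b) - w * Y i else if j = b then Y i else x (i, j))" for w :: complex
  define zs where "zs s = (\<lambda>(i, j). if j = a then s * x (i, b) - Y i else x (i, j))" for s :: complex
  have hp: "h l \<in> polyf ({..<m} \<times> {..<k})" for l by (simp add: h_def poly)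
  obtain P where P: "\<And>w. h 0 (xw w) = Polynomial.poly P w"
  proof -
    obtain P where "\<forall>w. h 0 (\<lambda>v. poly (if snd v = a then [:x (fst v, b), - Y (fst v):] else [:x v:]) w) = Polynomial.poly P w"
      using polyf_line[OF hp] by (rule exE)
    moreover have "(\<lambda>v. poly (if snd v = a then [:x (fst v, b), - Y (fst v):] else [:x v:]) w) = xw w" for w
      by (auto simp: xw_def fun_eq_iff)
    ultimately show ?thesis using that by simp
  qed
  obtain q where q: "\<And>l w. h l (yw w) = Polynomial.poly (q l) w"
  proof -
    have "\<exists>Q. \<forall>w. h l (yw w) = Polynomial.poly Q w" for l
    proof -
      obtain Q where "\<forall>w. h l (\<lambda>v. poly (if snd v = a then [:x (fst v, b), - Y (fst v):] else
          if snd v = b then [:Y (fst v):] else [:x v:]) w) = Polynomial.poly Q w"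
        using polyf_line[OF hp] by (rule exE)
      moreover have "(\<lambda>v. poly (if snd v = a then [:x (fst v, b), - Y (fst v):] else
          if snd v = b then [:Y (fst v):] else [:x v:]) w) = yw w" for w
        by (auto simp: yw_def fun_eq_iff)
      ultimately show ?thesis by auto
    qed
    then show ?thesis using that by metis
  qed
  obtain R where R: "\<And>s. h 0 (zs s) = Polynomial.poly R s"
  proof -
    obtain R where "\<forall>s. h 0 (\<lambda>v. poly (if snd v = a then [:- Y (fst v), x (fst v, b):] else [:x v:]) s) = Polynomial.poly R s"
      using polyf_line[OF hp] by (rule exE)
    moreover have "(\<lambda>v. poly (if snd v = a then [:- Y (fst v), x (fst v, b):] else [:x v:]) s) = zs s" for s
      by (auto simp: zs_def fun_eq_iff)
    ultimately show ?thesis using that by simp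
  qed
  have "degree P \<le> A"
  proof (rule degree_le_if_reversed)
    fix s :: complex assume s: "s \<noteq> 0"
    have "zs s = colscale (\<lambda>i. if i = a then s else 1) (xw (1 / s))"
      using s by (auto simp: zs_def xw_def colscale_def fun_eq_iff right_diff_distrib)
    moreover have "F a - shift a b \<beta> 0 a = A" using ab by (simp add: shift_def A_def)
    ultimately show "Polynomial.poly R s = s ^ A * Polynomial.poly P (1 / s)"
      using coef_colscale_single[of a s "shift a b \<beta> 0" "xw (1 / s)"] ab s
      unfolding R[symmetric] P[symmetric] h_def by simp
  qed
  moreover have "P - monom 1 (F b - e) * (\<Sum>l\<le>e. monom ((- 1) ^ l) (e - l) * q l) = 0"
  proof (rule poly_eq_0_if_cofinite[of "{0}"])
    fix w :: complex assume "w \<notin> {0}"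
    then have w: "w \<noteq> 0" by simp
    let ?y = "colscale (\<lambda>i. if i = b then w else 1) (yw w)"
    have "xw w = colop a b 1 ?y"
      using ab by (auto simp: xw_def yw_def colop_def colscale_def fun_eq_iff)
    then have "h 0 (xw w) = (\<Sum>l\<le>e. h l ?y * (- 1) ^ l)" using h0[of 1 ?y] by simp
    also have "\<dots> = (\<Sum>l\<le>e. w ^ (F b - e) * ((- 1) ^ l * w ^ (e - l) * h l (yw w)))"
    proof (rule sum.cong[OF refl])
      fix l assume l: "l \<in> {..e}"
      have "h l ?y = w ^ (F b - l) * h l (yw w)"
        using coef_colscale_single[of b w "shift a b \<beta> l" "yw w"] ab w by (simp add: h_def shift_def)
      moreover have "F b - l = (F b - e) + (e - l)" using l AB by simp
      ultimately show "h l ?y * (- 1) ^ l = w ^ (F b - e) * ((- 1) ^ l * w ^ (e - l) * h l (yw w))"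
        by (simp add: power_add)
    qed
    finally show "Polynomial.poly (P - monom 1 (F b - e) * (\<Sum>l\<le>e. monom ((- 1) ^ l) (e - l) * q l)) w = 0"
      by (simp add: P q poly_monom poly_sum sum_distrib_left)
  qed simp
  ultimately have "P = 0"
  proof -
    assume d: "degree P \<le> A" and eq: "P - monom 1 (F b - e) * (\<Sum>l\<le>e. monom ((- 1) ^ l) (e - l) * q l) = 0"
    let ?Q = "\<Sum>l\<le>e. monom ((- 1) ^ l) (e - l) * q l"
    have P: "P = monom 1 (F b - e) * ?Q" using eq by simp
    show "P = 0"
    proof (rule ccontr)
      assume "P \<noteq> 0"
      then have "?Q \<noteq> 0" using P by auto
      then have "degree P = F b - e + degree ?Q"
        unfolding P by (subst degree_mult_eq) (auto simp: degree_monom_eq monom_eq_0_iff)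
      then show False using d AB by simp
    qed
  qed
  then have "h 0 (xw 1) = 0" by (simp add: P)
  moreover have "xw 1 = x" using ab by (auto simp: xw_def Y_def fun_eq_iff)
  ultimately show False using x by simp
qed

lemma leading_hw_array: "c \<beta> \<in> hw_array m k n (\<lambda>j. F j - \<beta> j) D"
  unfolding hw_array_def mem_Collect_eq
proof (intro conjI allI impI)
  show "c \<beta> \<in> polyf ({..<m} \<times> {..<k})" by (rule poly)
next
  fix a b and s :: complex and x assume "a < b \<and> b < k"
  then show "c \<beta> (colop a b s x) = c \<beta> x" by (simp add: leading_colop)
next
  fix e :: "nat \<Rightarrow> complex" and x assume "\<forall>j<k. e j \<noteq> 0"
  then show "c \<beta> (colscale e x) = (\<Prod>j<k. e j ^ (F j - \<beta> j)) * c \<beta> x" by (intro coef_colscale) simp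
next
  fix a b and s :: complex and x assume "a < b \<and> b < n"
  then show "c \<beta> (rowop a b s x) = c \<beta> x" by (simp add: coef_rowop)
next
  fix e :: "nat \<Rightarrow> complex" and x assume "\<forall>i<n. e i \<noteq> 0"
  then show "c \<beta> (rowscale (\<lambda>i. if i < n then e i else 1) x) = (\<Prod>i<n. e i ^ D i) * c \<beta> x"
    by (intro coef_rowscale) simp
qed

end

end

subsection \<open>Standard monomials span and are independent\<close>

lemma array_monomial_J_array:
  assumes "t \<in> tableaux n n F D"
  shows "array_monomial t J_array = 1"
proof -
  have "row_minor I J_array = 1" if "I \<in> set t" for I
  proof -
    have "I \<in> LLn n n" using assms that by (auto simp: tableaux_def standard_tableau_def)
    then obtain r where I: "I = {..<r}" by (auto simp: LLn_def)
    have "mat r r (\<lambda>(a, b). J_array (pick {..<r} a, b)) = 1\<^sub>m r"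
      by (rule eq_matI) (auto simp: pick_lessThan J_array_def)
    then show ?thesis by (simp add: row_minor_def I)
  qed
  then show ?thesis unfolding array_monomial_def by (induction t) auto
qed

lemma low_zero_imp_0: "p \<in> low m k w 0 \<Longrightarrow> p x = 0"
  by (induction rule: low.induct) auto

lemma low_smult: "p \<in> low m k w R \<Longrightarrow> (\<lambda>x. a * p x) \<in> low m k w R"
  using low_mult_polyf[OF _ polyf.const] by blast

text \<open>Subtracting the combination of enlarged tableaux that matches the leading term lowers
  the bound \<open>R\<close>. \<open>IH\<close> has to cover all shapes, as the leading coefficient
  belongs to \<open>F'\<close> and not to \<open>F\<close>.\<close>

lemma hw_array_spanned_step:
  assumes IH: "\<And>F p. antimono F \<Longrightarrow> \<forall>r\<ge>k. F r = 0 \<Longrightarrow> p \<in> hw_array m k n F D \<Longrightarrow>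
      \<exists>a. \<forall>x. p x = (\<Sum>t\<in>tableaux m n F D. a t * array_monomial t x)"
    and nm: "n \<le> m" and F: "antimono F" and k: "\<forall>r\<ge>k. F r = 0"
    and w: "w = (\<lambda>j. (F 0 + 2) ^ j)"
    and p: "p \<in> hw_array (Suc m) k n F D" "p \<in> low m k w R"
  shows "\<exists>a. \<forall>x. p x = (\<Sum>t\<in>tableaux (Suc m) n F D. a t * array_monomial t x)"
  using p
proof (induction R arbitrary: p)
  case 0
  then show ?case using low_zero_imp_0 by (intro exI[of _ "\<lambda>_. 0"]) simp
next
  case (Suc R)
  \<comment> \<open>The exponents are at most \<open>F 0\<close>, hence digits in base
    \<open>F 0 + 2\<close>; this base is at least 2, so \<open>w\<close> increases even if
    \<open>F 0 = 0\<close>.\<close>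
  have wm: "w a < w b" if "a < b" for a b using that by (simp add: w)
  from low_collect[OF Suc.prems(2)] obtain S0 c0 where S0: "finite S0" "\<forall>\<gamma>\<in>S0. weight w k \<gamma> < Suc R"
    "\<forall>\<gamma>\<in>S0. \<forall>j\<ge>k. \<gamma> j = 0" "\<forall>\<gamma>. c0 \<gamma> \<in> polyf ({..<m} \<times> {..<k})"
    and p0: "\<forall>x. p x = (\<Sum>\<gamma>\<in>S0. c0 \<gamma> x * row_monomial m k \<gamma> x)"
    by (elim exE conjE)
  \<comment> \<open>Discarding zero coefficients makes \<open>coef_exponent_le\<close> applicable to
    every member of \<open>S\<close>.\<close>
  define S where "S = {\<gamma> \<in> S0. \<exists>x. c0 \<gamma> x \<noteq> 0}"
  define c where "c = (\<lambda>\<gamma> x. if \<gamma> \<in> S then c0 \<gamma> x else 0)"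
  have c: "c \<gamma> \<in> polyf ({..<m} \<times> {..<k})" for \<gamma>
    using S0(4) by (cases "\<gamma> \<in> S") (auto simp: c_def intro: polyf.const)
  have S: "finite S" "\<And>\<gamma>. \<gamma> \<in> S \<Longrightarrow> weight w k \<gamma> \<le> R" "\<And>\<gamma> j. \<gamma> \<in> S \<Longrightarrow> k \<le> j \<Longrightarrow> \<gamma> j = 0"
    using S0(1-3) by (auto simp: S_def less_Suc_eq_le)
  have ex: "p x = (\<Sum>\<gamma>\<in>S. c \<gamma> x * row_monomial m k \<gamma> x)" for x
    unfolding p0[rule_format] by (rule sum.mono_neutral_cong_right) (use S0(1) in \<open>auto simp: S_def c_def\<close>)
  interpret row_expansion m k n F D p S c
    by (unfold_locales; (rule Suc.prems(1) nm S(1) c ex | (rule S(3); assumption) | simp add: c_def))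
  have nz: "\<exists>x. c \<gamma> x \<noteq> 0" if "\<gamma> \<in> S" for \<gamma> using that by (auto simp: S_def c_def)
  have le: "\<gamma> j \<le> F j" if "\<gamma> \<in> S" for \<gamma> j
  proof (cases "j < k")
    case True
    then show ?thesis using nz[OF that] coef_exponent_le by blast
  qed (use S(3)[OF that, of j] in simp)
  have F0: "F j \<le> F 0" for j using antimonoD[OF F, of 0 j] by simp
  show ?case
  proof (cases "\<exists>\<beta>\<in>S. weight w k \<beta> = R")
    case False
    then have "weight w k \<gamma> < R" if "\<gamma> \<in> S" for \<gamma> using S(2)[OF that] that by (metis le_neq_implies_less)
    then have "(\<lambda>x. \<Sum>\<gamma>\<in>S. c \<gamma> x * row_monomial m k \<gamma> x) \<in> low m k w R"
      by (intro low_sum low_term c) auto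
    then have "p \<in> low m k w R" using ex by presburger
    then show ?thesis by (rule Suc.IH[OF Suc.prems(1)])
  next
    case True
    then obtain \<beta> where \<beta>: "\<beta> \<in> S" "weight w k \<beta> = R" by blast
    have max: "weight w k \<gamma> \<le> weight w k \<beta>" if "\<gamma> \<in> S" for \<gamma> using S(2)[OF that] \<beta>(2) by simp
    define F' where "F' = (\<lambda>j. F j - \<beta> j)"
    have strip: "(\<lambda>j. F j - F' j) = \<beta>" using le[OF \<beta>(1)] by (auto simp: F'_def)
    have int: "interlaces F' F"
      unfolding interlaces_def
    proof (intro allI conjI)
      fix r
      show "F' r \<le> F r" by (simp add: F'_def)
      show "F (Suc r) \<le> F' r"
      proof (cases "Suc r < k")
        case True
        obtain x0 where "c \<beta> x0 \<noteq> 0" using nz[OF \<beta>(1)] by blast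
        from leading_interlaces[where w = w, OF \<beta>(1) max wm lessI True this] show ?thesis
          by (simp add: F'_def)
      qed (use k in simp)
    qed
    have k': "\<forall>r\<ge>k. F' r = 0" using k by (simp add: F'_def)
    have "c \<beta> \<in> hw_array m k n F' D"
      unfolding F'_def by (rule leading_hw_array[where w = w, OF \<beta>(1) max wm])
    from IH[OF interlaces_antimono(2)[OF int] k' this]
    obtain a where a: "\<forall>x. c \<beta> x = (\<Sum>u\<in>tableaux m n F' D. a u * array_monomial u x)" by (rule exE)
    have "\<forall>u\<in>tableaux m n F' D. \<exists>l. l \<in> low m k w R \<and> (\<forall>x. array_monomial (add_strip m F u) x =
        array_monomial u x * row_monomial m k \<beta> x + l x)"
    proof
      fix u assume u: "u \<in> tableaux m n F' D"
      show "\<exists>l. l \<in> low m k w R \<and> (\<forall>x. array_monomial (add_strip m F u) x =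
          array_monomial u x * row_monomial m k \<beta> x + l x)"
        using add_strip_lead[where w = w, OF u int k nm wm] unfolding strip \<beta>(2) Bex_def .
    qed
    from bchoice[OF this] obtain l where "\<forall>u\<in>tableaux m n F' D. l u \<in> low m k w R \<and>
        (\<forall>x. array_monomial (add_strip m F u) x = array_monomial u x * row_monomial m k \<beta> x + l u x)"
      by (rule exE)
    then have l: "\<And>u. u \<in> tableaux m n F' D \<Longrightarrow> l u \<in> low m k w R"
      and lx: "\<And>u x. u \<in> tableaux m n F' D \<Longrightarrow>
        array_monomial (add_strip m F u) x = array_monomial u x * row_monomial m k \<beta> x + l u x"
      by simp_all
    define q where "q = (\<lambda>x. p x - (\<Sum>u\<in>tableaux m n F' D. a u * array_monomial (add_strip m F u) x))"
    have "q \<in> hw_array (Suc m) k n F D"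
      unfolding q_def using nm
      by (intro hw_array_diff Suc.prems(1) hw_array_sum array_monomial_hw_array add_strip_tableaux[OF _ int nm] k) auto
    moreover have "q \<in> low m k w R"
    proof -
      have "q x = (\<Sum>\<gamma>\<in>S - {\<beta>}. c \<gamma> x * row_monomial m k \<gamma> x) + (\<Sum>u\<in>tableaux m n F' D. - a u * l u x)" for x
      proof -
        have "p x = c \<beta> x * row_monomial m k \<beta> x + (\<Sum>\<gamma>\<in>S - {\<beta>}. c \<gamma> x * row_monomial m k \<gamma> x)"
          unfolding ex by (rule sum.remove[OF S(1) \<beta>(1)])
        moreover have "(\<Sum>u\<in>tableaux m n F' D. a u * array_monomial (add_strip m F u) x) =
            c \<beta> x * row_monomial m k \<beta> x + (\<Sum>u\<in>tableaux m n F' D. a u * l u x)"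
          unfolding a[rule_format] sum_distrib_right sum.distrib[symmetric]
          by (rule sum.cong) (auto simp: lx algebra_simps)
        ultimately show ?thesis by (simp add: q_def sum_negf)
      qed
      moreover have "weight w k \<gamma> < R" if "\<gamma> \<in> S - {\<beta>}" for \<gamma>
      proof -
        have "weight w k \<gamma> \<noteq> weight w k \<beta>"
        proof
          assume eq: "weight w k \<gamma> = weight w k \<beta>"
          have "\<gamma> j < F 0 + 2" "\<beta> j < F 0 + 2" for j
            using le[of \<gamma> j] le[OF \<beta>(1), of j] F0[of j] that by auto
          then have "\<gamma> j = \<beta> j" if "j < k" for j
            using digits_unique[of k \<gamma> "F 0 + 2" \<beta> j] eq that unfolding weight_def w by blast
          then have "\<gamma> j = \<beta> j" for j using S(3)[of \<gamma> j] S(3)[OF \<beta>(1), of j] that by (cases "j < k") auto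
          then show False using that by auto
        qed
        then show ?thesis using S(2)[of \<gamma>] that \<beta>(2) by simp
      qed
      then have "(\<lambda>x. (\<Sum>\<gamma>\<in>S - {\<beta>}. c \<gamma> x * row_monomial m k \<gamma> x) +
          (\<Sum>u\<in>tableaux m n F' D. - a u * l u x)) \<in> low m k w R"
        by (intro low_add low_sum low_term low_smult c l) auto
      ultimately show ?thesis by presburger
    qed
    ultimately have "\<exists>b. \<forall>x. q x = (\<Sum>t\<in>tableaux (Suc m) n F D. b t * array_monomial t x)"
      by (rule Suc.IH)
    then obtain b where b: "\<forall>x. q x = (\<Sum>t\<in>tableaux (Suc m) n F D. b t * array_monomial t x)"
      by (rule exE)
    \<comment> \<open>The coefficients are collected over the fibres of
      \<open>add_strip m F\<close>.\<close>
    define a' where "a' t = (\<Sum>u\<in>{u \<in> tableaux m n F' D. add_strip m F u = t}. a u)" for t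
    have "(\<Sum>u\<in>tableaux m n F' D. a u * array_monomial (add_strip m F u) x) =
        (\<Sum>t\<in>tableaux (Suc m) n F D. a' t * array_monomial t x)" for x
    proof -
      have "(\<Sum>t\<in>tableaux (Suc m) n F D. a' t * array_monomial t x) =
          (\<Sum>t\<in>tableaux (Suc m) n F D. \<Sum>u\<in>{u \<in> tableaux m n F' D. add_strip m F u = t}.
            a u * array_monomial (add_strip m F u) x)"
        by (rule sum.cong) (auto simp: a'_def sum_distrib_right)
      also have "\<dots> = (\<Sum>u\<in>tableaux m n F' D. a u * array_monomial (add_strip m F u) x)"
        by (rule sum.group) (auto simp: finite_tableaux intro: add_strip_tableaux[OF _ int nm])
      finally show ?thesis ..
    qed
    then have "p x = (\<Sum>t\<in>tableaux (Suc m) n F D. (b t + a' t) * array_monomial t x)" for x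
      using b[rule_format, of x] by (simp add: q_def distrib_right sum.distrib diff_eq_eq)
    then show ?thesis by (intro exI[of _ "\<lambda>t. b t + a' t"]) simp
  qed
qed

text \<open>The induction starts at \<open>m = n\<close> with \<open>F\<close> and \<open>p\<close>
  arbitrary. \<open>D\<close> stays fixed, since the rows taken away are not touched by the smaller
  group.\<close>

lemma hw_array_spanned:
  assumes "n \<le> m" and "antimono F" and "\<forall>r\<ge>k. F r = 0" and D: "\<forall>i\<ge>n. D i = 0"
    and "p \<in> hw_array m k n F D"
  shows "\<exists>a. \<forall>x. p x = (\<Sum>t\<in>tableaux m n F D. a t * array_monomial t x)"
  using assms(1-3,5)
proof (induction m arbitrary: F p rule: dec_induct)
  case base
  show ?case
  proof (cases "\<exists>x. p x \<noteq> 0")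
    case False
    then show ?thesis by (intro exI[of _ "\<lambda>_. 0"]) simp
  next
    case True
    then obtain x where "p x \<noteq> 0" by blast
    note wt = hw_array_square_weights[OF base(3) this]
    \<comment> \<open>A nonzero function in the square case forces \<open>D = F\<close>, and then
      there is exactly one tableau.\<close>
    have "F i = D i" for i
      using wt[of i] base(2) D by (cases "i < n"; cases "i < k") auto
    then have FD: "D = F" by auto
    have "n \<le> i \<Longrightarrow> F i = 0" for i using D FD by simp
    from tableaux_square_exists[OF base(1) this]
    obtain t where t: "t \<in> tableaux n n F D" unfolding FD by blast
    have T: "tableaux n n F D = {t}" using t tableaux_square_unique by blast
    have h: "(\<lambda>x. p x - p J_array * array_monomial t x) \<in> hw_array n k n F D"
      using hw_array_diff[OF base(3) hw_array_sum[of "{t}" array_monomial n k n F D "\<lambda>_. p J_array"]]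
        array_monomial_hw_array[OF t base(2)] by simp
    have "p x - p J_array * array_monomial t x = 0" for x
      by (rule hw_array_square_eq_0[OF h]) (simp only: array_monomial_J_array[OF t] mult_1_right diff_self)
    then have eq: "p x = p J_array * array_monomial t x" for x by (subst eq_iff_diff_eq_0)
    show ?thesis
      unfolding T
    proof (intro exI allI)
      fix x
      show "p x = (\<Sum>t\<in>{t}. p J_array * array_monomial t x)" using eq[of x] by simp
    qed
  qed
next
  case (step m)
  define w where "w = (\<lambda>j. (F 0 + 2) ^ j)"
  obtain R where R: "p \<in> low m k w R"
    using polyf_low[OF hw_arrayD(1)[OF step.prems(3)]] by blast
  show ?case
    by (rule hw_array_spanned_step[OF _ step.hyps(1) step.prems(1,2) w_def step.prems(3) R])
      (rule step.IH)
qed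

text \<open>Among the tableaux with nonzero coefficient take one of maximal leading weight. Those of
  equal weight leave the same shape when the last strip is removed, so their leading coefficients
  are monomials of distinct tableaux of one shape with one row less.\<close>

lemma array_monomials_independent:
  assumes "n \<le> m" and "\<forall>r\<ge>k. F r = 0"
    and "\<And>x. (\<Sum>t\<in>tableaux m n F D. a t * array_monomial t x) = 0" and "t \<in> tableaux m n F D"
  shows "a t = 0"
  using assms
proof (induction m arbitrary: F a t rule: dec_induct)
  case base
  have "tableaux n n F D = {t}" using base(3) tableaux_square_unique by blast
  then show ?case using base(2)[of J_array] array_monomial_J_array[OF base(3)] by simp
next
  case (step m)
  note nm = step.hyps(1)
  define w where "w = (\<lambda>j. (F 0 + 2) ^ j)"
  have wm: "w a < w b" if "a < b" for a b using that by (simp add: w_def)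
  define r where "r = remove_strip m"
  define Fo where "Fo t = outer_shape (r t)" for t
  define \<beta> where "\<beta> t = (\<lambda>j. F j - Fo t j)" for t
  let ?T = "tableaux (Suc m) n F D"
  have T: "r t \<in> tableaux m n (Fo t) D" "interlaces (Fo t) F" "add_strip m F (r t) = t" if "t \<in> ?T" for t
    using remove_strip_tableaux[OF that nm] by (simp_all add: r_def Fo_def)
  show ?case
  proof (rule ccontr)
    assume at: "a t \<noteq> 0"
    define Z where "Z = {t \<in> ?T. a t \<noteq> 0}"
    have Z: "finite Z" "t \<in> Z" using step.prems(3) at by (auto simp: Z_def finite_tableaux)
    let ?W = "(\<lambda>t. weight w k (\<beta> t)) ` Z"
    have "Max ?W \<in> ?W" using Z by (intro Max_in) auto
    then obtain t1 where t1Z: "t1 \<in> Z" "Max ?W = weight w k (\<beta> t1)" by auto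
    have t1: "t1 \<in> Z" "\<And>t. t \<in> Z \<Longrightarrow> weight w k (\<beta> t) \<le> weight w k (\<beta> t1)"
      unfolding t1Z(2)[symmetric] using t1Z(1) Z(1) by simp_all
    have t1T: "t1 \<in> ?T" "a t1 \<noteq> 0" using t1(1) by (auto simp: Z_def)
    define R where "R = weight w k (\<beta> t1)"
    \<comment> \<open>Tableaux with coefficient 0 are included, so that \<open>G\<close> becomes a
      sum over all of \<open>tableaux m n (Fo t1) D\<close>, as the induction hypothesis
      demands.\<close>
    define Z1 where "Z1 = {t \<in> ?T. Fo t = Fo t1}"
    have sm: "weight w k (\<beta> t) < R" if "t \<in> Z" "t \<notin> Z1" for t
    proof -
      have tT: "t \<in> ?T" using that(1) by (simp add: Z_def)
      have "weight w k (\<beta> t) \<noteq> R"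
      proof
        assume eq: "weight w k (\<beta> t) = R"
        have Fj: "F j \<le> F 0" for j using antimonoD[OF interlaces_antimono(1)[OF T(2)[OF tT]], of 0 j] by simp
        have lt: "\<beta> u j < F 0 + 2" for u j using Fj[of j] by (simp add: \<beta>_def)
        have b: "\<beta> t j = \<beta> t1 j" if "j < k" for j
          using digits_unique[of k "\<beta> t" "F 0 + 2" "\<beta> t1" j] eq lt that unfolding R_def weight_def w_def by blast
        have le: "Fo t j \<le> F j" "Fo t1 j \<le> F j" for j
          using T(2)[OF tT] T(2)[OF t1T(1)] by (auto simp: interlaces_def)
        have "Fo t j = Fo t1 j" for j
        proof (cases "j < k")
          case True
          then show ?thesis using b[of j] le[of j] by (simp add: \<beta>_def)
        next
          case False
          then show ?thesis using le[of j] step.prems(1) by simp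
        qed
        then have "Fo t = Fo t1" by (rule ext)
        then show False using that tT by (auto simp: Z1_def)
      qed
      then show ?thesis using t1(2)[OF that(1)] by (simp add: R_def)
    qed
    have "\<forall>t\<in>?T. \<exists>l. l \<in> low m k w (weight w k (\<beta> t)) \<and>
        (\<forall>x. array_monomial t x = array_monomial (r t) x * row_monomial m k (\<beta> t) x + l x)"
    proof
      fix t assume t: "t \<in> ?T"
      show "\<exists>l. l \<in> low m k w (weight w k (\<beta> t)) \<and>
          (\<forall>x. array_monomial t x = array_monomial (r t) x * row_monomial m k (\<beta> t) x + l x)"
        using add_strip_lead[where w = w, OF T(1,2)[OF t] step.prems(1) nm wm] unfolding T(3)[OF t] \<beta>_def Bex_def .
    qed
    from bchoice[OF this] obtain l where "\<forall>t\<in>?T. l t \<in> low m k w (weight w k (\<beta> t)) \<and>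
        (\<forall>x. array_monomial t x = array_monomial (r t) x * row_monomial m k (\<beta> t) x + l t x)"
      by (rule exE)
    then have l: "\<And>t. t \<in> ?T \<Longrightarrow> l t \<in> low m k w (weight w k (\<beta> t))"
      and lx: "\<And>t x. t \<in> ?T \<Longrightarrow> array_monomial t x = array_monomial (r t) x * row_monomial m k (\<beta> t) x + l t x"
      by simp_all
    have Z1T: "Z1 \<subseteq> ?T" by (auto simp: Z1_def)
    have \<beta>1: "\<beta> t = \<beta> t1" if "t \<in> Z1" for t using that by (simp add: Z1_def \<beta>_def)
    have r_polyf: "array_monomial (r t) \<in> polyf ({..<m} \<times> {..<k})" if "t \<in> ?T" for t
    proof (rule array_monomial_polyf[OF T(1)[OF that]])
      show "\<forall>i\<ge>k. Fo t i = 0" using T(2)[OF that] step.prems(1) by (metis interlaces_def le_zero_eq)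
    qed
    define G where "G x = (\<Sum>t\<in>Z1. a t * array_monomial (r t) x)" for x
    define L where "L x = (\<Sum>t\<in>Z1. a t * l t x) + (\<Sum>t\<in>?T - Z1. a t * array_monomial t x)" for x
    have "G x = 0" for x
    proof (rule leading_coefficient_unique[where G = G and l = L and w = w and m = m and k = k and \<beta> = "\<beta> t1"])
      show "G \<in> polyf ({..<m} \<times> {..<k})"
        unfolding G_def[abs_def] using r_polyf Z1T by (intro polyf_sum polyf.mult polyf.const) auto
      have other: "(\<lambda>x. a t * array_monomial t x) \<in> low m k w R" if "t \<in> ?T - Z1" for t
      proof (cases "a t = 0")
        case False
        then have tZ: "t \<in> Z" using that by (simp add: Z_def)
        have "(\<lambda>x. array_monomial (r t) x * row_monomial m k (\<beta> t) x + l t x) \<in> low m k w R"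
          using sm[OF tZ] that l[of t] low_mono less_imp_le r_polyf
          by (intro low_add low_term) auto
        moreover have "array_monomial t = (\<lambda>x. array_monomial (r t) x * row_monomial m k (\<beta> t) x + l t x)"
          using lx that by auto
        ultimately show ?thesis by (intro low_smult) simp
      qed (simp add: low.zero)
      have "l t \<in> low m k w R" if "t \<in> Z1" for t
        using l[of t] that Z1T \<beta>1[OF that] by (auto simp: R_def)
      then have "(\<lambda>x. \<Sum>t\<in>Z1. a t * l t x) \<in> low m k w R" by (intro low_sum low_smult)
      moreover have "(\<lambda>x. \<Sum>t\<in>?T - Z1. a t * array_monomial t x) \<in> low m k w R"
        by (intro low_sum other)
      ultimately show "L \<in> low m k w (weight w k (\<beta> t1))"
        unfolding L_def[abs_def] R_def[symmetric] by (rule low_add)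
      fix x
      have "(\<Sum>t\<in>Z1. a t * array_monomial t x) = G x * row_monomial m k (\<beta> t1) x + (\<Sum>t\<in>Z1. a t * l t x)"
        unfolding G_def sum_distrib_right sum.distrib[symmetric]
        by (rule sum.cong) (use lx Z1T \<beta>1 in \<open>auto simp: algebra_simps\<close>)
      moreover have "(\<Sum>t\<in>?T. a t * array_monomial t x) =
          (\<Sum>t\<in>?T - Z1. a t * array_monomial t x) + (\<Sum>t\<in>Z1. a t * array_monomial t x)"
        by (rule sum.subset_diff[OF Z1T finite_tableaux])
      ultimately show "G x * row_monomial m k (\<beta> t1) x + L x = 0"
        using step.prems(2)[of x] by (simp add: L_def add_ac)
    qed
    moreover have "G x = (\<Sum>u\<in>tableaux m n (Fo t1) D. a (add_strip m F u) * array_monomial u x)" for x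
      unfolding G_def
    proof (rule sum.reindex_bij_witness[where i = "add_strip m F" and j = r])
      fix t assume "t \<in> Z1"
      then have "t \<in> ?T" "Fo t = Fo t1" by (auto simp: Z1_def)
      then show "add_strip m F (r t) = t" "r t \<in> tableaux m n (Fo t1) D"
        "a (add_strip m F (r t)) * array_monomial (r t) x = a t * array_monomial (r t) x"
        using T[of t] by auto
    next
      fix u assume u: "u \<in> tableaux m n (Fo t1) D"
      have int: "interlaces (Fo t1) F" by (rule T(2)[OF t1T(1)])
      have uT: "add_strip m F u \<in> ?T" by (rule add_strip_tableaux[OF u int nm])
      note inj = add_strip_inj[OF T(1)[OF uT] u T(2)[OF uT] int T(3)[OF uT]]
      show "r (add_strip m F u) = u" by (rule inj(1))
      show "add_strip m F u \<in> Z1" using uT inj(2) by (simp add: Z1_def)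
    qed
    ultimately have "(\<Sum>u\<in>tableaux m n (Fo t1) D. a (add_strip m F u) * array_monomial u x) = 0" for x
      by simp
    moreover have "\<forall>i\<ge>k. Fo t1 i = 0"
      using T(2)[OF t1T(1)] step.prems(1) by (metis interlaces_def le_zero_eq)
    ultimately have "a (add_strip m F (r t1)) = 0"
      using step.IH[of "Fo t1" "\<lambda>u. a (add_strip m F u)" "r t1"] T(1)[OF t1T(1)] by blast
    then show False using t1T T(3)[OF t1T(1)] by simp
  qed
qed

subsection \<open>The representation on the F-summand\<close>

lemma pointwise_scale_vector_space: "vector_space sc \<Longrightarrow> vector_space (pointwise_scale sc)"
  unfolding vector_space_def pointwise_scale_def by (auto simp: fun_eq_iff)

lemma vector_space_fscale: "vector_space fscale"
  by (rule pointwise_scale_vector_space) (unfold_locales, auto simp: algebra_simps)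

interpretation fscale: vector_space fscale
  by (rule vector_space_fscale)

lemma sum_fun_apply: "(\<Sum>a\<in>A. f a) x = (\<Sum>a\<in>A. f a x)"
  by (induction A rule: infinite_finite_induct) auto

lemma young_zero:
  assumes "young F" and "ylen F \<le> k" and "k \<le> r"
  shows "F r = 0"
proof (rule ccontr)
  assume r: "F r \<noteq> 0"
  have "F r \<le> F i" if "i \<le> r" for i using assms(1) that by (auto simp: young_def dest: antimonoD)
  then have "{..r} \<subseteq> {r. F r \<noteq> 0}" using r by (auto simp: Suc_le_eq dest: less_le_trans)
  then have "card {..r} \<le> card {r. F r \<noteq> 0}"
    using assms(1) by (intro card_mono) (auto simp: young_def)
  then show False using assms(2,3) by (simp add: ylen_def)
qed

lemma poly_funs_zero: "(\<lambda>Q. 0) \<in> poly_funs m k"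
  using poly_funs.const[of m k 0] by (simp cong: if_cong)

lemma poly_funs_subspace: "fscale.subspace (poly_funs m k)"
proof (rule fscale.subspaceI)
  show "0 \<in> poly_funs m k" using poly_funs_zero by (simp add: zero_fun_def)
next
  fix f g assume "f \<in> poly_funs m k" "g \<in> poly_funs m k"
  then show "f + g \<in> poly_funs m k" unfolding plus_fun_def by (rule poly_funs.add)
next
  fix a f assume f: "f \<in> poly_funs m k"
  from poly_funs.mult[OF poly_funs.const[where c = a] this]
  have "(\<lambda>Q. (if Q \<in> carrier_mat m k then a else 0) * f Q) \<in> poly_funs m k" .
  moreover have "(\<lambda>Q. (if Q \<in> carrier_mat m k then a else 0) * f Q) = fscale a f"
    using poly_funs_outside[OF f] by (auto simp: pointwise_scale_def)
  ultimately show "fscale a f \<in> poly_funs m k" by simp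
qed

lemma rho_summand_subspace: "fscale.subspace (rho_summand m k F)"
proof (rule fscale.subspaceI)
  show "0 \<in> rho_summand m k F"
    using hw_right_iff[OF fscale.subspace_0[OF poly_funs_subspace]] by simp
next
  fix f g assume fg: "f \<in> rho_summand m k F" "g \<in> rho_summand m k F"
  note p = fg[THEN rho_summand_poly_funs]
  show "f + g \<in> rho_summand m k F"
    using fg unfolding hw_right_iff[OF p(1)] hw_right_iff[OF p(2)]
      hw_right_iff[OF fscale.subspace_add[OF poly_funs_subspace p]]
    by (auto simp: distrib_left)
next
  fix a f assume f: "f \<in> rho_summand m k F"
  note p = rho_summand_poly_funs[OF f]
  show "fscale a f \<in> rho_summand m k F"
    using f unfolding hw_right_iff[OF p] hw_right_iff[OF fscale.subspace_scale[OF poly_funs_subspace p]]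
    by (auto simp: pointwise_scale_def)
qed

lemma B_component_subspace:
  assumes "n \<le> m"
  shows "fscale.subspace (B_component m k n F D)"
proof (rule fscale.subspaceI)
  show "0 \<in> B_component m k n F D"
    using fscale.subspace_0[OF rho_summand_subspace] by (simp add: B_component_iff[OF assms])
next
  fix f g assume "f \<in> B_component m k n F D" "g \<in> B_component m k n F D"
  then show "f + g \<in> B_component m k n F D"
    unfolding B_component_iff[OF assms]
    using fscale.subspace_add[OF rho_summand_subspace] by (auto simp: distrib_left)
next
  fix a f assume "f \<in> B_component m k n F D"
  then show "fscale a f \<in> B_component m k n F D"
    unfolding B_component_iff[OF assms]
    using fscale.subspace_scale[OF rho_summand_subspace] by (auto simp: pointwise_scale_def)
qed

lemma standard_monomial_combination:
  assumes "\<forall>r\<ge>k. F r = 0"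
  shows "(\<Sum>t\<in>tableaux m n F D. fscale (a t) (standard_monomial m k t)) =
    on_mat m k (\<lambda>x. \<Sum>t\<in>tableaux m n F D. a t * array_monomial t x)"
  by (auto simp: fun_eq_iff sum_fun_apply pointwise_scale_def standard_monomial_on_mat[OF _ assms] on_mat_def
      intro!: sum.cong sum.neutral)

lemma standard_monomials_independent:
  assumes nm: "n \<le> m" and k: "\<forall>r\<ge>k. F r = 0"
    and "(\<Sum>t\<in>tableaux m n F D. fscale (a t) (standard_monomial m k t)) = 0" and "t \<in> tableaux m n F D"
  shows "a t = 0"
proof (rule array_monomials_independent[OF nm k _ assms(4)])
  fix x
  let ?p = "\<lambda>x. \<Sum>t\<in>tableaux m n F D. a t * array_monomial t x"
  have "?p \<in> polyf ({..<m} \<times> {..<k})"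
    using array_monomial_polyf[OF _ k] by (intro polyf_sum polyf.mult polyf.const)
  from on_mat_mat[OF this, of x] show "?p x = 0"
    using assms(3) unfolding standard_monomial_combination[OF k] by simp
qed

lemma standard_monomials_basis:
  assumes nm: "n \<le> m" and F: "antimono F" and k: "\<forall>r\<ge>k. F r = 0" and D: "\<forall>i\<ge>n. D i = 0"
  shows "inj_on (standard_monomial m k) (tableaux m n F D)"
    and "is_basis fscale (standard_monomial m k ` tableaux m n F D) (B_component m k n F D)"
proof -
  let ?T = "tableaux m n F D" and ?s = "standard_monomial m k"
  have fin: "finite (?s ` ?T)" by (simp add: finite_tableaux)
  show inj: "inj_on ?s ?T"
  proof (rule inj_onI, rule ccontr)
    fix t u assume tu: "t \<in> ?T" "u \<in> ?T" "?s t = ?s u" "t \<noteq> u"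
    let ?a = "\<lambda>v. if v = t then 1 else if v = u then - 1 else 0 :: complex"
    have "(\<Sum>v\<in>?T. fscale (?a v) (?s v)) = (\<Sum>v\<in>{t, u}. fscale (?a v) (?s v))"
      by (rule sum.mono_neutral_right) (use tu finite_tableaux in auto)
    also have "\<dots> = 0" using tu by (simp add: fscale.scale_minus_left)
    finally have "?a t = 0" by (rule standard_monomials_independent[where a = ?a, OF nm k _ tu(1)])
    then show False by simp
  qed
  have "\<not> fscale.dependent (?s ` ?T)"
    unfolding fscale.dependent_finite[OF fin]
  proof (intro notI, elim exE conjE bexE)
    fix u f assume f: "f \<in> ?s ` ?T" "u f \<noteq> 0" and s: "(\<Sum>f\<in>?s ` ?T. fscale (u f) f) = 0"
    then obtain t where t: "t \<in> ?T" "f = ?s t" by auto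
    have "(\<Sum>t\<in>?T. fscale (u (?s t)) (?s t)) = 0" using s by (simp add: sum.reindex[OF inj])
    from standard_monomials_independent[where a = "\<lambda>t. u (?s t)", OF nm k this t(1)] f t show False by simp
  qed
  moreover have "fscale.span (?s ` ?T) = B_component m k n F D"
  proof
    show "fscale.span (?s ` ?T) \<subseteq> B_component m k n F D"
      by (rule fscale.span_minimal[OF _ B_component_subspace[OF nm]])
        (use standard_monomial_B_component[OF _ k nm] in blast)
    show "B_component m k n F D \<subseteq> fscale.span (?s ` ?T)"
    proof
      fix f assume f: "f \<in> B_component m k n F D"
      from hw_array_spanned[OF nm F k D B_component_hw_array[OF nm f]]
      obtain a where a: "\<forall>x. f (mat m k x) = (\<Sum>t\<in>?T. a t * array_monomial t x)" by (rule exE)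
      have "f \<in> poly_funs m k" using f rho_summand_poly_funs by (auto simp: B_component_iff[OF nm])
      then have "f = on_mat m k (\<lambda>x. f (mat m k x))" by (rule poly_funs_eq_on_mat)
      also have "\<dots> = (\<Sum>t\<in>?T. fscale (a t) (?s t))"
        unfolding standard_monomial_combination[OF k] using a by simp
      also have "\<dots> \<in> fscale.span (?s ` ?T)"
        by (intro fscale.span_sum fscale.span_scale fscale.span_base) auto
      finally show "f \<in> fscale.span (?s ` ?T)" .
    qed
  qed
  ultimately show "is_basis fscale (?s ` ?T) (B_component m k n F D)"
    by (simp add: is_basis_def)
qed

lemma standard_monomial_highest_weight_vector:
  assumes nm: "n \<le> m" and k: "\<forall>r\<ge>k. F r = 0" and t: "t \<in> tableaux m n F D"
  shows "highest_weight_vector n fscale (rho_summand m k F) (GLn_act m k n) D (standard_monomial m k t)"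
  unfolding highest_weight_vector_def
proof
  show "standard_monomial m k t \<in> hw_space n fscale (rho_summand m k F) (GLn_act m k n) D"
    using standard_monomial_B_component[OF t k nm] by (simp add: B_component_def)
  show "standard_monomial m k t \<noteq> 0"
  proof
    assume z: "standard_monomial m k t = 0"
    let ?a = "\<lambda>v. if v = t then 1 else 0 :: complex"
    have "(\<Sum>v\<in>tableaux m n F D. fscale (?a v) (standard_monomial m k v)) = 0"
      using z by (intro sum.neutral) auto
    from standard_monomials_independent[where a = ?a, OF nm k this t] show False by simp
  qed
qed

section \<open>The action of the smaller group\<close>

lemma GLn_act_poly_funs:
  assumes nm: "n \<le> m" and X: "X \<in> GL n" and f: "f \<in> poly_funs m k"
  shows "GLn_act m k n X f \<in> poly_funs m k"
proof -
  let ?E = "embed m n X"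
  have E: "?E \<in> carrier_mat m m" by (rule embed_carrier[OF nm GL_carrier[OF X]])
  let ?p = "\<lambda>x. f (mat m k x)"
  let ?q = "\<lambda>x. ?p (\<lambda>v. \<Sum>l<m. ?E $$ (l, fst v) * x (l, snd v))"
  have "?q \<in> polyf ({..<m} \<times> {..<k})"
    by (rule polyf_subst[OF poly_funs_imp_polyf[OF f]]) (auto intro!: polyf_sum polyf.mult polyf.const polyf.coord)
  moreover have "GLn_act m k n X f = on_mat m k ?q"
  proof
    fix Q
    have "transpose_mat ?E * Q = mat m k (\<lambda>v. \<Sum>l<m. ?E $$ (l, fst v) * Q $$ (l, snd v))" if "Q \<in> carrier_mat m k"
      by (rule eq_matI) (use that E in \<open>auto simp: scalar_prod_def atLeast0LessThan\<close>)
    then show "GLn_act m k n X f Q = on_mat m k ?q Q"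
      by (simp add: GLn_act_apply[OF nm X] on_mat_def)
  qed
  ultimately show ?thesis using on_mat_in_poly_funs by simp
qed

text \<open>Left and right multiplication commute, so the conditions on the columns survive.\<close>

lemma GLn_act_rho_summand:
  assumes nm: "n \<le> m" and X: "X \<in> GL n" and f: "f \<in> rho_summand m k F"
  shows "GLn_act m k n X f \<in> rho_summand m k F"
proof -
  let ?E = "transpose_mat (embed m n X)"
  have E: "?E \<in> carrier_mat m m" using embed_carrier[OF nm GL_carrier[OF X]] by simp
  note p = rho_summand_poly_funs[OF f]
  have f1: "\<And>u Q. u \<in> unipotent k \<Longrightarrow> Q \<in> carrier_mat m k \<Longrightarrow> f (Q * u) = f Q"
    and f2: "\<And>a Q. a \<in> torus k \<Longrightarrow> Q \<in> carrier_mat m k \<Longrightarrow> f (Q * a) = torus_char k F a * f Q"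
    using f unfolding hw_right_iff[OF p] by blast+
  have EQ: "?E * Q \<in> carrier_mat m k" if "Q \<in> carrier_mat m k" for Q
    using E that by simp
  have as: "?E * (Q * u) = (?E * Q) * u" "Q * u \<in> carrier_mat m k"
    if "Q \<in> carrier_mat m k" "u \<in> GL k" for Q u
    using assoc_mult_mat[OF E that(1) GL_carrier[OF that(2)]] E that GL_carrier[OF that(2)] by auto
  show ?thesis
    unfolding hw_right_iff[OF GLn_act_poly_funs[OF nm X p]]
    unfolding GLn_act_apply[OF nm X]
    using as EQ f1 f2 unipotent_GL torus_GL by simp
qed

lemma GLn_act_linear:
  assumes "n \<le> m" and "X \<in> GL n"
  shows "GLn_act m k n X (f + g) = GLn_act m k n X f + GLn_act m k n X g"
    and "GLn_act m k n X (fscale a f) = fscale a (GLn_act m k n X f)"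
  by (auto simp: GLn_act_apply[OF assms] pointwise_scale_def fun_eq_iff)

lemma GLn_act_one:
  assumes "n \<le> m" and "f \<in> poly_funs m k"
  shows "GLn_act m k n (1\<^sub>m n) f = f"
  using poly_funs_outside[OF assms(2)]
  by (auto simp: GLn_act_apply[OF assms(1) GL_one] embed_one[OF assms(1)] fun_eq_iff)

text \<open>Transposition and precomposition both reverse the order; together they give a left
  action.\<close>

lemma GLn_act_mult:
  assumes nm: "n \<le> m" and X: "X \<in> GL n" and Y: "Y \<in> GL n"
  shows "GLn_act m k n (X * Y) f = GLn_act m k n X (GLn_act m k n Y f)"
proof
  fix Q
  let ?X = "embed m n X" and ?Y = "embed m n Y"
  have c: "?X \<in> carrier_mat m m" "?Y \<in> carrier_mat m m"
    using embed_carrier[OF nm GL_carrier] X Y by auto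
  have "transpose_mat (?X * ?Y) * Q = transpose_mat ?Y * (transpose_mat ?X * Q)" if "Q \<in> carrier_mat m k"
    unfolding transpose_mult[OF c] by (rule assoc_mult_mat) (use c that in auto)
  moreover have "transpose_mat ?X * Q \<in> carrier_mat m k" if "Q \<in> carrier_mat m k"
    using c that by (intro mult_carrier_mat) auto
  ultimately show "GLn_act m k n (X * Y) f Q = GLn_act m k n X (GLn_act m k n Y f) Q"
    by (simp add: GLn_act_apply[OF nm] GL_mult X Y embed_mult[OF nm GL_carrier[OF X] GL_carrier[OF Y]])
qed

lemma rho_summand_GL_rep:
  assumes "n \<le> m"
  shows "GL_rep n fscale (rho_summand m k F) (GLn_act m k n)"
  unfolding GL_rep_def linear_on_def
  using vector_space_fscale rho_summand_subspace GLn_act_rho_summand[OF assms] GLn_act_linear[OF assms]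
    GLn_act_one[OF assms rho_summand_poly_funs] GLn_act_mult[OF assms]
  by auto

subsection \<open>Powers of linear forms\<close>

text \<open>Terms are added one at a time, so that an induction can read off the explicit data
  \<open>b\<close> and \<open>r\<close>.\<close>

inductive_set power_span :: "'i set \<Rightarrow> nat \<Rightarrow> (('i \<Rightarrow> complex) \<Rightarrow> complex) set" for X N where
  zero: "(\<lambda>x. 0) \<in> power_span X N"
| step: "p \<in> power_span X N \<Longrightarrow> (\<lambda>x. b * (\<Sum>i\<in>X. r i * x i) ^ N + p x) \<in> power_span X N"

lemma power_span_term: "(\<lambda>x. b * (\<Sum>i\<in>X. r i * x i) ^ N) \<in> power_span X N"
  using power_span.step[OF power_span.zero] by simp

lemma power_span_add: "p \<in> power_span X N \<Longrightarrow> q \<in> power_span X N \<Longrightarrow> (\<lambda>x. p x + q x) \<in> power_span X N"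
  by (induction rule: power_span.induct) (auto simp: add.assoc intro: power_span.step)

lemma power_span_smult: "p \<in> power_span X N \<Longrightarrow> (\<lambda>x. a * p x) \<in> power_span X N"
proof (induction rule: power_span.induct)
  case zero
  then show ?case by (simp add: power_span.zero)
next
  case (step p b r)
  then show ?case using power_span.step[where b = "a * b" and r = r, OF step.IH] by (simp add: algebra_simps)
qed

lemma power_span_diff:
  assumes "p \<in> power_span X N" and "q \<in> power_span X N"
  shows "(\<lambda>x. p x - q x) \<in> power_span X N"
  using power_span_add[OF assms(1) power_span_smult[OF assms(2), of "- 1"]] by simp

lemma power_span_sum: "(\<And>a. a \<in> A \<Longrightarrow> p a \<in> power_span X N) \<Longrightarrow> (\<lambda>x. \<Sum>a\<in>A. p a x) \<in> power_span X N"
  by (induction A rule: infinite_finite_induct) (auto intro: power_span.zero power_span_add)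

text \<open>Induction on \<open>n\<close>: the difference \<open>g (2 s) - 2\<^sup>n g s\<close> has no term of degree \<open>n\<close>.\<close>

lemma power_span_coefficients:
  assumes "\<And>s. (\<lambda>x. \<Sum>i\<le>n. s ^ i * v i x) \<in> power_span X N" and "i \<le> n"
  shows "v i \<in> power_span X N"
  using assms
proof (induction n arbitrary: v i)
  case 0
  then show ?case using 0(1)[of 1] by simp
next
  case (Suc n)
  have low: "v i \<in> power_span X N" if "i \<le> n" for i
  proof -
    have "(\<lambda>x. \<Sum>i\<le>n. s ^ i * ((2 ^ i - 2 ^ Suc n) * v i x)) \<in> power_span X N" for s
    proof -
      have "(\<lambda>x. (\<Sum>i\<le>Suc n. (2 * s) ^ i * v i x) - 2 ^ Suc n * (\<Sum>i\<le>Suc n. s ^ i * v i x)) \<in> power_span X N"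
        by (rule power_span_diff[OF Suc.prems(1) power_span_smult[OF Suc.prems(1)]])
      moreover have "(\<Sum>i\<le>Suc n. (2 * s) ^ i * v i x) - 2 ^ Suc n * (\<Sum>i\<le>Suc n. s ^ i * v i x) =
          (\<Sum>i\<le>n. s ^ i * ((2 ^ i - 2 ^ Suc n) * v i x))" for x
      proof -
        have "(\<Sum>i\<le>Suc n. (2 * s) ^ i * v i x) - 2 ^ Suc n * (\<Sum>i\<le>Suc n. s ^ i * v i x) =
            (\<Sum>i\<le>Suc n. s ^ i * ((2 ^ i - 2 ^ Suc n) * v i x))"
          unfolding sum_distrib_left sum_subtractf[symmetric]
          by (rule sum.cong) (auto simp: algebra_simps power_mult_distrib)
        then show ?thesis by simp
      qed
      ultimately show ?thesis by simp
    qed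
    from Suc.IH[OF this that]
    have "(\<lambda>x. 1 / (2 ^ i - 2 ^ Suc n) * ((2 ^ i - 2 ^ Suc n) * v i x)) \<in> power_span X N"
      by (rule power_span_smult)
    moreover have "(2 :: complex) ^ i - 2 ^ Suc n \<noteq> 0"
    proof
      assume "(2 :: complex) ^ i - 2 ^ Suc n = 0"
      then have "of_nat (2 ^ i) = (of_nat (2 ^ Suc n) :: complex)" by simp
      then have "(2 :: nat) ^ i = 2 ^ Suc n" by (rule of_nat_eq_iff[THEN iffD1])
      then show False using that by (simp del: power_Suc)
    qed
    ultimately show ?thesis by simp
  qed
  show ?case
  proof (cases "i \<le> n")
    case False
    then have i: "i = Suc n" using Suc.prems(2) by simp
    have "(\<lambda>x. (\<Sum>i\<le>Suc n. 1 ^ i * v i x) - (\<Sum>i\<le>n. v i x)) \<in> power_span X N"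
      by (rule power_span_diff[OF Suc.prems(1) power_span_sum]) (rule low, simp)
    then show ?thesis by (simp add: i)
  qed (rule low)
qed

text \<open>Up to the factor \<open>Suc N\<close>, the product of \<open>x i\<close> with the
  \<open>N\<close>-th power of a linear form is the coefficient of \<open>s\<close> in the
  \<open>Suc N\<close>-th power of that form plus \<open>s * x i\<close>.\<close>

lemma power_span_mult_coord:
  assumes "p \<in> power_span X N" and "finite X" and "i \<in> X"
  shows "(\<lambda>x. p x * x i) \<in> power_span X (Suc N)"
  using assms(1)
proof induction
  case zero
  then show ?case by (simp add: power_span.zero)
next
  case (step p b r)
  define v where "v = (\<lambda>e x. of_nat (Suc N choose e) * x i ^ e * (\<Sum>i\<in>X. r i * x i) ^ (Suc N - e))"
  have "(\<lambda>x. \<Sum>e\<le>Suc N. s ^ e * v e x) \<in> power_span X (Suc N)" for s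
  proof -
    have "(\<Sum>e\<le>Suc N. s ^ e * v e x) = 1 * (\<Sum>j\<in>X. (r j + (if j = i then s else 0)) * x j) ^ Suc N" for x
    proof -
      have "(\<Sum>j\<in>X. (r j + (if j = i then s else 0)) * x j) = s * x i + (\<Sum>j\<in>X. r j * x j)"
        using assms(2,3) by (simp add: distrib_right sum.distrib if_distrib[of "\<lambda>z. z * _"] sum.delta cong: if_cong)
      then have "1 * (\<Sum>j\<in>X. (r j + (if j = i then s else 0)) * x j) ^ Suc N =
          (\<Sum>e\<le>Suc N. of_nat (Suc N choose e) * (s * x i) ^ e * (\<Sum>j\<in>X. r j * x j) ^ (Suc N - e))"
        by (simp only: binomial_ring mult_1_left)
      also have "\<dots> = (\<Sum>e\<le>Suc N. s ^ e * v e x)"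
        by (rule sum.cong) (auto simp: v_def power_mult_distrib mult_ac)
      finally show ?thesis ..
    qed
    then show ?thesis using power_span_term[where b = 1 and X = X and r = "\<lambda>j. r j + (if j = i then s else 0)" and N = "Suc N"] by simp
  qed
  from power_span_coefficients[OF this, of 1]
  have "v 1 \<in> power_span X (Suc N)" by simp
  from power_span_smult[OF this, of "b / of_nat (Suc N)"]
  have "(\<lambda>x. b * (\<Sum>i\<in>X. r i * x i) ^ N * x i) \<in> power_span X (Suc N)"
    by (simp add: v_def mult_ac del: of_nat_Suc)
  from power_span_add[OF this step.IH] show ?case by (simp add: distrib_right)
qed

text \<open>A power of a linear form is multiplied in one factor at a time, each factor being a
  combination of coordinates.\<close>

lemma power_span_mult:
  assumes "p \<in> power_span X N" and "q \<in> power_span X M" and "finite X"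
  shows "(\<lambda>x. p x * q x) \<in> power_span X (N + M)"
proof -
  have pow: "(\<lambda>x. p x * (\<Sum>i\<in>X. r i * x i) ^ M) \<in> power_span X (N + M)" for r M
  proof (induction M)
    case 0
    then show ?case using assms(1) by simp
  next
    case (Suc M)
    have "(\<lambda>x. \<Sum>i\<in>X. r i * (p x * (\<Sum>i\<in>X. r i * x i) ^ M * x i)) \<in> power_span X (Suc (N + M))"
      by (intro power_span_sum power_span_smult power_span_mult_coord Suc.IH assms(3))
    moreover have "(\<Sum>i\<in>X. r i * (p x * (\<Sum>i\<in>X. r i * x i) ^ M * x i)) = p x * (\<Sum>i\<in>X. r i * x i) ^ Suc M" for x
      unfolding power_Suc sum_distrib_right[of _ X "(\<Sum>i\<in>X. r i * x i) ^ M"] sum_distrib_left[of "p x"]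
      by (simp add: mult_ac)
    ultimately show ?case by simp
  qed
  show ?thesis
    using assms(2)
  proof induction
    case zero
    then show ?case by (simp add: power_span.zero)
  next
    case (step q b r)
    from power_span_add[OF power_span_smult[where a = b, OF pow[where r = r]] step.IH] show ?case
      by (simp add: algebra_simps)
  qed
qed

lemma power_span_homogeneous: "p \<in> power_span X N \<Longrightarrow> p (\<lambda>i. s * x i) = s ^ N * p x"
proof (induction rule: power_span.induct)
  case (step p b r)
  have "(\<Sum>i\<in>X. r i * (s * x i)) = s * (\<Sum>i\<in>X. r i * x i)"
    by (simp add: sum_distrib_left mult_ac)
  then show ?case using step by (simp add: power_mult_distrib algebra_simps)
qed simp

lemma polyf_power_span:
  assumes "f \<in> polyf X" and "finite X"
  obtains M h where "\<And>d. h d \<in> power_span X d" and "\<And>d x. M < d \<Longrightarrow> h d x = 0"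
    and "\<And>x. f x = (\<Sum>d\<le>M. h d x)"
proof -
  have "\<exists>M h. (\<forall>d. h d \<in> power_span X d) \<and> (\<forall>d x. M < d \<longrightarrow> h d x = 0) \<and> (\<forall>x. f x = (\<Sum>d\<le>M. h d x))"
    using assms(1)
  proof induction
    case (const c)
    have "(\<lambda>x. if d = 0 then c else 0) \<in> power_span X d" for d
      using power_span_term[where b = c and X = X and r = "\<lambda>_. 0" and N = 0] by (cases d) (auto intro: power_span.zero)
    then show ?case by (intro exI[of _ "0::nat"] exI[of _ "\<lambda>d x. if d = 0 then c else 0"]) auto
  next
    case (coord i)
    have "(\<lambda>x. x i) \<in> power_span X 1"
      using power_span_term[where b = 1 and X = X and r = "\<lambda>j. if j = i then 1 else 0" and N = 1] coord assms(2)
      by (simp add: if_distrib[of "\<lambda>z. z * _"] sum.delta cong: if_cong)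
    then have "(\<lambda>x. if d = 1 then x i else 0) \<in> power_span X d" for d
      by (cases "d = 1") (auto intro: power_span.zero)
    then show ?case
      by (intro exI[of _ "1::nat"] exI[of _ "\<lambda>d x. if d = 1 then x i else 0"]) auto
  next
    case (add f g)
    then obtain M h N l where fh: "\<forall>d. h d \<in> power_span X d" "\<forall>d x. M < d \<longrightarrow> h d x = 0" "\<forall>x. f x = (\<Sum>d\<le>M. h d x)"
      and gl: "\<forall>d. l d \<in> power_span X d" "\<forall>d x. N < d \<longrightarrow> l d x = 0" "\<forall>x. g x = (\<Sum>d\<le>N. l d x)"
      by (elim exE conjE)
    have 1: "(\<Sum>d\<le>M. h d x) = (\<Sum>d\<le>max M N. h d x)" for x
      by (rule sum.mono_neutral_left) (use fh(2) in auto)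
    have 2: "(\<Sum>d\<le>N. l d x) = (\<Sum>d\<le>max M N. l d x)" for x
      by (rule sum.mono_neutral_left) (use gl(2) in auto)
    show ?case
      by (intro exI[of _ "max M N"] exI[of _ "\<lambda>d x. h d x + l d x"])
        (use fh gl in \<open>auto simp: 1 2 sum.distrib intro: power_span_add\<close>)
  next
    case (mult f g)
    then obtain M h N l where fh: "\<forall>d. h d \<in> power_span X d" "\<forall>d x. M < d \<longrightarrow> h d x = 0" "\<forall>x. f x = (\<Sum>d\<le>M. h d x)"
      and gl: "\<forall>d. l d \<in> power_span X d" "\<forall>d x. N < d \<longrightarrow> l d x = 0" "\<forall>x. g x = (\<Sum>d\<le>N. l d x)"
      by (elim exE conjE)
    \<comment> \<open>The convolution of homogeneous parts is \<open>polynomial_product\<close> at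
      the point 1.\<close>
    have "(\<Sum>d\<le>M. h d x * 1 ^ d) * (\<Sum>d\<le>N. l d x * 1 ^ d) =
        (\<Sum>r\<le>M + N. (\<Sum>k\<le>r. h k x * l (r - k) x) * 1 ^ r)" for x
      by (rule polynomial_product) (use fh(2) gl(2) in auto)
    moreover have "(\<Sum>k\<le>r. h k x * l (r - k) x) = 0" if "M + N < r" for r x
    proof (rule sum.neutral, intro ballI)
      fix k assume "k \<in> {..r}"
      have "M < k \<or> N < r - k" using that by linarith
      then show "h k x * l (r - k) x = 0" using fh(2) gl(2) by auto
    qed
    moreover have "(\<lambda>x. \<Sum>k\<le>r. h k x * l (r - k) x) \<in> power_span X r" for r
    proof (rule power_span_sum)
      fix k assume "k \<in> {..r}"
      then show "(\<lambda>x. h k x * l (r - k) x) \<in> power_span X r"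
        using power_span_mult[OF fh(1)[rule_format, of k] gl(1)[rule_format, of "r - k"] assms(2)] by simp
    qed
    ultimately show ?case
      by (intro exI[of _ "M + N"] exI[of _ "\<lambda>r x. \<Sum>k\<le>r. h k x * l (r - k) x"]) (simp add: fh(3) gl(3))
  qed
  then show ?thesis using that by (elim exE conjE) blast
qed

text \<open>Scaling singles out the part of degree \<open>N\<close>. The hypothesis is restricted to
  \<open>s \<noteq> 0\<close> because it will come from invertible column scalings.\<close>

lemma homogeneous_power_sum:
  assumes f: "f \<in> polyf X" and "finite X" and hom: "\<And>s x. s \<noteq> 0 \<Longrightarrow> f (\<lambda>i. s * x i) = s ^ N * f x"
  shows "\<exists>J b r. \<forall>x. f x = (\<Sum>j<J::nat. b j * (\<Sum>i\<in>X. r j i * x i) ^ N)"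
proof -
  obtain M h where h: "\<And>d. h d \<in> power_span X d" "\<And>d x. M < d \<Longrightarrow> h d x = 0"
    and fh: "\<And>x. f x = (\<Sum>d\<le>M. h d x)"
    using polyf_power_span[OF f assms(2)] by metis
  have fN: "f x = h N x" for x
  proof -
    let ?a = "\<lambda>d. h d x - (if d = N then f x else 0)"
    have "(\<Sum>d\<le>max M N. ?a d * s ^ d) = 0" if "s \<notin> {0}" for s
    proof -
      have "(\<Sum>d\<le>max M N. h d x * s ^ d) = (\<Sum>d\<le>M. h d (\<lambda>i. s * x i))"
        by (rule sum.mono_neutral_cong_right) (auto simp: h(2) power_span_homogeneous[OF h(1)])
      also have "\<dots> = s ^ N * f x" using hom[of s x] that by (simp add: fh)
      finally have 1: "(\<Sum>d\<le>max M N. h d x * s ^ d) = s ^ N * f x" .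
      have "(\<Sum>d\<le>max M N. (if d = N then f x else 0) * s ^ d) = s ^ N * f x"
        by (simp add: if_distrib[of "\<lambda>z. z * _"] sum.delta cong: if_cong)
      then show ?thesis using 1 by (simp add: left_diff_distrib sum_subtractf)
    qed
    from coeffs_eq_0_if_cofinite[where A = "{0}" and a = ?a and M = "max M N" and e = N, OF _ this]
    have "?a N = 0" by simp
    then show ?thesis by simp
  qed
  have "\<exists>J b r. \<forall>x. p x = (\<Sum>j<J::nat. b j * (\<Sum>i\<in>X. r j i * x i) ^ N)" if "p \<in> power_span X N" for p
    using that
  proof induction
    case zero
    show ?case by (rule exI[of _ 0]) simp
  next
    case (step p b' r')
    then obtain J b r where p: "\<forall>x. p x = (\<Sum>j<J::nat. b j * (\<Sum>i\<in>X. r j i * x i) ^ N)" by (elim exE)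
    show ?case
    proof (intro exI allI)
      fix x
      show "b' * (\<Sum>i\<in>X. r' i * x i) ^ N + p x =
          (\<Sum>j<Suc J. (b(J := b')) j * (\<Sum>i\<in>X. (r(J := r')) j i * x i) ^ N)"
        using p by simp
    qed
  qed
  from this[OF h(1)[of N]] show ?thesis by (simp add: fN)
qed

text \<open>Positivity of the Hermitian form on symmetric tensors for which \<open>\<langle>r\<^sup>N, r'\<^sup>N\<rangle> = \<langle>r, r'\<rangle>\<^sup>N\<close>.\<close>

lemma power_sum_zero:
  fixes e :: "'a \<Rightarrow> complex" and r :: "'a \<Rightarrow> 'i \<Rightarrow> complex"
  assumes X: "finite X"
    and zero: "(\<Sum>a\<in>A. \<Sum>a'\<in>A. e a * cnj (e a') * (\<Sum>i\<in>X. r a i * cnj (r a' i)) ^ N) = 0"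
  shows "(\<Sum>a\<in>A. e a * (\<Sum>i\<in>X. r a i * x i) ^ N) = 0"
proof -
  \<comment> \<open>Words of length \<open>N\<close> in \<open>X\<close> index the coordinates of
    the \<open>N\<close>-th tensor power. \<open>T\<close> is the combination of the tensor powers
    of the \<open>r a\<close>, and the given form is its squared norm.\<close>
  let ?W = "PiE {..<N} (\<lambda>_. X)"
  have W: "finite ?W" by (rule finite_PiE) (use X in auto)
  have ex: "(\<Sum>i\<in>X. u i) ^ N = (\<Sum>w\<in>?W. \<Prod>c<N. u (w c))" for u :: "'i \<Rightarrow> complex"
    using prod_sum_PiE[of "{..<N}" "\<lambda>_. X" "\<lambda>_. u"] X by simp
  define T where "T w = (\<Sum>a\<in>A. e a * (\<Prod>c<N. r a (w c)))" for w
  have "(\<Sum>a\<in>A. \<Sum>a'\<in>A. e a * cnj (e a') * (\<Sum>i\<in>X. r a i * cnj (r a' i)) ^ N) =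
      (\<Sum>w\<in>?W. T w * cnj (T w))"
  proof -
    have "(\<Sum>a\<in>A. \<Sum>a'\<in>A. e a * cnj (e a') * (\<Sum>i\<in>X. r a i * cnj (r a' i)) ^ N) =
        (\<Sum>a\<in>A. \<Sum>a'\<in>A. \<Sum>w\<in>?W. (e a * (\<Prod>c<N. r a (w c))) * cnj (e a' * (\<Prod>c<N. r a' (w c))))"
      unfolding ex by (simp add: sum_distrib_left prod.distrib mult_ac)
    also have "\<dots> = (\<Sum>a\<in>A. \<Sum>w\<in>?W. \<Sum>a'\<in>A. (e a * (\<Prod>c<N. r a (w c))) * cnj (e a' * (\<Prod>c<N. r a' (w c))))"
      by (intro sum.cong refl sum.swap)
    also have "\<dots> = (\<Sum>w\<in>?W. \<Sum>a\<in>A. \<Sum>a'\<in>A. (e a * (\<Prod>c<N. r a (w c))) * cnj (e a' * (\<Prod>c<N. r a' (w c))))"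
      by (rule sum.swap)
    also have "\<dots> = (\<Sum>w\<in>?W. T w * cnj (T w))"
      by (simp only: T_def cnj_sum sum_product)
    finally show ?thesis .
  qed
  also have "\<dots> = of_real (\<Sum>w\<in>?W. (cmod (T w))\<^sup>2)"
    by (simp only: complex_norm_square[symmetric] of_real_sum)
  finally have "complex_of_real (\<Sum>w\<in>?W. (cmod (T w))\<^sup>2) = 0" unfolding zero by (rule sym)
  then have "(\<Sum>w\<in>?W. (cmod (T w))\<^sup>2) = 0" by (simp only: of_real_eq_0_iff)
  then have T0: "T w = 0" if "w \<in> ?W" for w
    using sum_nonneg_eq_0_iff[OF W, of "\<lambda>w. (cmod (T w))\<^sup>2"] that by simp
  have "(\<Sum>a\<in>A. e a * (\<Sum>i\<in>X. r a i * x i) ^ N) = (\<Sum>a\<in>A. \<Sum>w\<in>?W. e a * (\<Prod>c<N. r a (w c)) * (\<Prod>c<N. x (w c)))"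
    unfolding ex by (simp add: sum_distrib_left prod.distrib mult_ac)
  also have "\<dots> = (\<Sum>w\<in>?W. \<Sum>a\<in>A. e a * (\<Prod>c<N. r a (w c)) * (\<Prod>c<N. x (w c)))" by (rule sum.swap)
  also have "\<dots> = (\<Sum>w\<in>?W. T w * (\<Prod>c<N. x (w c)))" by (simp add: T_def sum_distrib_right)
  also have "\<dots> = 0" by (rule sum.neutral) (simp add: T0)
  finally show ?thesis .
qed

subsection \<open>The invariant inner product\<close>

lemma unipotent_mult:
  assumes u: "u \<in> unipotent r" and v: "v \<in> unipotent r"
  shows "u * v \<in> unipotent r"
proof -
  note ud = unipotentD[OF u] and vd = unipotentD[OF v]
  have e: "(u * v) $$ (i, j) = (\<Sum>l = 0..<r. u $$ (i, l) * v $$ (l, j))" if "i < r" "j < r" for i j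
    using that ud(1) vd(1) by (simp add: scalar_prod_def)
  show ?thesis
  proof (rule unipotentI)
    show "u * v \<in> carrier_mat r r" using ud(1) vd(1) by simp
    fix i j assume i: "i < r" and ji: "j < i"
    have "u $$ (i, l) * v $$ (l, j) = 0" if "l < r" for l
      using ud(2)[OF i, of l] vd(2)[OF that, of j] ji by (cases "l < i") auto
    then show "(u * v) $$ (i, j) = 0" unfolding e[OF i less_trans[OF ji i]] by (intro sum.neutral) auto
  next
    fix i assume i: "i < r"
    have "u $$ (i, l) * v $$ (l, i) = (if l = i then 1 else 0)" if "l < r" for l
      using ud(2)[OF i, of l] vd(2)[OF that, of i] ud(3)[OF i] vd(3)[OF i]
      by (cases l i rule: linorder_cases) auto
    then show "(u * v) $$ (i, i) = 1" unfolding e[OF i i] using i by simp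
  qed
qed

lemma unipotent_one: "1\<^sub>m r \<in> unipotent r"
  by (rule unipotentI) auto

text \<open>Elimination again. \<open>Z\<close> quantifies over all \<open>L\<close> and
  \<open>U\<close>, so that the inverse of an elementary operation can be absorbed into them; at an
  invertible diagonal matrix \<open>cell\<close> applies.\<close>

lemma big_cell_dense:
  assumes \<Phi>: "\<Phi> \<in> polyf ({..<n} \<times> {..<n})"
    and cell: "\<And>L d U. transpose_mat L \<in> unipotent n \<Longrightarrow> d \<in> torus n \<Longrightarrow> U \<in> unipotent n \<Longrightarrow> \<Phi> (($$) (L * d * U)) = 0"
  shows "\<Phi> x = 0"
proof -
  define Z where "Z = {x. \<forall>L U. transpose_mat L \<in> unipotent n \<longrightarrow> U \<in> unipotent n \<longrightarrow>
    \<Phi> (($$) (L * mat n n x * U)) = 0}"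
  have carL: "L \<in> carrier_mat n n" if "transpose_mat L \<in> unipotent n" for L
    using unipotentD(1)[OF that] by simp
  have elem: "mat n n (\<lambda>(i, j). if i = j then 1 else if i = a \<and> j = b then s else 0) \<in> unipotent n"
    if "a < b" "b < n" for a b and s :: complex
    by (rule unipotentI) (use that in auto)
  have "x \<in> Z"
  proof (rule diagonal_dense[of n n])
    fix x :: array and r
    assume a: "\<And>s. s \<noteq> 0 \<Longrightarrow> x((r, r) := s) \<in> Z"
    show "x \<in> Z"
      unfolding Z_def mem_Collect_eq
    proof (intro allI impI)
      fix L U assume L: "transpose_mat L \<in> unipotent n" and U: "U \<in> unipotent n"
      let ?f = "\<lambda>x. \<Phi> (\<lambda>v. \<Sum>q<n. (\<Sum>l<n. L $$ (fst v, l) * x (l, q)) * U $$ (q, snd v))"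
      have f: "\<Phi> (($$) (L * mat n n x * U)) = ?f x" for x
        by (rule polyf_cong[OF \<Phi>])
          (use carL[OF L] unipotentD(1)[OF U] in \<open>auto simp: scalar_prod_def atLeast0LessThan\<close>)
      have "?f \<in> polyf ({..<n} \<times> {..<n})"
        by (rule polyf_subst[OF \<Phi>]) (auto intro!: polyf_sum polyf.mult polyf.const polyf.coord)
      moreover have "?f (x((r, r) := s)) = 0" if "s \<noteq> 0" for s
        unfolding f[symmetric] using a[OF that] L U unfolding Z_def by blast
      ultimately show "\<Phi> (($$) (L * mat n n x * U)) = 0"
        unfolding f by (rule polyf_line_entry)
    qed
  next
    fix x :: array and a b and s :: complex
    assume ab: "a < b" "b < n" and r: "rowop a b s x \<in> Z"
    let ?E = "mat n n (\<lambda>(i, j). if i = j then 1 else if i = a \<and> j = b then - s else 0)"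
    have x: "mat n n x = transpose_mat ?E * mat n n (rowop a b s x)"
    proof (rule eq_matI)
      fix i j assume "i < dim_row (transpose_mat ?E * mat n n (rowop a b s x))"
        "j < dim_col (transpose_mat ?E * mat n n (rowop a b s x))"
      then have ij: "i < n" "j < n" by auto
      have "(transpose_mat ?E * mat n n (rowop a b s x)) $$ (i, j) =
          (\<Sum>l = 0..<n. (if l = i then rowop a b s x (l, j) else 0) +
            (if l = a then if i = b then - s * rowop a b s x (l, j) else 0 else 0))"
        using ij ab by (auto simp: scalar_prod_def intro!: sum.cong)
      also have "\<dots> = x (i, j)" using ij ab by (simp add: sum.distrib rowop_def)
      finally show "mat n n x $$ (i, j) = (transpose_mat ?E * mat n n (rowop a b s x)) $$ (i, j)"
        using ij by simp
    qed auto
    show "x \<in> Z"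
      unfolding Z_def mem_Collect_eq
    proof (intro allI impI)
      fix L U assume L: "transpose_mat L \<in> unipotent n" and U: "U \<in> unipotent n"
      have "transpose_mat (L * transpose_mat ?E) = ?E * transpose_mat L"
        using carL[OF L] by (subst transpose_mult[of _ n n _ n]) auto
      also have "\<dots> \<in> unipotent n" by (rule unipotent_mult[OF elem[OF ab] L])
      finally have "transpose_mat (L * transpose_mat ?E) \<in> unipotent n" .
      then have "\<Phi> (($$) (L * transpose_mat ?E * mat n n (rowop a b s x) * U)) = 0"
        using r U unfolding Z_def by blast
      moreover have "L * transpose_mat ?E * mat n n (rowop a b s x) = L * mat n n x"
        unfolding x by (rule assoc_mult_mat[of _ n n _ n _ n]) (use carL[OF L] in auto)
      ultimately show "\<Phi> (($$) (L * mat n n x * U)) = 0" by simp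
    qed
  next
    fix x :: array and a b and s :: complex
    assume ab: "a < b" "b < n" and r: "colop a b s x \<in> Z"
    let ?E = "mat n n (\<lambda>(i, j). if i = j then 1 else if i = a \<and> j = b then - s else 0)"
    have x: "mat n n x = mat n n (colop a b s x) * ?E"
    proof (rule eq_matI)
      fix i j assume "i < dim_row (mat n n (colop a b s x) * ?E)" "j < dim_col (mat n n (colop a b s x) * ?E)"
      then have ij: "i < n" "j < n" by auto
      have "(mat n n (colop a b s x) * ?E) $$ (i, j) =
          (\<Sum>l = 0..<n. (if l = j then colop a b s x (i, l) else 0) +
            (if l = a then if j = b then - s * colop a b s x (i, l) else 0 else 0))"
        using ij ab by (auto simp: scalar_prod_def intro!: sum.cong)
      also have "\<dots> = x (i, j)" using ij ab by (simp add: sum.distrib colop_def)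
      finally show "mat n n x $$ (i, j) = (mat n n (colop a b s x) * ?E) $$ (i, j)"
        using ij by simp
    qed auto
    show "x \<in> Z"
      unfolding Z_def mem_Collect_eq
    proof (intro allI impI)
      fix L U assume L: "transpose_mat L \<in> unipotent n" and U: "U \<in> unipotent n"
      have "\<Phi> (($$) (L * mat n n (colop a b s x) * (?E * U))) = 0"
        using r L unipotent_mult[OF elem[OF ab] U] unfolding Z_def by blast
      moreover have "L * mat n n (colop a b s x) * (?E * U) = L * mat n n (colop a b s x) * ?E * U"
        by (rule assoc_mult_mat[of _ n n _ n _ n, symmetric]) (use carL[OF L] unipotentD(1)[OF U] in auto)
      moreover have "L * mat n n (colop a b s x) * ?E = L * mat n n x"
        unfolding x by (rule assoc_mult_mat[of _ n n _ n _ n]) (use carL[OF L] in auto)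
      ultimately show "\<Phi> (($$) (L * mat n n x * U)) = 0" by simp
    qed
  next
    fix x :: array
    assume d0: "\<And>i j. i < n \<Longrightarrow> j < n \<Longrightarrow> i \<noteq> j \<Longrightarrow> x (i, j) = 0" and d1: "\<And>i. i < n \<Longrightarrow> i < n \<Longrightarrow> x (i, i) \<noteq> 0"
    have "mat n n x = mat n n (\<lambda>(i, j). if i = j then x (i, i) else 0)"
      by (rule eq_matI) (auto simp: d0)
    also have "\<dots> \<in> torus n" by (rule torus_diag) (simp add: d1)
    finally show "x \<in> Z" using cell unfolding Z_def by blast
  qed
  moreover have "transpose_mat (1\<^sub>m n) \<in> unipotent n" using unipotent_one[of n] by simp
  ultimately have "\<Phi> (($$) (1\<^sub>m n * mat n n x * 1\<^sub>m n)) = 0"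
    using unipotent_one[of n] unfolding Z_def mem_Collect_eq by blast
  moreover have "1\<^sub>m n * mat n n x * 1\<^sub>m n = mat n n x" by simp
  moreover have "\<Phi> (($$) (mat n n x)) = \<Phi> x" by (rule polyf_cong[OF \<Phi>]) auto
  ultimately show ?thesis by simp
qed

section \<open>Conjugate transposes and the pairing of matrices\<close>

abbreviation cmat :: "complex mat \<Rightarrow> complex mat" where
  "cmat \<equiv> map_mat cnj"

definition star :: "complex mat \<Rightarrow> complex mat" where
  "star g = transpose_mat (cmat g)"

lemma cmat_mult:
  assumes "A \<in> carrier_mat a b" and "B \<in> carrier_mat b c"
  shows "cmat (A * B) = cmat A * cmat B"
  by (rule eq_matI) (use assms in \<open>auto simp: scalar_prod_def\<close>)

lemma cmat_cmat: "cmat (cmat A) = A"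
  by (rule eq_matI) auto

lemma cmat_transpose: "cmat (transpose_mat A) = transpose_mat (cmat A)"
  by (rule eq_matI) auto

lemma cmat_GL: "g \<in> GL n \<Longrightarrow> cmat g \<in> GL n"
proof -
  assume g: "g \<in> GL n"
  have c: "g \<in> carrier_mat n n" "minv g \<in> carrier_mat n n" using GL_carrier g minv(1) by auto
  have "cmat g * cmat (minv g) = cmat (1\<^sub>m n)"
    using cmat_mult[OF c] minv(3)[OF g] by simp
  also have "cmat (1\<^sub>m n) = 1\<^sub>m n" by (rule eq_matI) auto
  finally have "det (cmat g) * det (cmat (minv g)) = 1"
    using det_mult[of "cmat g" n "cmat (minv g)"] c by simp
  then show ?thesis using c by (auto simp: GL_iff_det)
qed

lemma star_GL: "g \<in> GL n \<Longrightarrow> star g \<in> GL n"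
  unfolding star_def by (intro GL_transpose cmat_GL)

lemma cmat_embed:
  assumes "n \<le> m" and "X \<in> carrier_mat n n"
  shows "cmat (embed m n X) = embed m n (cmat X)"
proof -
  have "cmat X \<in> carrier_mat n n" using assms by simp
  then show ?thesis
    using embed_carrier[OF assms] embed_carrier[OF assms(1), of "cmat X"]
      carrier_matD[OF assms(2)]
    by (intro eq_matI) (auto simp: embed_index[OF assms(1)] assms)
qed

lemma embed_transpose:
  assumes "n \<le> m" and "X \<in> carrier_mat n n"
  shows "transpose_mat (embed m n X) = embed m n (transpose_mat X)"
proof -
  have "transpose_mat X \<in> carrier_mat n n" using assms by simp
  then show ?thesis
    using embed_carrier[OF assms] embed_carrier[OF assms(1), of "transpose_mat X"]
      carrier_matD[OF assms(2)]
    by (intro eq_matI) (auto simp: embed_index[OF assms(1)] assms)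
qed

text \<open>Complex bilinear; applying \<open>cmat\<close> to one argument gives the Hermitian
  product of matrices.\<close>

definition bil :: "nat \<Rightarrow> nat \<Rightarrow> complex mat \<Rightarrow> complex mat \<Rightarrow> complex" where
  "bil m k A B = (\<Sum>v\<in>{..<m} \<times> {..<k}. A $$ v * B $$ v)"

lemma bil_commute: "bil m k A B = bil m k B A"
  by (simp add: bil_def mult.commute)

lemma bil_adjoint:
  assumes "E \<in> carrier_mat m m" "A \<in> carrier_mat m k" "B \<in> carrier_mat m k"
  shows "bil m k A (transpose_mat E * B) = bil m k (E * A) B"
proof -
  have 1: "(transpose_mat E * B) $$ (i, j) = (\<Sum>l<m. E $$ (l, i) * B $$ (l, j))" if "i < m" "j < k" for i j
    using assms that by (simp add: scalar_prod_def atLeast0LessThan)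
  have 2: "(E * A) $$ (l, j) = (\<Sum>i<m. E $$ (l, i) * A $$ (i, j))" if "l < m" "j < k" for l j
    using assms that by (simp add: scalar_prod_def atLeast0LessThan)
  have "bil m k A (transpose_mat E * B) = (\<Sum>i<m. \<Sum>j<k. \<Sum>l<m. A $$ (i, j) * (E $$ (l, i) * B $$ (l, j)))"
    unfolding bil_def by (simp add: sum.cartesian_product' 1 sum_distrib_left)
  also have "\<dots> = (\<Sum>i<m. \<Sum>l<m. \<Sum>j<k. A $$ (i, j) * (E $$ (l, i) * B $$ (l, j)))"
    by (intro sum.cong refl sum.swap)
  also have "\<dots> = (\<Sum>l<m. \<Sum>i<m. \<Sum>j<k. A $$ (i, j) * (E $$ (l, i) * B $$ (l, j)))"
    by (rule sum.swap)
  also have "\<dots> = (\<Sum>l<m. \<Sum>j<k. \<Sum>i<m. A $$ (i, j) * (E $$ (l, i) * B $$ (l, j)))"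
    by (intro sum.cong refl sum.swap)
  also have "\<dots> = bil m k (E * A) B"
    unfolding bil_def by (simp add: sum.cartesian_product' 2 sum_distrib_left sum_distrib_right mult_ac)
  finally show ?thesis .
qed

lemma bil_cmat:
  assumes "A \<in> carrier_mat m k" "B \<in> carrier_mat m k"
  shows "bil m k (cmat A) (cmat B) = cnj (bil m k A B)"
  using assms by (auto simp: bil_def intro!: sum.cong)

locale hw_function =
  fixes m k n :: nat and F D :: "nat \<Rightarrow> nat" and f :: "complex mat \<Rightarrow> complex"
    and J N :: nat and b :: "nat \<Rightarrow> complex" and R :: "nat \<Rightarrow> complex mat"
  assumes nm: "n \<le> m" and f: "f \<in> B_component m k n F D" and R: "R j \<in> carrier_mat m k"
    and expand: "Q \<in> carrier_mat m k \<Longrightarrow> f Q = (\<Sum>j<J. b j * bil m k (R j) Q ^ N)"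
begin

text \<open>For \<open>f = \<Sum> b\<^sub>j \<langle>R\<^sub>j, \<cdot>\<rangle>\<^sup>N\<close> this is the inner product of \<open>g f\<close> and \<open>f\<close>.\<close>

definition K :: "complex mat \<Rightarrow> complex" where
  "K g = (\<Sum>j<J. cnj (b j) * f (transpose_mat (embed m n g) * cmat (R j)))"

lemma cR: "cmat (R j) \<in> carrier_mat m k"
  using R by simp

lemma E: "g \<in> carrier_mat n n \<Longrightarrow> embed m n g \<in> carrier_mat m m"
  by (rule embed_carrier[OF nm])

lemma EQ: "g \<in> carrier_mat n n \<Longrightarrow> Q \<in> carrier_mat m k \<Longrightarrow> transpose_mat (embed m n g) * Q \<in> carrier_mat m k"
  using E by (intro mult_carrier_mat) auto

lemma transpose_embed_mult:
  assumes "g \<in> carrier_mat n n" "h \<in> carrier_mat n n" "Q \<in> carrier_mat m k"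
  shows "transpose_mat (embed m n (g * h)) * Q = transpose_mat (embed m n h) * (transpose_mat (embed m n g) * Q)"
  unfolding embed_mult[OF nm assms(1,2)] transpose_mult[OF E[OF assms(1)] E[OF assms(2)]]
  by (rule assoc_mult_mat[of _ m m _ m _ k]) (use E[OF assms(1)] E[OF assms(2)] assms(3) in auto)

lemma K_unipotent: "g \<in> carrier_mat n n \<Longrightarrow> u \<in> unipotent n \<Longrightarrow> K (g * u) = K g"
  using f EQ[OF _ cR] unfolding B_component_iff[OF nm] K_def
  by (simp add: transpose_embed_mult[OF _ unipotentD(1) cR])

lemma K_torus: "g \<in> carrier_mat n n \<Longrightarrow> a \<in> torus n \<Longrightarrow> K (g * a) = torus_char n D a * K g"
  using f EQ[OF _ cR] unfolding B_component_iff[OF nm] K_def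
  by (simp add: transpose_embed_mult[OF _ torusD(1) cR] sum_distrib_left mult.left_commute)

text \<open>\<open>star g\<close> is the adjoint of \<open>g\<close>, and the form is Hermitian:
  exchanging the two copies of the expansion of \<open>f\<close> conjugates every pairing.\<close>

lemma K_star:
  assumes g: "g \<in> carrier_mat n n"
  shows "K (star g) = cnj (K g)"
proof -
  let ?E = "embed m n g"
  have cg: "cmat g \<in> carrier_mat n n" using g by simp
  have star: "transpose_mat (embed m n (star g)) = cmat ?E"
    unfolding star_def using embed_transpose[OF nm cg] cmat_embed[OF nm g] by (metis transpose_transpose)
  have cE: "cmat ?E \<in> carrier_mat m m" using E[OF g] by simp
  have "K (star g) = (\<Sum>j<J. \<Sum>j'<J. cnj (b j) * b j' * bil m k (R j') (cmat ?E * cmat (R j)) ^ N)"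
    unfolding K_def star using cE R by (simp add: expand sum_distrib_left mult.assoc)
  also have "\<dots> = (\<Sum>j<J. \<Sum>j'<J. cnj (b j') * b j * bil m k (R j) (cmat ?E * cmat (R j')) ^ N)"
    by (rule sum.swap)
  also have "\<dots> = cnj (\<Sum>j<J. \<Sum>j'<J. b j' * cnj (b j) * bil m k (R j') (transpose_mat ?E * cmat (R j)) ^ N)"
  proof -
    have "cnj (bil m k (R j) (transpose_mat ?E * cmat (R j'))) = bil m k (R j') (cmat ?E * cmat (R j))" for j j'
    proof -
      have "bil m k (R j') (cmat ?E * cmat (R j)) = bil m k (cmat (R j)) (transpose_mat (cmat ?E) * R j')"
        using bil_adjoint[OF cE cR[of j] R[of j']] bil_commute by metis
      moreover have "cmat (transpose_mat ?E * cmat (R j')) = transpose_mat (cmat ?E) * R j'"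
        using cmat_mult[of "transpose_mat ?E" m m "cmat (R j')" k] E[OF g] cR
        by (simp add: cmat_cmat cmat_transpose)
      ultimately show ?thesis
        using bil_cmat[OF R[of j] EQ[OF g cR[of j']]] by simp
    qed
    then have "cnj (\<Sum>j<J. \<Sum>j'<J. b j' * cnj (b j) * bil m k (R j') (transpose_mat ?E * cmat (R j)) ^ N) =
      (\<Sum>j<J. \<Sum>j'<J. cnj (b j') * b j * bil m k (R j) (cmat ?E * cmat (R j')) ^ N)"
      by (simp add: mult_ac)
    then show ?thesis by simp
  qed
  also have "(\<Sum>j<J. \<Sum>j'<J. b j' * cnj (b j) * bil m k (R j') (transpose_mat ?E * cmat (R j)) ^ N) = K g"
    unfolding K_def by (simp add: expand[OF EQ[OF g cR]] sum_distrib_left mult_ac)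
  finally show ?thesis .
qed

text \<open>\<open>U\<close> fixes \<open>f\<close> and \<open>d\<close> scales it. \<open>L\<close>
  passes to the other argument as \<open>star L\<close>, which is upper unipotent and fixes
  \<open>f\<close> too.\<close>

lemma K_cell:
  assumes L: "transpose_mat L \<in> unipotent n" and d: "d \<in> torus n" and U: "U \<in> unipotent n"
  shows "K (L * d * U) = torus_char n D d * K (1\<^sub>m n)"
proof -
  have c: "L \<in> carrier_mat n n" "d \<in> carrier_mat n n"
    using unipotentD(1)[OF L] torusD(1)[OF d] by auto
  have one: "1\<^sub>m n \<in> carrier_mat n n" by simp
  have s1: "star (1\<^sub>m n) = 1\<^sub>m n" unfolding star_def by (rule eq_matI) auto
  have sL: "star L \<in> unipotent n"
    by (rule unipotentI) (use c unipotentD(2,3)[OF L] in \<open>auto simp: star_def\<close>)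
  have "K (L * d * U) = torus_char n D d * K L"
    using K_unipotent[OF _ U] K_torus[OF c(1) d] c by simp
  also have "K L = cnj (K (1\<^sub>m n * star L))"
    using K_star[of "star L"] c by (simp add: star_def cmat_cmat cmat_transpose)
  also have "\<dots> = K (1\<^sub>m n)"
    unfolding K_unipotent[OF one sL] K_star[OF one, symmetric] s1 ..
  finally show ?thesis .
qed

text \<open>Comparison on the big cell extends to all matrices because \<open>K\<close> is
  polynomial in the entries, singular matrices included.\<close>

lemma K_polyf: "(\<lambda>x. K (mat n n x)) \<in> polyf ({..<n} \<times> {..<n})"
  unfolding K_def
proof (intro polyf_sum polyf.mult polyf.const)
  fix j
  have fp: "f \<in> poly_funs m k" using f rho_summand_poly_funs by (auto simp: B_component_iff[OF nm])
  let ?e = "\<lambda>x l i. if l < n \<and> i < n then x (l, i) else if l = i then 1 else 0"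
  have "(\<lambda>x. f (mat m k (\<lambda>v. \<Sum>l<m. ?e x l (fst v) * cnj (R j $$ (l, snd v))))) \<in> polyf ({..<n} \<times> {..<n})"
  proof (rule polyf_subst[OF poly_funs_imp_polyf[OF fp]], intro polyf_sum polyf.mult polyf.const)
    fix v l
    show "(\<lambda>x. ?e x l (fst v)) \<in> polyf ({..<n} \<times> {..<n})"
      by (cases "l < n \<and> fst v < n") (auto intro: polyf.intros)
  qed
  moreover have "transpose_mat (embed m n (mat n n x)) * cmat (R j) =
      mat m k (\<lambda>v. \<Sum>l<m. ?e x l (fst v) * cnj (R j $$ (l, snd v)))" for x :: array
  proof (rule eq_matI)
    have x: "mat n n x \<in> carrier_mat n n" by simp
    fix i t assume "i < dim_row (mat m k (\<lambda>v. \<Sum>l<m. ?e x l (fst v) * cnj (R j $$ (l, snd v))))"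
      "t < dim_col (mat m k (\<lambda>v. \<Sum>l<m. ?e x l (fst v) * cnj (R j $$ (l, snd v))))"
    then have it: "i < m" "t < k" by auto
    show "(transpose_mat (embed m n (mat n n x)) * cmat (R j)) $$ (i, t) =
      mat m k (\<lambda>v. \<Sum>l<m. ?e x l (fst v) * cnj (R j $$ (l, snd v))) $$ (i, t)"
      using it E[OF x] R[of j]
      by (auto simp: scalar_prod_def atLeast0LessThan embed_index[OF nm x] intro!: sum.cong)
  qed (use E[of "mat n n x"] R[of j] in auto)
  ultimately show "(\<lambda>x. f (transpose_mat (embed m n (mat n n x)) * cmat (R j))) \<in> polyf ({..<n} \<times> {..<n})"
    by simp
qed

text \<open>Taking \<open>h = star (g i')\<close> and summing with the factors
  \<open>cnj (c i')\<close> yields the squared norm of the combination, by the adjoint property;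
  positivity finishes.\<close>

lemma combination_zero:
  assumes g: "\<And>i. i < l \<Longrightarrow> g i \<in> GL n"
    and zero: "\<And>h. h \<in> GL n \<Longrightarrow> (\<Sum>i<l. c i * K (h * g i)) = 0"
  shows "(\<Sum>i<l. fscale (c i) (GLn_act m k n (g i) f)) = 0"
proof
  fix Q
  show "(\<Sum>i<l. fscale (c i) (GLn_act m k n (g i) f)) Q = 0 Q"
  proof (cases "Q \<in> carrier_mat m k")
    case True
    let ?E = "\<lambda>i. embed m n (g i)"
    have gc: "g i \<in> carrier_mat n n" if "i < l" for i using g[OF that] GL_carrier by blast
    have ER: "?E i * R j \<in> carrier_mat m k" if "i < l" for i j using E[OF gc[OF that]] R by simp
    have hE: "f (transpose_mat (?E i) * Q) = (\<Sum>j<J. b j * bil m k (?E i * R j) Q ^ N)"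
      if "i < l" "Q \<in> carrier_mat m k" for i Q
      using bil_adjoint[OF E[OF gc[OF that(1)]] R that(2)] EQ[OF gc[OF that(1)] that(2)] by (simp add: expand)
    let ?A = "{..<l} \<times> {..<J}"
    let ?e = "\<lambda>(i, j). c i * b j" and ?r = "\<lambda>(i, j). ($$) (?E i * R j)"
    let ?X = "{..<m} \<times> {..<k}"
    have "(\<Sum>a\<in>?A. \<Sum>a'\<in>?A. ?e a * cnj (?e a') * (\<Sum>v\<in>?X. ?r a v * cnj (?r a' v)) ^ N) =
        (\<Sum>i'<l. cnj (c i') * (\<Sum>i<l. c i * K (star (g i') * g i)))"
    proof -
      have inner: "(\<Sum>v\<in>?X. (?E i * R j) $$ v * cnj ((?E i' * R j') $$ v)) = bil m k (?E i * R j) (cmat (?E i' * R j'))"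
        if "i' < l" for i j i' j'
        unfolding bil_def using carrier_matD[OF ER[OF that, of j']] by (intro sum.cong) (auto simp del: index_mult_mat)
      have Kx: "K (star (g i') * g i) = (\<Sum>j'<J. cnj (b j') * (\<Sum>j<J. b j * bil m k (?E i * R j) (cmat (?E i' * R j')) ^ N))"
        if "i < l" "i' < l" for i i'
      proof -
        have sc: "star (g i') \<in> carrier_mat n n" using gc[OF that(2)] by (simp add: star_def)
        have "transpose_mat (embed m n (star (g i'))) = cmat (?E i')"
          unfolding star_def using embed_transpose[OF nm, of "cmat (g i')"] cmat_embed[OF nm gc[OF that(2)]] gc[OF that(2)]
          by (metis map_carrier_mat transpose_transpose)
        then have t: "transpose_mat (embed m n (star (g i'))) * cmat (R j') = cmat (?E i' * R j')" for j'
          using cmat_mult[OF E[OF gc[OF that(2)]] R] by simp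
        have "cmat (?E i' * R j') \<in> carrier_mat m k" for j' using ER[OF that(2)] by simp
        then show ?thesis
          unfolding K_def transpose_embed_mult[OF sc gc[OF that(1)] cR] t by (simp add: hE[OF that(1)])
      qed
      have "(\<Sum>a\<in>?A. \<Sum>a'\<in>?A. ?e a * cnj (?e a') * (\<Sum>v\<in>?X. ?r a v * cnj (?r a' v)) ^ N) =
          (\<Sum>i<l. \<Sum>j<J. \<Sum>i'<l. \<Sum>j'<J. (c i * b j) * cnj (c i' * b j') *
            bil m k (?E i * R j) (cmat (?E i' * R j')) ^ N)"
      proof -
        have "(\<Sum>a\<in>?A. \<Sum>a'\<in>?A. ?e a * cnj (?e a') * (\<Sum>v\<in>?X. ?r a v * cnj (?r a' v)) ^ N) =
            (\<Sum>a\<in>?A. \<Sum>a'\<in>?A. (c (fst a) * b (snd a)) * cnj (c (fst a') * b (snd a')) *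
              bil m k (?E (fst a) * R (snd a)) (cmat (?E (fst a') * R (snd a'))) ^ N)"
          by (intro sum.cong refl) (auto simp: inner)
        then show ?thesis by (simp only: sum.cartesian_product' fst_conv snd_conv)
      qed
      also have "\<dots> = (\<Sum>i<l. \<Sum>i'<l. \<Sum>j<J. \<Sum>j'<J. (c i * b j) * cnj (c i' * b j') *
            bil m k (?E i * R j) (cmat (?E i' * R j')) ^ N)"
        by (intro sum.cong refl sum.swap)
      also have "\<dots> = (\<Sum>i<l. \<Sum>i'<l. \<Sum>j'<J. \<Sum>j<J. (c i * b j) * cnj (c i' * b j') *
            bil m k (?E i * R j) (cmat (?E i' * R j')) ^ N)"
        by (intro sum.cong refl sum.swap)
      also have "\<dots> = (\<Sum>i'<l. \<Sum>i<l. \<Sum>j'<J. \<Sum>j<J. (c i * b j) * cnj (c i' * b j') *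
            bil m k (?E i * R j) (cmat (?E i' * R j')) ^ N)"
        by (rule sum.swap)
      also have "\<dots> = (\<Sum>i'<l. cnj (c i') * (\<Sum>i<l. c i * K (star (g i') * g i)))"
        by (intro sum.cong refl) (simp add: Kx sum_distrib_left mult_ac)
      finally show ?thesis .
    qed
    also have "\<dots> = 0"
      by (rule sum.neutral) (use zero[OF star_GL[OF g]] in simp)
    finally have "(\<Sum>a\<in>?A. ?e a * (\<Sum>v\<in>?X. ?r a v * Q $$ v) ^ N) = 0"
      by (intro power_sum_zero) auto
    then have "(\<Sum>a\<in>?A. (c (fst a) * b (snd a)) * bil m k (?E (fst a) * R (snd a)) Q ^ N) = 0"
      by (simp only: bil_def case_prod_unfold)
    then have "(\<Sum>i<l. \<Sum>j<J. (c i * b j) * bil m k (?E i * R j) Q ^ N) = 0"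
      by (simp only: sum.cartesian_product' fst_conv snd_conv)
    moreover have "(\<Sum>i<l. fscale (c i) (GLn_act m k n (g i) f)) Q =
        (\<Sum>i<l. \<Sum>j<J. (c i * b j) * bil m k (?E i * R j) Q ^ N)"
      unfolding sum_fun_apply pointwise_scale_def
      by (intro sum.cong refl) (simp add: GLn_act_apply[OF nm g] hE True sum_distrib_left mult_ac)
    ultimately show ?thesis by simp
  next
    case False
    then show ?thesis
      unfolding sum_fun_apply pointwise_scale_def by (simp add: GLn_act_apply[OF nm g])
  qed
qed

end

subsection \<open>Comparison with a model of the irreducible representation\<close>

text \<open>Scaling all columns by \<open>s\<close> shows that \<open>f\<close> is homogeneous, of
  degree the sum of the \<open>F j\<close>, and therefore a sum of powers of linear forms.\<close>

lemma B_component_hw_function: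
  assumes nm: "n \<le> m" and f: "f \<in> B_component m k n F D"
  shows "\<exists>J N b R. hw_function m k n F D f J N b R"
proof -
  let ?p = "\<lambda>x. f (mat m k x)"
  let ?N = "\<Sum>j<k. F j"
  let ?X = "{..<m} \<times> {..<k}"
  have p: "?p \<in> hw_array m k n F D" by (rule B_component_hw_array[OF nm f])
  have hom: "?p (\<lambda>i. s * x i) = s ^ ?N * ?p x" if "s \<noteq> 0" for s :: complex and x :: array
  proof -
    have "?p (colscale (\<lambda>_. s) x) = (\<Prod>j<k. s ^ F j) * ?p x"
      by (rule hw_arrayD(3)[OF p]) (use that in simp)
    moreover have "colscale (\<lambda>_. s) x = (\<lambda>i. s * x i)" by (auto simp: colscale_def fun_eq_iff)
    ultimately show ?thesis by (simp add: power_sum)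
  qed
  have "\<exists>J b r. \<forall>x. ?p x = (\<Sum>j<J::nat. b j * (\<Sum>i\<in>?X. r j i * x i) ^ ?N)"
    by (rule homogeneous_power_sum[OF hw_arrayD(1)[OF p]]) (simp, rule hom)
  then obtain J b r where e: "\<forall>x. ?p x = (\<Sum>j<J::nat. b j * (\<Sum>i\<in>?X. r j i * x i) ^ ?N)"
    by (elim exE)
  have "hw_function m k n F D f J ?N b (\<lambda>j. mat m k (r j))"
  proof
    fix Q :: "complex mat" assume Q: "Q \<in> carrier_mat m k"
    have "f Q = ?p (($$) Q)" by (simp add: mat_index_eta[OF Q])
    also have "\<dots> = (\<Sum>j<J. b j * (\<Sum>i\<in>?X. r j i * Q $$ i) ^ ?N)" by (rule e[rule_format])
    also have "\<dots> = (\<Sum>j<J. b j * bil m k (mat m k (r j)) Q ^ ?N)"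
      unfolding bil_def by (intro sum.cong refl arg_cong2[of _ _ _ _ "(*)"] arg_cong2[of _ _ _ _ "(^)"]) auto
    finally show "f Q = (\<Sum>j<J. b j * bil m k (mat m k (r j)) Q ^ ?N)" .
  qed (use nm f in auto)
  then show ?thesis by blast
qed

lemma sum_append:
  fixes a :: "nat \<Rightarrow> 'a::comm_monoid_add"
  shows "(\<Sum>i<l + l'. if i < l then a i else b (i - l)) = (\<Sum>i<l. a i) + (\<Sum>i<l'. b i)"
proof (induction l')
  case (Suc l')
  then show ?case by (simp add: add.assoc)
qed (auto intro!: sum.cong)

locale irreducible_model =
  fixes n :: nat and D :: "nat \<Rightarrow> nat" and sc :: "complex \<Rightarrow> 'v::ab_group_add \<Rightarrow> 'v"
    and V :: "'v set" and \<rho> :: "complex mat \<Rightarrow> 'v \<Rightarrow> 'v" and v :: 'v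
  assumes irrep: "irrep_hw n D sc V \<rho>" and v: "v \<in> hw_space n sc V \<rho> D" "v \<noteq> 0"
begin

lemma GL_rep: "GL_rep n sc V \<rho>"
  using irrep by (simp add: irrep_hw_def irreducible_rep_def)

sublocale vector_space sc
  using GL_rep by (simp add: GL_rep_def)

lemma V_subspace: "subspace V"
  using GL_rep by (simp add: GL_rep_def)

lemma v_in: "v \<in> V"
  using v by (simp add: hw_space_def)

lemma v_unipotent: "u \<in> unipotent n \<Longrightarrow> \<rho> u v = v"
  using v by (simp add: hw_space_def)

lemma v_torus: "a \<in> torus n \<Longrightarrow> \<rho> a v = sc (torus_char n D a) v"
  using v by (simp add: hw_space_def)

lemma act_in: "g \<in> GL n \<Longrightarrow> x \<in> V \<Longrightarrow> \<rho> g x \<in> V"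
  using GL_rep by (auto simp: GL_rep_def)

lemma act_add: "g \<in> GL n \<Longrightarrow> x \<in> V \<Longrightarrow> y \<in> V \<Longrightarrow> \<rho> g (x + y) = \<rho> g x + \<rho> g y"
  using GL_rep by (simp add: GL_rep_def linear_on_def)

lemma act_scale: "g \<in> GL n \<Longrightarrow> x \<in> V \<Longrightarrow> \<rho> g (sc c x) = sc c (\<rho> g x)"
  using GL_rep by (simp add: GL_rep_def linear_on_def)

lemma act_one: "x \<in> V \<Longrightarrow> \<rho> (1\<^sub>m n) x = x"
  using GL_rep by (simp add: GL_rep_def)

lemma act_mult: "g \<in> GL n \<Longrightarrow> h \<in> GL n \<Longrightarrow> x \<in> V \<Longrightarrow> \<rho> (g * h) x = \<rho> g (\<rho> h x)"
  using GL_rep by (simp add: GL_rep_def)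

lemma act_sum:
  fixes l :: nat
  assumes "g \<in> GL n" and "\<And>i. i < l \<Longrightarrow> x i \<in> V"
  shows "\<rho> g (\<Sum>i<l. sc (c i) (x i)) = (\<Sum>i<l. sc (c i) (\<rho> g (x i)))"
  using assms(2)
proof (induction l)
  case 0
  have "\<rho> g (sc 0 0) = sc 0 (\<rho> g 0)"
    by (rule act_scale[OF assms(1) subspace_0[OF V_subspace]])
  then show ?case by simp
next
  case (Suc l)
  have "(\<Sum>i<l. sc (c i) (x i)) \<in> V"
    using Suc.prems by (intro subspace_sum[OF V_subspace] subspace_scale[OF V_subspace]) auto
  moreover have "sc (c l) (x l) \<in> V" using Suc.prems by (intro subspace_scale[OF V_subspace]) simp
  ultimately show ?case using Suc act_add[OF assms(1)] act_scale[OF assms(1)] by simp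
qed

text \<open>Irreducibility in the form in which it is applied: to the domain of a relation, to an
  equalizer and to a kernel.\<close>

lemma subrep_cases:
  assumes "W \<subseteq> V" and "subspace W" and "\<And>g x. g \<in> GL n \<Longrightarrow> x \<in> W \<Longrightarrow> \<rho> g x \<in> W"
  shows "W = {0} \<or> W = V"
proof -
  have "GL_rep n sc W \<rho>"
    unfolding GL_rep_def linear_on_def
    using assms vector_space_axioms act_add act_scale act_one act_mult by (auto simp: subset_eq)
  then show ?thesis using irrep assms(1) by (simp add: irrep_hw_def irreducible_rep_def)
qed

text \<open>The coordinate functional of a basis vector that occurs in \<open>v\<close>.\<close>

lemma matrix_coefficient:
  "\<exists>\<xi> P. P \<in> poly_funs n n \<and> (\<forall>x\<in>V. \<forall>y\<in>V. \<xi> (x + y) = \<xi> x + \<xi> y) \<and>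
    (\<forall>c. \<forall>x\<in>V. \<xi> (sc c x) = c * \<xi> x) \<and> (\<forall>g\<in>GL n. \<xi> (\<rho> g v) = P g) \<and> \<xi> v \<noteq> (0 :: complex)"
proof -
  obtain B p where B: "finite B" "is_basis sc B V" and p: "\<forall>b\<in>B. \<forall>b'\<in>B. p b b' \<in> poly_funs n n"
    and act: "\<forall>g\<in>GL n. \<forall>b\<in>B. \<rho> g b = (\<Sum>b'\<in>B. sc (p b b' g) b')"
    using irrep unfolding irrep_hw_def polynomial_rep_def by (elim conjE exE)
  have ind: "independent B" and span: "span B = V" using B(2) by (auto simp: is_basis_def)
  let ?r = "representation B"
  have vsum: "(\<Sum>b\<in>B. sc (?r v b) b) = v"
    by (rule sum_representation_eq[OF ind]) (use span v_in B(1) in auto)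
  have "\<exists>b0\<in>B. ?r v b0 \<noteq> 0"
  proof (rule ccontr)
    assume "\<not> ?thesis"
    then have "(\<Sum>b\<in>B. sc (?r v b) b) = 0" by (intro sum.neutral) simp
    then show False using vsum v(2) by simp
  qed
  then obtain b0 where b0: "b0 \<in> B" "?r v b0 \<noteq> 0" by blast
  let ?P = "\<lambda>g. \<Sum>b\<in>B. ?r v b * p b b0 g"
  have BV: "b \<in> V" if "b \<in> B" for b using that span span_base by blast
  show ?thesis
  proof (rule exI[of _ "\<lambda>x. ?r x b0"], rule exI[of _ ?P], intro conjI ballI allI)
    have "?P = (\<Sum>b\<in>B. fscale (?r v b) (p b b0))" by (auto simp: fun_eq_iff sum_fun_apply pointwise_scale_def)
    also have "\<dots> \<in> poly_funs n n"
      using p b0(1) by (intro fscale.subspace_sum[OF poly_funs_subspace] fscale.subspace_scale[OF poly_funs_subspace]) auto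
    finally show "?P \<in> poly_funs n n" .
    show "?r (x + y) b0 = ?r x b0 + ?r y b0" if "x \<in> V" "y \<in> V" for x y
      using representation_add[OF ind] that span by auto
    show "?r (sc c x) b0 = c * ?r x b0" if "x \<in> V" for c x
      using representation_scale[OF ind] that span by auto
    show "?r (\<rho> g v) b0 = ?P g" if g: "g \<in> GL n" for g
    proof -
      \<comment> \<open>The basis is enumerated because \<open>act_sum\<close> speaks of sums over
        an initial segment of the numbers.\<close>
      obtain e where e: "bij_betw e {..<card B} B" using B(1) by (metis atLeast0LessThan ex_bij_betw_nat_finite)
      have re: "(\<Sum>b\<in>B. h b) = (\<Sum>i<card B. h (e i))" for h :: "'v \<Rightarrow> 'v"
        by (rule sum.reindex_bij_betw[OF e, symmetric])
      have eB: "e i \<in> B" if "i < card B" for i using e that by (auto simp: bij_betw_def)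
      have "\<rho> g v = \<rho> g (\<Sum>i<card B. sc (?r v (e i)) (e i))"
        unfolding re[of "\<lambda>b. sc (?r v b) b", symmetric] vsum ..
      also have "\<dots> = (\<Sum>i<card B. sc (?r v (e i)) (\<rho> g (e i)))"
        by (rule act_sum[OF g]) (use eB BV in auto)
      also have "\<dots> = (\<Sum>b\<in>B. sc (?r v b) (\<rho> g b))" by (rule re[symmetric])
      finally have gv: "\<rho> g v = (\<Sum>b\<in>B. sc (?r v b) (\<rho> g b))" .
      have gb: "?r (\<rho> g b) b0 = p b b0 g" if b: "b \<in> B" for b
      proof -
        have "?r (\<rho> g b) b0 = (\<Sum>b'\<in>B. ?r (sc (p b b' g) b') b0)"
          using act g b representation_sum[OF ind, of B "\<lambda>b'. sc (p b b' g) b'"] span_scale span_base by simp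
        also have "\<dots> = (\<Sum>b'\<in>B. if b' = b0 then p b b' g else 0)"
          by (rule sum.cong) (auto simp: representation_scale[OF ind span_base] representation_basis[OF ind])
        also have "\<dots> = p b b0 g" using B(1) b0(1) by simp
        finally show ?thesis .
      qed
      have gbV: "\<rho> g b \<in> span B" if "b \<in> B" for b using act_in[OF g BV[OF that]] span by simp
      have "?r (\<rho> g v) b0 = (\<Sum>b\<in>B. ?r (sc (?r v b) (\<rho> g b)) b0)"
        unfolding gv using representation_sum[OF ind, of B "\<lambda>b. sc (?r v b) (\<rho> g b)"] span_scale gbV by simp
      also have "\<dots> = ?P g"
        by (rule sum.cong) (auto simp: representation_scale[OF ind gbV] gb)
      finally show ?thesis .
    qed
    show "?r v b0 \<noteq> 0" by (rule b0(2))
  qed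
qed

end

locale model_and_function = irreducible_model n D sc V \<rho> v + hw_function m k n F D f J N b R
  for m k n :: nat and F D :: "nat \<Rightarrow> nat" and sc :: "complex \<Rightarrow> 'v::ab_group_add \<Rightarrow> 'v"
    and V \<rho> v f J N b R
begin

text \<open>Letting the torus element \<open>diag (1, s, s\<^sup>2, \<dots>)\<close> act singles out, as the coefficient of
  \<open>s\<^bsup>d\<^esup>\<close> with \<open>d = \<Sum> i D\<^sub>i\<close>, the part of weight \<open>D\<close> of the matrix coefficient.
  On the big cell it is proportional to \<open>K\<close>, hence everywhere.\<close>

lemma relation_K:
  fixes l :: nat
  assumes g: "\<And>i. i < l \<Longrightarrow> g i \<in> GL n" and rel: "(\<Sum>i<l. sc (c i) (\<rho> (g i) v)) = 0" and h: "h \<in> GL n"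
  shows "(\<Sum>i<l. c i * K (h * g i)) = 0"
proof -
  from matrix_coefficient obtain \<xi> P where P: "P \<in> poly_funs n n"
    and add: "\<forall>x\<in>V. \<forall>y\<in>V. \<xi> (x + y) = \<xi> x + \<xi> y"
    and scale': "\<forall>c. \<forall>x\<in>V. \<xi> (sc c x) = c * \<xi> x"
    and Pv': "\<forall>g\<in>GL n. \<xi> (\<rho> g v) = P g" and nz: "\<xi> v \<noteq> (0 :: complex)"
    by (elim exE conjE)
  note scale = scale'[rule_format] and Pv = Pv'[rule_format]
  define Pa where "Pa x = P (mat n n x)" for x
  have Pa: "Pa \<in> polyf ({..<n} \<times> {..<n})" unfolding Pa_def[abs_def] by (rule poly_funs_imp_polyf[OF P])
  from polyf_graded[OF Pa, of fst] obtain M q where q': "\<forall>e. q e \<in> polyf ({..<n} \<times> {..<n})"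
    and qM': "\<forall>e x. M < e \<longrightarrow> q e x = 0"
    and qs': "\<forall>s x. Pa (\<lambda>i. s ^ fst i * x i) = (\<Sum>e\<le>M. q e x * s ^ e)"
    by (elim exE conjE)
  note q = q'[rule_format] and qM = qM'[rule_format] and qs = qs'[rule_format]
  define d where "d = (\<Sum>i<n. i * D i)"
  define T where "T s = mat n n (\<lambda>(i, j). if i = j then s ^ i else 0)" for s :: complex
  have T: "T s \<in> torus n" if "s \<noteq> 0" for s unfolding T_def by (rule torus_diag) (use that in simp)
  have Tc: "T s \<in> carrier_mat n n" for s by (simp add: T_def)
  have Tchar: "torus_char n D (T s) = s ^ d" for s
    by (simp add: torus_char_def T_def d_def power_sum power_mult)
  have PT: "P (T s * g) = (\<Sum>e\<le>M. q e (($$) g) * s ^ e)" if g: "g \<in> carrier_mat n n" for s g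
  proof -
    have "T s * g = mat n n (\<lambda>i. s ^ fst i * g $$ i)"
      by (rule eq_matI) (use g in \<open>auto simp: T_def scalar_prod_def if_distrib[of "\<lambda>z. z * _"] sum.delta cong: if_cong\<close>)
    then show ?thesis using qs[of s "($$) g"] by (simp add: Pa_def)
  qed
  have P1: "P (1\<^sub>m n) = \<xi> v" using Pv[OF GL_one] act_one[OF v_in] by simp
  \<comment> \<open>Both \<open>q d\<close> and \<open>K\<close> turn out to be
    \<open>torus_char n D a\<close> times a constant at \<open>L * a * U\<close>;
    \<open>\<Phi>\<close> is the resulting cross-multiplied difference.\<close>
  define \<Phi> where "\<Phi> x = K (1\<^sub>m n) * q d x - P (1\<^sub>m n) * K (mat n n x)" for x
  have "\<Phi> x = 0" for x
  proof (rule big_cell_dense[where \<Phi> = \<Phi> and n = n])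
    show "\<Phi> \<in> polyf ({..<n} \<times> {..<n})"
      unfolding \<Phi>_def[abs_def] by (intro polyf_diff polyf.mult polyf.const q K_polyf)
    fix L a U assume L: "transpose_mat L \<in> unipotent n" and a: "a \<in> torus n" and U: "U \<in> unipotent n"
    have Lc: "L \<in> carrier_mat n n" using unipotentD(1)[OF L] by simp
    have L0: "L $$ (i, j) = 0" if "i < j" "j < n" for i j
      using unipotentD(2)[OF L that(2,1)] that Lc by simp
    have L1: "L $$ (i, i) = 1" if "i < n" for i using unipotentD(3)[OF L that] that Lc by simp
    note ac = torusD(1)[OF a] and Uc = unipotentD(1)[OF U]
    let ?x = "($$) (L * a * U)"
    have mx: "mat n n ?x = L * a * U" by (rule mat_index_eta) (use Lc ac Uc in simp)
    \<comment> \<open>The conjugate of \<open>L\<close> by \<open>T s\<close>, with entries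
      \<open>s ^ (i - j) * L $$ (i, j)\<close>. As \<open>L\<close> is lower triangular it extends
      polynomially to \<open>s = 0\<close>, where it is the identity.\<close>
    define Ls where "Ls s = mat n n (\<lambda>i. poly (if snd i \<le> fst i then monom (L $$ i) (fst i - snd i) else 0) s)" for s
    obtain Pl where Pl: "\<forall>s. Pa (\<lambda>i. poly (if snd i \<le> fst i then monom (L $$ i) (fst i - snd i) else 0) s) = poly Pl s"
      using polyf_line[OF Pa] by (rule exE)
    then have PLs: "P (Ls s) = poly Pl s" for s by (simp add: Pa_def Ls_def)
    have Lsc: "Ls s \<in> carrier_mat n n" for s by (simp add: Ls_def)
    have "Ls 0 = 1\<^sub>m n"
      by (rule eq_matI) (auto simp: Ls_def poly_monom L1 power_0_left)
    then have Pl0: "poly Pl 0 = P (1\<^sub>m n)" using PLs[of 0] by simp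
    have LsGL: "Ls s \<in> GL n" for s
    proof -
      have "transpose_mat (Ls s) \<in> unipotent n"
        by (rule unipotentI) (auto simp: Ls_def L1 poly_monom)
      from GL_transpose[OF unipotent_GL[OF this]] show ?thesis by simp
    qed
    have "(\<Sum>e\<le>M. q e ?x * s ^ e) = torus_char n D a * s ^ d * poly Pl s" if s: "s \<noteq> 0" for s
    proof -
      have TL: "T s * L = Ls s * T s"
      proof (rule eq_matI)
        fix i j assume "i < dim_row (Ls s * T s)" "j < dim_col (Ls s * T s)"
        then have ij: "i < n" "j < n" using carrier_matD[OF Lsc[of s]] carrier_matD[OF Tc[of s]] by auto
        have "(T s * L) $$ (i, j) = s ^ i * L $$ (i, j)"
          using ij Lc by (simp add: T_def scalar_prod_def if_distrib[of "\<lambda>z. z * _"] sum.delta cong: if_cong)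
        moreover have "(Ls s * T s) $$ (i, j) = Ls s $$ (i, j) * s ^ j"
          using ij by (simp add: T_def Ls_def scalar_prod_def if_distrib[of "\<lambda>z. _ * z"] sum.delta' cong: if_cong)
        moreover have "Ls s $$ (i, j) * s ^ j = s ^ i * L $$ (i, j)"
        proof (cases "j \<le> i")
          case True
          then have "s ^ i = s ^ (i - j) * s ^ j" by (simp flip: power_add)
          then show ?thesis using True ij by (simp add: Ls_def poly_monom)
        next
          case False
          then show ?thesis using ij L0[of i j] by (simp add: Ls_def)
        qed
        ultimately show "(T s * L) $$ (i, j) = (Ls s * T s) $$ (i, j)" by simp
      qed (use carrier_matD[OF Lc] carrier_matD[OF Lsc[of s]] carrier_matD[OF Tc[of s]] in auto)
      have aU: "a * U \<in> carrier_mat n n" using ac Uc by simp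
      have "T s * (L * a * U) = T s * (L * (a * U))"
        by (simp only: assoc_mult_mat[OF Lc ac Uc])
      also have "\<dots> = (T s * L) * (a * U)" by (rule assoc_mult_mat[OF Tc Lc aU, symmetric])
      also have "\<dots> = Ls s * (T s * (a * U))" unfolding TL by (rule assoc_mult_mat[OF Lsc Tc aU])
      finally have prod: "T s * (L * a * U) = Ls s * (T s * (a * U))" .
      have GLs: "T s \<in> GL n" "a \<in> GL n" "U \<in> GL n"
        using torus_GL T[OF s] a unipotent_GL U by auto
      have "\<rho> (Ls s * (T s * (a * U))) v = sc (torus_char n D a * s ^ d) (\<rho> (Ls s) v)"
        using GLs LsGL GL_mult act_mult act_scale v_in act_in
        by (simp add: v_unipotent[OF U] v_torus[OF a] v_torus[OF T[OF s]] Tchar mult.commute)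
      then have "\<xi> (\<rho> (T s * (L * a * U)) v) = torus_char n D a * s ^ d * P (Ls s)"
        unfolding prod using scale[OF act_in[OF LsGL v_in]] Pv[OF LsGL] by simp
      moreover have "T s * (L * a * U) \<in> GL n"
        unfolding prod using GLs LsGL GL_mult by blast
      ultimately have "P (T s * (L * a * U)) = torus_char n D a * s ^ d * poly Pl s"
        using Pv PLs by simp
      then show ?thesis using PT[of "L * a * U" s] Lc ac Uc by simp
    qed
    then have "(\<Sum>e\<le>M. monom (q e ?x) e) - smult (torus_char n D a) (monom 1 d * Pl) = 0"
      by (intro poly_eq_0_if_cofinite[of "{0}"]) (auto simp: poly_sum poly_monom mult.assoc)
    then have "coeff (\<Sum>e\<le>M. monom (q e ?x) e) d = coeff (smult (torus_char n D a) (monom 1 d * Pl)) d"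
      by simp
    moreover have "coeff (\<Sum>e\<le>M. monom (q e ?x) e) d = q d ?x"
      using qM[of d ?x] by (cases "d \<le> M") (auto simp: coeff_sum coeff_monom)
    \<comment> \<open>Only the constant term of \<open>Pl\<close> reaches the power
      \<open>s ^ d\<close>, and it is the value of \<open>P\<close> at \<open>Ls 0\<close>.\<close>
    moreover have "coeff (smult (torus_char n D a) (monom 1 d * Pl)) d = torus_char n D a * P (1\<^sub>m n)"
      using Pl0 by (simp add: coeff_monom_mult poly_0_coeff_0)
    ultimately have "q d ?x = torus_char n D a * P (1\<^sub>m n)" by simp
    then show "\<Phi> ?x = 0" unfolding \<Phi>_def mx K_cell[OF L a U] by simp
  qed
  then have proportional: "P (1\<^sub>m n) * K g = K (1\<^sub>m n) * q d (($$) g)" if "g \<in> carrier_mat n n" for g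
    using mat_index_eta[OF that] unfolding \<Phi>_def by (metis right_minus_eq)
  have hg: "h * g i \<in> GL n" if "i < l" for i using GL_mult[OF h g[OF that]] .
  have "(\<Sum>i<l. c i * q d (($$) (h * g i))) = 0"
  proof (cases "d \<le> M")
    case True
    \<comment> \<open>The relation is moved by \<open>T s * h\<close> and evaluated by
      \<open>\<xi>\<close>; since \<open>s\<close> varies, every power of \<open>s\<close> vanishes
      separately.\<close>
    have "(\<Sum>e\<le>M. (\<Sum>i<l. c i * q e (($$) (h * g i))) * s ^ e) = 0" if "s \<notin> {0}" for s
    proof -
      have s: "s \<noteq> 0" using that by simp
      have Th: "T s * h \<in> GL n" by (rule GL_mult[OF torus_GL[OF T[OF s]] h])
      have gv: "\<rho> (g i) v \<in> V" if "i < l" for i by (rule act_in[OF g[OF that] v_in])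
      have sum_coeff: "\<xi> (\<Sum>i<l. sc (c i) (y i)) = (\<Sum>i<l. c i * \<xi> (y i))" if "\<And>i. i < l \<Longrightarrow> y i \<in> V" for y :: "nat \<Rightarrow> 'v" and l :: nat
        using that
      proof (induction l)
        case 0
        then show ?case using scale[OF subspace_0[OF V_subspace], of 0] by simp
      next
        case (Suc l)
        have "(\<Sum>i<l. sc (c i) (y i)) \<in> V"
          using Suc.prems by (intro subspace_sum[OF V_subspace] subspace_scale[OF V_subspace]) auto
        moreover have "sc (c l) (y l) \<in> V" using Suc.prems by (intro subspace_scale[OF V_subspace]) simp
        ultimately show ?case using Suc add scale by simp
      qed
      have "0 = \<xi> (\<rho> (T s * h) (\<Sum>i<l. sc (c i) (\<rho> (g i) v)))"
        unfolding rel using act_scale[OF Th subspace_0[OF V_subspace], of 0] scale[OF subspace_0[OF V_subspace], of 0]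
        by simp
      also have "\<dots> = (\<Sum>i<l. c i * \<xi> (\<rho> (T s * h) (\<rho> (g i) v)))"
        using act_sum[OF Th gv] sum_coeff[OF act_in[OF Th gv]] by simp
      also have "\<dots> = (\<Sum>i<l. c i * P (T s * (h * g i)))"
      proof (rule sum.cong[OF refl])
        fix i assume "i \<in> {..<l}"
        then have i: "i < l" by simp
        have "\<rho> (T s * h) (\<rho> (g i) v) = \<rho> (T s * h * g i) v" by (rule act_mult[OF Th g[OF i] v_in, symmetric])
        also have "T s * h * g i = T s * (h * g i)"
          by (rule assoc_mult_mat[OF Tc GL_carrier[OF h] GL_carrier[OF g[OF i]]])
        finally show "c i * \<xi> (\<rho> (T s * h) (\<rho> (g i) v)) = c i * P (T s * (h * g i))"
          using Pv[OF GL_mult[OF torus_GL[OF T[OF s]] hg[OF i]]] by simp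
      qed
      also have "\<dots> = (\<Sum>i<l. \<Sum>e\<le>M. c i * q e (($$) (h * g i)) * s ^ e)"
        by (rule sum.cong) (auto simp: PT[OF GL_carrier[OF hg]] sum_distrib_left mult.assoc)
      also have "\<dots> = (\<Sum>e\<le>M. \<Sum>i<l. c i * q e (($$) (h * g i)) * s ^ e)" by (rule sum.swap)
      finally show ?thesis by (simp add: sum_distrib_right)
    qed
    from coeffs_eq_0_if_cofinite[where A = "{0}" and a = "\<lambda>e. \<Sum>i<l. c i * q e (($$) (h * g i))", OF _ this True]
    show ?thesis by simp
  qed (simp add: qM)
  then have "P (1\<^sub>m n) * (\<Sum>i<l. c i * K (h * g i)) = 0"
  proof -
    assume z: "(\<Sum>i<l. c i * q d (($$) (h * g i))) = 0"
    have "P (1\<^sub>m n) * (\<Sum>i<l. c i * K (h * g i)) = (\<Sum>i<l. c i * (P (1\<^sub>m n) * K (h * g i)))"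
      by (simp add: sum_distrib_left mult_ac)
    also have "\<dots> = (\<Sum>i<l. c i * (K (1\<^sub>m n) * q d (($$) (h * g i))))"
      by (intro sum.cong refl) (simp add: proportional[OF GL_carrier[OF hg]])
    also have "\<dots> = K (1\<^sub>m n) * (\<Sum>i<l. c i * q d (($$) (h * g i)))"
      by (simp add: sum_distrib_left mult_ac)
    finally show ?thesis using z by simp
  qed
  then show ?thesis using nz P1 by simp
qed

lemma relation_transfer:
  fixes l :: nat
  assumes "\<And>i. i < l \<Longrightarrow> g i \<in> GL n" and "(\<Sum>i<l. sc (c i) (\<rho> (g i) v)) = 0"
  shows "(\<Sum>i<l. fscale (c i) (GLn_act m k n (g i) f)) = 0"
  by (rule combination_zero[OF assms(1)]) (use relation_K[OF assms] in auto)

end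

subsection \<open>Intertwining operators\<close>

lemma GLn_act_sum:
  assumes "n \<le> m" and "X \<in> GL n"
  shows "GLn_act m k n X (\<Sum>i\<in>I. fscale (c i) (f i)) = (\<Sum>i\<in>I. fscale (c i) (GLn_act m k n X (f i)))"
proof (induction I rule: infinite_finite_induct)
  case empty
  then show ?case by (auto simp: GLn_act_apply[OF assms] fun_eq_iff)
next
  case (infinite I)
  then show ?case by (auto simp: GLn_act_apply[OF assms] fun_eq_iff)
next
  case (insert i I)
  show ?case
    unfolding sum.insert[OF insert.hyps] GLn_act_linear[OF assms] insert.IH ..
qed

locale model_in_functions = irreducible_model n D sc V \<rho> v
  for m k n :: nat and F D :: "nat \<Rightarrow> nat" and sc :: "complex \<Rightarrow> 'v::ab_group_add \<Rightarrow> 'v" and V \<rho> v +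
  assumes nm: "n \<le> m"
begin

abbreviation "act \<equiv> GLn_act m k n"
abbreviation "Rho \<equiv> rho_summand m k F"
abbreviation "Hom \<equiv> HomGL n sc V \<rho> fscale Rho act"
abbreviation "B \<equiv> B_component m k n F D"

lemma Rho_act: "g \<in> GL n \<Longrightarrow> f \<in> Rho \<Longrightarrow> act g f \<in> Rho"
  by (rule GLn_act_rho_summand[OF nm])

lemma B_Rho: "f \<in> B \<Longrightarrow> f \<in> Rho"
  by (simp add: B_component_def hw_space_def)

text \<open>The subrepresentation of \<open>V \<times> Rho\<close> generated by \<open>(v, f)\<close>; it is the graph of a map.\<close>

definition rel :: "(complex mat \<Rightarrow> complex) \<Rightarrow> 'v \<Rightarrow> (complex mat \<Rightarrow> complex) \<Rightarrow> bool" where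
  "rel f x y \<longleftrightarrow> (\<exists>(l::nat) c g. (\<forall>i<l. g i \<in> GL n) \<and> x = (\<Sum>i<l. sc (c i) (\<rho> (g i) v)) \<and>
    y = (\<Sum>i<l. fscale (c i) (act (g i) f)))"

lemma rel_base: "f \<in> B \<Longrightarrow> rel f v f"
  unfolding rel_def
proof (intro exI conjI)
  assume "f \<in> B"
  then have f: "f \<in> poly_funs m k" using B_Rho rho_summand_poly_funs by blast
  show "\<forall>i<1::nat. 1\<^sub>m n \<in> GL n" by (simp add: GL_one)
  show "v = (\<Sum>i<1::nat. sc 1 (\<rho> (1\<^sub>m n) v))" by (simp add: act_one[OF v_in])
  show "f = (\<Sum>i<1::nat. fscale 1 (act (1\<^sub>m n) f))" by (simp add: GLn_act_one[OF nm f])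
qed

lemma rel_add:
  assumes "rel f x y" and "rel f x' y'"
  shows "rel f (x + x') (y + y')"
proof -
  obtain l c g where 1: "\<forall>i<l::nat. g i \<in> GL n" "x = (\<Sum>i<l. sc (c i) (\<rho> (g i) v))"
    "y = (\<Sum>i<l. fscale (c i) (act (g i) f))"
    using assms(1) unfolding rel_def by (elim exE conjE)
  obtain l' c' g' where 2: "\<forall>i<l'::nat. g' i \<in> GL n" "x' = (\<Sum>i<l'. sc (c' i) (\<rho> (g' i) v))"
    "y' = (\<Sum>i<l'. fscale (c' i) (act (g' i) f))"
    using assms(2) unfolding rel_def by (elim exE conjE)
  let ?c = "\<lambda>i. if i < l then c i else c' (i - l)" and ?g = "\<lambda>i. if i < l then g i else g' (i - l)"
  have "\<forall>i<l + l'. ?g i \<in> GL n" using 1(1) 2(1) by auto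
  moreover have "x + x' = (\<Sum>i<l + l'. sc (?c i) (\<rho> (?g i) v))"
    unfolding 1(2) 2(2) sum_append[symmetric] by (rule sum.cong) auto
  moreover have "y + y' = (\<Sum>i<l + l'. fscale (?c i) (act (?g i) f))"
    unfolding 1(3) 2(3) sum_append[symmetric] by (rule sum.cong) auto
  ultimately show ?thesis unfolding rel_def by (intro exI conjI)
qed

lemma rel_scale:
  assumes "rel f x y"
  shows "rel f (sc a x) (fscale a y)"
proof -
  obtain l c g where 1: "\<forall>i<l::nat. g i \<in> GL n" "x = (\<Sum>i<l. sc (c i) (\<rho> (g i) v))"
    "y = (\<Sum>i<l. fscale (c i) (act (g i) f))"
    using assms unfolding rel_def by (elim exE conjE)
  have "sc a x = (\<Sum>i<l. sc (a * c i) (\<rho> (g i) v))" unfolding 1(2) by (simp add: scale_sum_right)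
  moreover have "fscale a y = (\<Sum>i<l. fscale (a * c i) (act (g i) f))"
    unfolding 1(3) by (simp add: fscale.scale_sum_right)
  ultimately show ?thesis using 1(1) unfolding rel_def by (intro exI conjI)
qed

lemma rel_act:
  assumes "rel f x y" and h: "h \<in> GL n"
  shows "rel f (\<rho> h x) (act h y)"
proof -
  obtain l c g where 1: "\<forall>i<l::nat. g i \<in> GL n" "x = (\<Sum>i<l. sc (c i) (\<rho> (g i) v))"
    "y = (\<Sum>i<l. fscale (c i) (act (g i) f))"
    using assms unfolding rel_def by (elim exE conjE)
  have "\<rho> h x = (\<Sum>i<l. sc (c i) (\<rho> h (\<rho> (g i) v)))"
    unfolding 1(2) by (rule act_sum[OF h]) (use 1(1) act_in v_in in auto)
  also have "\<dots> = (\<Sum>i<l. sc (c i) (\<rho> (h * g i) v))"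
    by (rule sum.cong) (use 1(1) act_mult[OF h _ v_in] in auto)
  finally have x: "\<rho> h x = (\<Sum>i<l. sc (c i) (\<rho> (h * g i) v))" .
  have "act h y = (\<Sum>i<l. fscale (c i) (act h (act (g i) f)))"
    unfolding 1(3) by (rule GLn_act_sum[OF nm h])
  also have "\<dots> = (\<Sum>i<l. fscale (c i) (act (h * g i) f))"
    by (rule sum.cong) (use 1(1) GLn_act_mult[OF nm h] in auto)
  finally have y: "act h y = (\<Sum>i<l. fscale (c i) (act (h * g i) f))" .
  have "\<forall>i<l. h * g i \<in> GL n" using 1(1) GL_mult[OF h] by auto
  then show ?thesis using x y unfolding rel_def by (intro exI conjI)
qed

lemma rel_in:
  assumes "rel f x y" and f: "f \<in> B"
  shows "x \<in> V" and "y \<in> Rho"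
proof -
  obtain l c g where 1: "\<forall>i<l::nat. g i \<in> GL n" "x = (\<Sum>i<l. sc (c i) (\<rho> (g i) v))"
    "y = (\<Sum>i<l. fscale (c i) (act (g i) f))"
    using assms unfolding rel_def by (elim exE conjE)
  show "x \<in> V" unfolding 1(2)
    using 1(1) act_in v_in by (intro subspace_sum[OF V_subspace] subspace_scale[OF V_subspace]) auto
  show "y \<in> Rho" unfolding 1(3)
    using 1(1) Rho_act[OF _ B_Rho[OF f]]
    by (intro fscale.subspace_sum[OF rho_summand_subspace] fscale.subspace_scale[OF rho_summand_subspace]) auto
qed

text \<open>Relations among the translates of \<open>v\<close> hold for those of \<open>f\<close>,
  so the generated subspace contains no vertical vector.\<close>

lemma rel_zero:
  assumes "rel f 0 y" and f: "f \<in> B"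
  shows "y = 0"
proof -
  obtain l c g where 1: "\<forall>i<l::nat. g i \<in> GL n" "0 = (\<Sum>i<l. sc (c i) (\<rho> (g i) v))"
    "y = (\<Sum>i<l. fscale (c i) (act (g i) f))"
    using assms unfolding rel_def by (elim exE conjE)
  obtain J N b R where "hw_function m k n F D f J N b R"
    using B_component_hw_function[OF nm f] by (elim exE)
  then interpret hw_function m k n F D f J N b R .
  interpret model_and_function m k n F D sc V \<rho> v f J N b R by unfold_locales
  show ?thesis unfolding 1(3) by (rule relation_transfer) (use 1 in auto)
qed

lemma rel_unique:
  assumes "rel f x y" and "rel f x y'" and f: "f \<in> B"
  shows "y = y'"
proof -
  have "rel f (x + sc (- 1) x) (y + fscale (- 1) y')" by (rule rel_add[OF assms(1) rel_scale[OF assms(2)]])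
  then have "y + fscale (- 1) y' = 0" by (intro rel_zero[OF _ f]) simp
  then show ?thesis by simp
qed

text \<open>The domain of the relation is a subrepresentation that contains the nonzero vector
  \<open>v\<close>.\<close>

lemma rel_total:
  assumes f: "f \<in> B" and "x \<in> V"
  shows "\<exists>y. rel f x y"
proof -
  let ?W = "{x. \<exists>y. rel f x y}"
  have "?W = {0} \<or> ?W = V"
  proof (rule subrep_cases)
    show "?W \<subseteq> V" using rel_in(1)[OF _ f] by auto
    show "subspace ?W"
    proof (rule subspaceI)
      show "0 \<in> ?W" using rel_scale[OF rel_base[OF f], of 0] by auto
    qed (use rel_add rel_scale in blast)+
  qed (use rel_act in blast)
  moreover have "v \<in> ?W" using rel_base[OF f] by auto
  ultimately show ?thesis using v(2) assms(2) by auto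
qed

section \<open>Extensions as intertwining operators\<close>

definition extension :: "(complex mat \<Rightarrow> complex) \<Rightarrow> 'v \<Rightarrow> complex mat \<Rightarrow> complex" where
  "extension f x = (if x \<in> V then THE y. rel f x y else 0)"

lemma extension_rel:
  assumes f: "f \<in> B" and x: "x \<in> V"
  shows "rel f x (extension f x)"
proof -
  obtain y where y: "rel f x y" using rel_total[OF f x] by blast
  have "(THE y. rel f x y) = y"
    by (rule the_equality) (rule y, erule rel_unique[OF _ y f])
  then show ?thesis using y x by (simp add: extension_def)
qed

lemma extension_eqI: "f \<in> B \<Longrightarrow> rel f x y \<Longrightarrow> extension f x = y"
  by (rule rel_unique[OF extension_rel]) (auto dest: rel_in(1))

lemma extension_v: "f \<in> B \<Longrightarrow> extension f v = f"
  by (rule extension_eqI) (auto intro: rel_base)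

lemma extension_Hom:
  assumes f: "f \<in> B"
  shows "extension f \<in> Hom"
  unfolding HomGL_def linear_on_def mem_Collect_eq
proof (intro conjI allI ballI impI)
  show "extension f ` V \<subseteq> Rho" using rel_in(2)[OF extension_rel[OF f] f] by auto
next
  fix x assume "x \<notin> V"
  then show "extension f x = 0" by (simp add: extension_def)
next
  fix x y assume "x \<in> V" "y \<in> V"
  then show "extension f (x + y) = extension f x + extension f y"
    by (intro extension_eqI[OF f] rel_add extension_rel[OF f])
next
  fix c x assume "x \<in> V"
  then show "extension f (sc c x) = fscale c (extension f x)"
    by (intro extension_eqI[OF f] rel_scale extension_rel[OF f])
next
  fix g x assume "g \<in> GL n" "x \<in> V"
  then show "extension f (\<rho> g x) = act g (extension f x)"
    by (intro extension_eqI[OF f] rel_act extension_rel[OF f])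
qed

lemma HomD:
  assumes "T \<in> Hom"
  shows "x \<in> V \<Longrightarrow> T x \<in> Rho" and "x \<notin> V \<Longrightarrow> T x = 0"
    and "x \<in> V \<Longrightarrow> y \<in> V \<Longrightarrow> T (x + y) = T x + T y" and "x \<in> V \<Longrightarrow> T (sc c x) = fscale c (T x)"
    and "g \<in> GL n \<Longrightarrow> x \<in> V \<Longrightarrow> T (\<rho> g x) = act g (T x)"
  using assms by (auto simp: HomGL_def linear_on_def)

lemma Hom_zero: "T \<in> Hom \<Longrightarrow> T 0 = 0"
  using HomD(4)[of T 0 0] subspace_0[OF V_subspace] by simp

lemma Hom_value_in_B:
  assumes T: "T \<in> Hom"
  shows "T v \<in> B"
  unfolding B_component_def hw_space_def mem_Collect_eq
proof (intro conjI ballI)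
  show "T v \<in> Rho" by (rule HomD(1)[OF T v_in])
  show "act u (T v) = T v" if "u \<in> unipotent n" for u
    using HomD(5)[OF T unipotent_GL[OF that] v_in] v_unipotent[OF that] by simp
  show "act a (T v) = fscale (torus_char n D a) (T v)" if "a \<in> torus n" for a
    using HomD(5)[OF T torus_GL[OF that] v_in] v_torus[OF that] HomD(4)[OF T v_in] by simp
qed

text \<open>The equalizer of two intertwining operators is a subrepresentation, here one that
  contains \<open>v\<close>.\<close>

lemma Hom_eqI:
  assumes T: "T \<in> Hom" and T': "T' \<in> Hom" and eq: "T v = T' v"
  shows "T = T'"
proof
  fix x
  let ?W = "{x \<in> V. T x = T' x}"
  have "?W = {0} \<or> ?W = V"
  proof (rule subrep_cases)
    show "subspace ?W"
      using subspace_0[OF V_subspace] subspace_add[OF V_subspace] subspace_scale[OF V_subspace]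
      by (intro subspaceI) (auto simp: HomD[OF T] HomD[OF T'] Hom_zero[OF T] Hom_zero[OF T'])
    show "\<rho> g x \<in> ?W" if "g \<in> GL n" "x \<in> ?W" for g x
      using that act_in HomD(5)[OF T] HomD(5)[OF T'] by simp
  qed auto
  moreover have "v \<in> ?W" using v_in eq by simp
  ultimately have W: "?W = V" using v(2) by auto
  show "T x = T' x"
  proof (cases "x \<in> V")
    case True
    then have "x \<in> ?W" unfolding W .
    then show ?thesis by simp
  qed (simp add: HomD(2)[OF T] HomD(2)[OF T'])
qed

lemma Hom_add:
  assumes "T \<in> Hom" and "T' \<in> Hom"
  shows "T + T' \<in> Hom"
  unfolding HomGL_def linear_on_def mem_Collect_eq
  using HomD[OF assms(1)] HomD[OF assms(2)] fscale.subspace_add[OF rho_summand_subspace]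
  by (auto simp: GLn_act_linear[OF nm] fscale.scale_right_distrib)

lemma Hom_scale:
  assumes "T \<in> Hom"
  shows "pointwise_scale fscale a T \<in> Hom"
  unfolding HomGL_def linear_on_def mem_Collect_eq pointwise_scale_def[of fscale]
  using HomD[OF assms] fscale.subspace_scale[OF rho_summand_subspace]
  by (auto simp: GLn_act_linear[OF nm] fscale.scale_right_distrib mult.commute)

text \<open>Evaluation at \<open>v\<close> is inverse to \<open>extension\<close>. Linearity of
  \<open>extension\<close> follows because an operator is determined by its value at
  \<open>v\<close>.\<close>

lemma B_isomorphic_Hom: "isomorphic_spaces fscale B (pointwise_scale fscale) Hom"
  unfolding isomorphic_spaces_def
proof (intro exI conjI)
  note subspace = B_component_subspace[OF nm, of k F D]
  show "linear_on fscale (pointwise_scale fscale) B extension"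
    unfolding linear_on_def
  proof (intro conjI allI ballI)
    fix f g assume fg: "f \<in> B" "g \<in> B"
    note s = fscale.subspace_add[OF subspace fg]
    show "extension (f + g) = extension f + extension g"
      by (rule Hom_eqI[OF extension_Hom[OF s] Hom_add[OF extension_Hom[OF fg(1)] extension_Hom[OF fg(2)]]])
        (simp add: extension_v s fg)
  next
    fix c f assume f: "f \<in> B"
    note s = fscale.subspace_scale[OF subspace f, of c]
    show "extension (fscale c f) = pointwise_scale fscale c (extension f)"
      by (rule Hom_eqI[OF extension_Hom[OF s] Hom_scale[OF extension_Hom[OF f]]])
        (simp add: extension_v[OF s] extension_v[OF f] pointwise_scale_def[of fscale])
  qed
  show "bij_betw extension B Hom"
  proof (rule bij_betw_byWitness[where f' = "\<lambda>T. T v"])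
    show "\<forall>f\<in>B. extension f v = f" by (simp add: extension_v)
    show "\<forall>T\<in>Hom. extension (T v) = T"
    proof
      fix T assume T: "T \<in> Hom"
      show "extension (T v) = T"
        by (rule Hom_eqI[OF extension_Hom[OF Hom_value_in_B[OF T]] T]) (rule extension_v[OF Hom_value_in_B[OF T]])
    qed
    show "extension ` B \<subseteq> Hom" using extension_Hom by blast
    show "(\<lambda>T. T v) ` Hom \<subseteq> B" using Hom_value_in_B by blast
  qed
qed

text \<open>The copy is the image of \<open>extension f\<close>. Its kernel does not contain
  \<open>v\<close>, as \<open>f \<noteq> 0\<close>, so it is zero and the operator is
  injective.\<close>

lemma copy_of_model:
  assumes f: "f \<in> B" "f \<noteq> 0"
  shows "\<exists>W \<subseteq> Rho. GL_rep n fscale W act \<and> isomorphic_reps n sc V \<rho> fscale W act \<and>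
    highest_weight_vector n fscale W act D f"
proof (intro exI conjI)
  let ?T = "extension f"
  let ?W = "?T ` V"
  have T: "?T \<in> Hom" by (rule extension_Hom[OF f(1)])
  note TD = HomD[OF T]
  show WR: "?W \<subseteq> Rho" using TD(1) by auto
  have fW: "f \<in> ?W" using extension_v[OF f(1)] v_in by force
  have "fscale.subspace ?W"
  proof (rule fscale.subspaceI)
    show "0 \<in> ?W" using Hom_zero[OF T] subspace_0[OF V_subspace] by force
  next
    fix y y' assume "y \<in> ?W" "y' \<in> ?W"
    then obtain x x' where x: "x \<in> V" "x' \<in> V" "y = ?T x" "y' = ?T x'" by auto
    show "y + y' \<in> ?W"
      unfolding x(3,4) TD(3)[OF x(1,2), symmetric] by (rule imageI[OF subspace_add[OF V_subspace x(1,2)]])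
  next
    fix c y assume "y \<in> ?W"
    then obtain x where x: "x \<in> V" "y = ?T x" by auto
    show "fscale c y \<in> ?W"
      unfolding x(2) TD(4)[OF x(1), symmetric] by (rule imageI[OF subspace_scale[OF V_subspace x(1)]])
  qed
  moreover have "act g y \<in> ?W" if g: "g \<in> GL n" and y: "y \<in> ?W" for g y
  proof -
    obtain x where x: "x \<in> V" "y = ?T x" using y by auto
    show ?thesis
      unfolding x(2) TD(5)[OF g x(1), symmetric] by (rule imageI[OF act_in[OF g x(1)]])
  qed
  ultimately show "GL_rep n fscale ?W act"
    using rho_summand_GL_rep[OF nm, of k F] WR unfolding GL_rep_def linear_on_def by (auto simp: subset_eq)
  have ker: "{x \<in> V. ?T x = 0} = {0} \<or> {x \<in> V. ?T x = 0} = V"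
  proof (rule subrep_cases)
    show "subspace {x \<in> V. ?T x = 0}"
      using subspace_0[OF V_subspace] subspace_add[OF V_subspace] subspace_scale[OF V_subspace]
      by (intro subspaceI) (auto simp: TD Hom_zero[OF T])
    show "\<rho> g x \<in> {x \<in> V. ?T x = 0}" if "g \<in> GL n" "x \<in> {x \<in> V. ?T x = 0}" for g x
      using that act_in TD(5) Hom_zero[OF T] GLn_act_linear(2)[OF nm, of g k 0 0] by simp
  qed auto
  have "v \<notin> {x \<in> V. ?T x = 0}" using extension_v[OF f(1)] f(2) by simp
  then have ker0: "{x \<in> V. ?T x = 0} = {0}" using ker v_in by auto
  have inj: "inj_on ?T V"
  proof (rule inj_onI)
    fix x y assume xy: "x \<in> V" "y \<in> V" "?T x = ?T y"
    have s: "sc (- 1) y \<in> V" by (rule subspace_scale[OF V_subspace xy(2)])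
    have "?T (x + sc (- 1) y) = 0" using xy s by (simp only: TD(3,4)) simp
    then have "x + sc (- 1) y \<in> {x \<in> V. ?T x = 0}" using subspace_add[OF V_subspace xy(1) s] by simp
    then show "x = y" unfolding ker0 by simp
  qed
  have "?T \<in> HomGL n sc V \<rho> fscale ?W act"
    using T unfolding HomGL_def by auto
  moreover have "bij_betw ?T V ?W" using inj by (simp add: bij_betw_def)
  ultimately show "isomorphic_reps n sc V \<rho> fscale ?W act" unfolding isomorphic_reps_def by blast
  show "highest_weight_vector n fscale ?W act D f"
    using f fW unfolding highest_weight_vector_def B_component_def hw_space_def by simp
qed

end

theorem proposition3p7p2:
  fixes m n k :: nat and F D :: "nat \<Rightarrow> nat"
  assumes "1 \<le> n" and "n < m" and "1 \<le> k" and "k \<le> m" and "(F, D) \<in> Lambda k n"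
  shows
    "inj_on (standard_monomial m k) (tableaux m n F D) \<and>
     is_basis fscale (standard_monomial m k ` tableaux m n F D) (B_component m k n F D) \<and>
     (\<forall>t \<in> tableaux m n F D.
        highest_weight_vector n fscale (rho_summand m k F) (GLn_act m k n) D
          (standard_monomial m k t)) \<and>
     (\<forall>(sc :: complex \<Rightarrow> 'v::ab_group_add \<Rightarrow> 'v) V \<rho>. irrep_hw n D sc V \<rho> \<longrightarrow>
        (\<forall>t \<in> tableaux m n F D. \<exists>W \<subseteq> rho_summand m k F.
           GL_rep n fscale W (GLn_act m k n) \<and>
           isomorphic_reps n sc V \<rho> fscale W (GLn_act m k n) \<and>
           highest_weight_vector n fscale W (GLn_act m k n) D (standard_monomial m k t)) \<and>
        isomorphic_spaces
          fscale (B_component m k n F D)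
          (pointwise_scale fscale)
          (HomGL n sc V \<rho> fscale (rho_summand m k F) (GLn_act m k n)))"
proof -
  have nm: "n \<le> m" using assms(2) by simp
  have F: "antimono F" and k: "\<forall>r\<ge>k. F r = 0" and D: "\<forall>i\<ge>n. D i = 0"
    using assms(5) young_zero by (auto simp: Lambda_def young_def)
  note basis = standard_monomials_basis[OF nm F k D]
  note hwv = standard_monomial_highest_weight_vector[OF nm k]
  have model: "(\<forall>t \<in> tableaux m n F D. \<exists>W \<subseteq> rho_summand m k F.
           GL_rep n fscale W (GLn_act m k n) \<and>
           isomorphic_reps n sc V \<rho> fscale W (GLn_act m k n) \<and>
           highest_weight_vector n fscale W (GLn_act m k n) D (standard_monomial m k t)) \<and>
        isomorphic_spaces fscale (B_component m k n F D) (pointwise_scale fscale)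
          (HomGL n sc V \<rho> fscale (rho_summand m k F) (GLn_act m k n))"
    if irrep: "irrep_hw n D sc V \<rho>" for sc :: "complex \<Rightarrow> 'v \<Rightarrow> 'v" and V \<rho>
  proof -
    \<comment> \<open>Any highest weight vector of the model can serve as \<open>v\<close>.\<close>
    obtain v where v: "highest_weight_vector n sc V \<rho> D v"
      using irrep by (auto simp: irrep_hw_def)
    interpret model_in_functions m k n F D sc V \<rho> v
      by unfold_locales (use irrep v nm in \<open>auto simp: highest_weight_vector_def\<close>)
    have "\<exists>W \<subseteq> rho_summand m k F. GL_rep n fscale W (GLn_act m k n) \<and>
        isomorphic_reps n sc V \<rho> fscale W (GLn_act m k n) \<and>
        highest_weight_vector n fscale W (GLn_act m k n) D (standard_monomial m k t)"
      if "t \<in> tableaux m n F D" for t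
      by (rule copy_of_model)
        (use hwv[OF that] in \<open>auto simp: highest_weight_vector_def B_component_def\<close>)
    then show ?thesis using B_isomorphic_Hom by blast
  qed
  show ?thesis
    using basis hwv model by (intro conjI ballI allI impI) auto
qed

end
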